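(* Let $(M,L,\psi)$ be a weighted Finsler spacetime of dimension $n+1$ and let $\mathsf{J}$ be a nonsingular Lagrange tensor field along a timelike geodesic $\eta:I\to M$ of unit speed. Let $N\in(-\infty,0]\cup[n,+\infty]$ and let $\epsilon\in\mathbb{R}$ satisfy $\epsilon=0$ if $N=0$, and $|\epsilon|<\sqrt{\frac{N}{N-n}}$ if $N\neq0$ (the bound is read as $1$ for $N=+\infty$, and as no restriction for $N=n$). Put $$c=c(N,\epsilon)=\frac1n\Big(1-\epsilon^2\frac{N-n}{N}\Big)>0$$ (with $c(0,0)=\frac1n$ and $c(+\infty,\epsilon)=\frac{1-\epsilon^2}{n}$) and $\xi:=|\det\mathsf{J}_\psi|^{c}$. Then on $I$ $$\xi^{**}\le-c\,\xi\,\mathrm{Ric}_N(\eta^* ).$$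
   Context: **Lorentz–Finsler setting.** $M$ is a connected $C^\infty$-manifold without boundary of dimension $n+1\ge2$. A Lorentz–Finsler structure is a function $L:TM\to\mathbb{R}$ such that $L\in C^\infty(TM\setminus\{0\})$; $L(cv)=c^2L(v)$ for all $v\in TM$, $c>0$; and for every $v\in TM\setminus\{0\}$ the matrix $g_{\alpha\beta}(v)=\frac{\partial^2 L}{\partial v^\alpha\partial v^\beta}(v)$, $\alpha,\beta=0,\dots,n$, is non-degenerate of signature $(-,+,\dots,+)$. It defines a Lorentzian inner product $g_v$ on $T_xM$ (for $v\in T_xM\setminus\{0\}$), with $g_v(v,v)=2L(v)$. A vector $v$ is timelike if $L(v)<0$, lightlike if $L(v)=0$ and $v\ne 0$, causal if timelike or lightlike. A Finsler spacetime is such an $(M,L)$ time-oriented by a smooth vector field $X$ with $L(X(x))<0$ for all $x$. A causal $v\in T_xM$ is future-directed if it lies in the same connected component of $\overline{\Omega'_x}\setminus\{0\}$ as $X(x)$, where $\Omega'_x=\{v\in T_xM: L(v)<0\}$. $\Omega_x$ is the set of future-directed timelike vectors, $\overline\Omega=\bigcup_x\overline\Omega_x$. $F(v)=\sqrt{-2L(v)}$ on causal vectors; a timelike geodesic has unit speed if $F(\dot\eta)\equiv1$. All causal curves and geodesics are future-directed. **Connection and curvature.** With $(g^{\alpha\beta}(v))$ the inverse matrix, set $\widetilde\Gamma^\alpha_{\beta\gamma}(v)=\frac12\sum_\delta g^{\alpha\delta}(v)\big(\frac{\partial g_{\delta\gamma}}{\partial x^\beta}+\frac{\partial g_{\beta\delta}}{\partial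 x^\gamma}-\frac{\partial g_{\beta\gamma}}{\partial x^\delta}\big)(v)$, $G^\alpha(v)=\frac12\sum_{\beta,\gamma}\widetilde\Gamma^\alpha_{\beta\gamma}(v)v^\beta v^\gamma$, $N^\alpha_\beta(v)=\frac{\partial G^\alpha}{\partial v^\beta}(v)$, and $\Gamma^\alpha_{\beta\gamma}(v)=\widetilde\Gamma^\alpha_{\beta\gamma}(v)-\frac12\sum_{\delta,\mu}g^{\alpha\delta}(v)\big(\frac{\partial g_{\delta\gamma}}{\partial v^\mu}N^\mu_\beta+\frac{\partial g_{\beta\delta}}{\partial v^\mu}N^\mu_\gamma-\frac{\partial g_{\beta\gamma}}{\partial v^\mu}N^\mu_\delta\big)(v)$. Along a curve $\eta$, the covariant derivative $Y'=D^{\dot\eta}_{\dot\eta}Y$ has components $\dot Y^\alpha+\sum\Gamma^\alpha_{\beta\gamma}(\dot\eta)\dot\eta^\beta Y^\gamma$; for endomorphism fields $E$, $E'(P)=E(P)'-E(P')$. A causal geodesic is a smooth causal curve with $\ddot\eta^\alpha+2G^\alpha(\dot\eta)=0$. Put $R^\alpha_\beta(v)=2\frac{\partial G^\alpha}{\partial x^\beta}-\sum_\gamma\big(\frac{\partial N^\alpha_\beta}{\partial x^\gamma}v^\gamma-2\frac{\partial N^\alpha_\beta}{\partial v^\gamma}G^\gamma\big)-\sum_\gamma N^\alpha_\gamma N^\gamma_\beta$ (all at $v$), $R_v(w)=\sum R^\alpha_\beta(v)w^\beta\frac{\partial}{\partial x^\alpha}$ and $\mathrm{Ric}(v)=\mathrm{trace}(R_v)$.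 **Weight.** $\psi:\overline\Omega\setminus\{0\}\to\mathbb{R}$ is $C^\infty$ with $\psi(cv)=\psi(v)$ for $c>0$. For a causal geodesic $\eta$, $\psi_\eta(t)=\psi(\dot\eta(t))$. For $v\in\overline\Omega\setminus\{0\}$ and the geodesic $\eta$ with $\dot\eta(0)=v$: $\mathrm{Ric}_N(v)=\mathrm{Ric}(v)+\psi_\eta''(0)-\frac{\psi_\eta'(0)^2}{N-n}$ for $N\in\mathbb{R}\setminus\{n\}$; $\mathrm{Ric}_\infty(v)=\mathrm{Ric}(v)+\psi_\eta''(0)$; $\mathrm{Ric}_n(v)=\mathrm{Ric}(v)+\psi_\eta''(0)$ if $\psi_\eta'(0)=0$ and $-\infty$ otherwise. **Lagrange tensors and $\epsilon$-proper time.** Let $\eta:I\to M$ be a unit-speed timelike geodesic, $N_\eta(t)\subset T_{\eta(t)}M$ the $n$-dimensional $g_{\dot\eta(t)}$-orthogonal complement of $\dot\eta(t)$, and $\mathsf{R}(t)=R_{\dot\eta(t)}:N_\eta(t)\to N_\eta(t)$. A Jacobi tensor field is a smooth field of endomorphisms $\mathsf{J}(t)$ of $N_\eta(t)$ with $\mathsf{J}''+\mathsf{R}\mathsf{J}=0$ and $\ker\mathsf{J}(t)\cap\ker\mathsf{J}'(t)=\{0\}$ for all $t$; it is a Lagrange tensor field if moreover $(\mathsf{J}')^{\mathsf{T}}\mathsf{J}-\mathsf{J}^{\mathsf{T}}\mathsf{J}'=0$ ($\mathsf{T}$ = transpose with respect to $g_{\dot\eta}$). Nonsingular means invertible for all $t\in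 I$. $\mathsf{J}_\psi(t)=e^{-\psi_\eta(t)/n}\mathsf{J}(t)$. The $\epsilon$-proper time is $\tau_\epsilon=\int e^{\frac{2(\epsilon-1)}{n}\psi_\eta(t)}dt$, and $*$ denotes the (covariant) derivative with respect to $\tau_\epsilon$, i.e. $(\cdot)^*=e^{\frac{2(1-\epsilon)}{n}\psi_\eta}(\cdot)'$; $\eta^*(t)=e^{\frac{2(1-\epsilon)}{n}\psi_\eta(t)}\dot\eta(t)$. *)

theory Defs
  imports "HOL-Analysis.Analysis"
begin

section \<open>Smooth maps\<close>

primrec Ck_on_open ::
    "nat \<Rightarrow> ('a::euclidean_space \<Rightarrow> 'b::euclidean_space) \<Rightarrow> 'a set \<Rightarrow> bool" where
  "Ck_on_open 0 f U \<longleftrightarrow> continuous_on U f"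
| "Ck_on_open (Suc k) f U \<longleftrightarrow> (\<forall>x\<in>U. f differentiable (at x)) \<and>
     (\<forall>v. Ck_on_open k (\<lambda>x. frechet_derivative f (at x) v) U)"

text \<open>On an arbitrary set, smooth means that there are local smooth extensions. For open sets
  this is the usual notion; it is also applied to intervals with end points and to the
  cone bundle carrying the weight, which has a boundary.\<close>

definition smooth_on :: "'a::euclidean_space set \<Rightarrow> ('a \<Rightarrow> 'b::euclidean_space) \<Rightarrow> bool" where
  "smooth_on S f \<longleftrightarrow> (\<forall>x\<in>S. \<exists>U g. open U \<and> x \<in> U \<and> (\<forall>k. Ck_on_open k g U) \<and>
     (\<forall>y\<in>S \<inter> U. g y = f y))"


section \<open>Manifolds and tangent vectors\<close>

text \<open>Coordinates are indexed by \<open>'n option\<close>, a type with \<open>CARD('n) + 1 \<ge> 2\<close> elements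
  (\<open>None\<close> plays the role of the index 0). Thus the dimension is \<open>n + 1\<close> with \<open>n = CARD('n)\<close>.\<close>

type_synonym 'n coord = "(real, 'n option) vec"

datatype ('a, 'n::finite) chart = Chart (chart_dom: "'a set") (chart_map: "'a \<Rightarrow> 'n coord")

definition chart_img :: "('a, 'n::finite) chart \<Rightarrow> 'n coord set" where
  "chart_img c = chart_map c ` chart_dom c"

definition chart_inv :: "('a, 'n::finite) chart \<Rightarrow> 'n coord \<Rightarrow> 'a" where
  "chart_inv c = inv_into (chart_dom c) (chart_map c)"

definition smooth_atlas :: "('a::topological_space, 'n::finite) chart set \<Rightarrow> bool" where
  "smooth_atlas A \<longleftrightarrow> (\<Union>c\<in>A. chart_dom c) = UNIV \<and>
     (\<forall>c\<in>A. open (chart_dom c) \<and> open (chart_img c) \<and>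
        homeomorphism (chart_dom c) (chart_img c) (chart_map c) (chart_inv c)) \<and>
     (\<forall>c\<in>A. \<forall>d\<in>A. smooth_on (chart_map c ` (chart_dom c \<inter> chart_dom d))
        (chart_map d \<circ> chart_inv c))"

text \<open>The whole type \<open>'a\<close> is the underlying space of the manifold.\<close>

definition connected_manifold ::
    "('a::{t2_space,second_countable_topology}, 'n::finite) chart set \<Rightarrow> bool" where
  "connected_manifold A \<longleftrightarrow> smooth_atlas A \<and> connected (UNIV :: 'a set)"

text \<open>A tangent vector at \<open>p\<close> is stored as its components in a reference chart chosen at \<open>p\<close>, so
  that each tangent space is the vector space \<open>'n coord\<close>, and a function on the tangent bundle
  is a function of \<open>p\<close> and of these components. The reference chart varies with \<open>p\<close> in an
  arbitrary way; hence every notion involving several base points (smoothness, derivatives along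
  curves) is expressed in the charts of the atlas, with the components converted by
  \<open>transition_deriv\<close>.\<close>

definition ref_chart :: "('a, 'n::finite) chart set \<Rightarrow> 'a \<Rightarrow> ('a, 'n) chart" where
  "ref_chart A p = (SOME c. c \<in> A \<and> p \<in> chart_dom c)"

definition transition_deriv ::
    "('a, 'n::finite) chart \<Rightarrow> ('a, 'n) chart \<Rightarrow> 'a \<Rightarrow> 'n coord \<Rightarrow> 'n coord" where
  "transition_deriv c d p = frechet_derivative (chart_map d \<circ> chart_inv c) (at (chart_map c p))"

definition vec_to_chart ::
    "('a, 'n::finite) chart set \<Rightarrow> ('a, 'n) chart \<Rightarrow> 'a \<Rightarrow> 'n coord \<Rightarrow> 'n coord" where
  "vec_to_chart A c p = transition_deriv (ref_chart A p) c p"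

definition vec_of_chart ::
    "('a, 'n::finite) chart set \<Rightarrow> ('a, 'n) chart \<Rightarrow> 'a \<Rightarrow> 'n coord \<Rightarrow> 'n coord" where
  "vec_of_chart A c p = transition_deriv c (ref_chart A p) p"

text \<open>Expression of a function on the tangent bundle in the bundle coordinates \<open>(x, v)\<close>
  induced by a chart.\<close>

definition in_chart ::
    "('a, 'n::finite) chart set \<Rightarrow> ('a, 'n) chart \<Rightarrow> ('a \<Rightarrow> 'n coord \<Rightarrow> real) \<Rightarrow>
     'n coord \<times> 'n coord \<Rightarrow> real" where
  "in_chart A c f = (\<lambda>(x, v). f (chart_inv c x) (vec_of_chart A c (chart_inv c x) v))"


section \<open>Local expressions of the connection and the curvature\<close>

text \<open>Here \<open>L\<close> is a Lagrangian in bundle coordinates and \<open>z = (x, v)\<close>.\<close>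

definition ddx :: "'n::finite option \<Rightarrow> ('n coord \<times> 'n coord \<Rightarrow> real) \<Rightarrow> 'n coord \<times> 'n coord \<Rightarrow> real"
  where "ddx a f z = frechet_derivative f (at z) (axis a 1, 0)"

definition ddv :: "'n::finite option \<Rightarrow> ('n coord \<times> 'n coord \<Rightarrow> real) \<Rightarrow> 'n coord \<times> 'n coord \<Rightarrow> real"
  where "ddv a f z = frechet_derivative f (at z) (0, axis a 1)"

context
  fixes L :: "'n::finite coord \<times> 'n coord \<Rightarrow> real"
begin

definition gcomp :: "'n option \<Rightarrow> 'n option \<Rightarrow> 'n coord \<times> 'n coord \<Rightarrow> real" where
  "gcomp a b = ddv a (ddv b L)"

definition gmat :: "'n coord \<times> 'n coord \<Rightarrow> real ^ 'n option ^ 'n option" where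
  "gmat z = (\<chi> a b. gcomp a b z)"

definition gform :: "'n coord \<times> 'n coord \<Rightarrow> 'n coord \<Rightarrow> 'n coord \<Rightarrow> real" where
  "gform z u w = (\<Sum>a\<in>UNIV. \<Sum>b\<in>UNIV. gcomp a b z * u $ a * w $ b)"

definition ginv :: "'n option \<Rightarrow> 'n option \<Rightarrow> 'n coord \<times> 'n coord \<Rightarrow> real" where
  "ginv a b z = matrix_inv (gmat z) $ a $ b"

definition Gamma_tilde ::
    "'n option \<Rightarrow> 'n option \<Rightarrow> 'n option \<Rightarrow> 'n coord \<times> 'n coord \<Rightarrow> real" where
  "Gamma_tilde a b c z = 1/2 * (\<Sum>d\<in>UNIV. ginv a d z *
     (ddx b (gcomp d c) z + ddx c (gcomp b d) z - ddx d (gcomp b c) z))"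

definition spray :: "'n option \<Rightarrow> 'n coord \<times> 'n coord \<Rightarrow> real" where
  "spray a z = 1/2 * (\<Sum>b\<in>UNIV. \<Sum>c\<in>UNIV. Gamma_tilde a b c z * snd z $ b * snd z $ c)"

definition Ncoef :: "'n option \<Rightarrow> 'n option \<Rightarrow> 'n coord \<times> 'n coord \<Rightarrow> real" where
  "Ncoef a b = ddv b (spray a)"

definition Gamma ::
    "'n option \<Rightarrow> 'n option \<Rightarrow> 'n option \<Rightarrow> 'n coord \<times> 'n coord \<Rightarrow> real" where
  "Gamma a b c z = Gamma_tilde a b c z - 1/2 * (\<Sum>d\<in>UNIV. \<Sum>m\<in>UNIV. ginv a d z *
     (ddv m (gcomp d c) z * Ncoef m b z + ddv m (gcomp b d) z * Ncoef m c z
      - ddv m (gcomp b c) z * Ncoef m d z))"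

definition curv :: "'n coord \<times> 'n coord \<Rightarrow> real ^ 'n option ^ 'n option" where
  "curv z = (\<chi> a b. 2 * ddx b (spray a) z
     - (\<Sum>c\<in>UNIV. ddx c (Ncoef a b) z * snd z $ c - 2 * ddv c (Ncoef a b) z * spray c z)
     - (\<Sum>c\<in>UNIV. Ncoef a c z * Ncoef c b z))"

end


section \<open>Weighted Finsler spacetimes\<close>

definition minkowski :: "real ^ 'n::finite option ^ 'n option" where
  "minkowski = (\<chi> a b. if a = b then (if a = None then -1 else 1) else 0)"

definition lorentz_signature :: "real ^ 'n::finite option ^ 'n option \<Rightarrow> bool" where
  "lorentz_signature G \<longleftrightarrow> (\<exists>P :: real ^ 'n option ^ 'n option. invertible P \<and> transpose P ** G ** P = minkowski)"

definition lorentz_finsler ::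
    "('a, 'n::finite) chart set \<Rightarrow> ('a \<Rightarrow> 'n coord \<Rightarrow> real) \<Rightarrow> bool" where
  "lorentz_finsler A L \<longleftrightarrow>
     (\<forall>c\<in>A. smooth_on (chart_img c \<times> (UNIV - {0})) (in_chart A c L)) \<and>
     (\<forall>p v. \<forall>s>0. L p (s *\<^sub>R v) = s\<^sup>2 * L p v) \<and>
     (\<forall>c\<in>A. \<forall>x\<in>chart_img c. \<forall>v. v \<noteq> 0 \<longrightarrow> lorentz_signature (gmat (in_chart A c L) (x, v)))"

definition smooth_vector_field ::
    "('a, 'n::finite) chart set \<Rightarrow> ('a \<Rightarrow> 'n coord) \<Rightarrow> bool" where
  "smooth_vector_field A X \<longleftrightarrow> (\<forall>c\<in>A. smooth_on (chart_img c)
     (\<lambda>x. vec_to_chart A c (chart_inv c x) (X (chart_inv c x))))"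

definition finsler_spacetime ::
    "('a::{t2_space,second_countable_topology}, 'n::finite) chart set \<Rightarrow>
     ('a \<Rightarrow> 'n coord \<Rightarrow> real) \<Rightarrow> ('a \<Rightarrow> 'n coord) \<Rightarrow> bool" where
  "finsler_spacetime A L X \<longleftrightarrow> connected_manifold A \<and> lorentz_finsler A L \<and>
     smooth_vector_field A X \<and> (\<forall>p. L p (X p) < 0)"

context
  fixes L :: "'a \<Rightarrow> 'n::finite coord \<Rightarrow> real" and X :: "'a \<Rightarrow> 'n coord"
begin

definition timelike :: "'a \<Rightarrow> 'n coord \<Rightarrow> bool" where
  "timelike p v \<longleftrightarrow> L p v < 0"

definition lightlike :: "'a \<Rightarrow> 'n coord \<Rightarrow> bool" where
  "lightlike p v \<longleftrightarrow> L p v = 0 \<and> v \<noteq> 0"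

definition causal :: "'a \<Rightarrow> 'n coord \<Rightarrow> bool" where
  "causal p v \<longleftrightarrow> timelike p v \<or> lightlike p v"

definition future_causal :: "'a \<Rightarrow> 'n coord \<Rightarrow> bool" where
  "future_causal p v \<longleftrightarrow> causal p v \<and>
     connected_component (closure {w. timelike p w} - {0}) (X p) v"

definition future_cone :: "'a \<Rightarrow> 'n coord set" where
  "future_cone p = {v. timelike p v \<and> future_causal p v}"

definition Fnorm :: "'a \<Rightarrow> 'n coord \<Rightarrow> real" where
  "Fnorm p v = sqrt (- 2 * L p v)"

end

definition weighted_finsler_spacetime ::
    "('a::{t2_space,second_countable_topology}, 'n::finite) chart set \<Rightarrow>
     ('a \<Rightarrow> 'n coord \<Rightarrow> real) \<Rightarrow> ('a \<Rightarrow> 'n coord) \<Rightarrow> ('a \<Rightarrow> 'n coord \<Rightarrow> real) \<Rightarrow> bool" where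
  "weighted_finsler_spacetime A L X \<psi> \<longleftrightarrow> finsler_spacetime A L X \<and>
     (\<forall>c\<in>A. smooth_on {(x, v). x \<in> chart_img c \<and>
          vec_of_chart A c (chart_inv c x) v \<in> closure (future_cone L X (chart_inv c x)) - {0}}
        (in_chart A c \<psi>)) \<and>
     (\<forall>p. \<forall>v \<in> closure (future_cone L X p) - {0}. \<forall>s>0. \<psi> p (s *\<^sub>R v) = \<psi> p v)"


section \<open>Curves and geodesics\<close>

text \<open>Derivatives along a curve are taken within its parameter interval, i.e. they are one-sided
  at end points belonging to the interval.\<close>

definition nondeg_interval :: "real set \<Rightarrow> bool" where
  "nondeg_interval I \<longleftrightarrow> is_interval I \<and> interior I \<noteq> {}"

context
  fixes A :: "('a::topological_space, 'n::finite) chart set"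
begin

definition smooth_curve :: "real set \<Rightarrow> (real \<Rightarrow> 'a) \<Rightarrow> bool" where
  "smooth_curve I \<eta> \<longleftrightarrow> continuous_on I \<eta> \<and>
     (\<forall>c\<in>A. smooth_on {t\<in>I. \<eta> t \<in> chart_dom c} (chart_map c \<circ> \<eta>))"

definition chart_vel :: "('a, 'n) chart \<Rightarrow> real set \<Rightarrow> (real \<Rightarrow> 'a) \<Rightarrow> real \<Rightarrow> 'n coord" where
  "chart_vel c I \<eta> t = vector_derivative (chart_map c \<circ> \<eta>) (at t within I)"

definition chart_lift ::
    "('a, 'n) chart \<Rightarrow> real set \<Rightarrow> (real \<Rightarrow> 'a) \<Rightarrow> real \<Rightarrow> 'n coord \<times> 'n coord" where
  "chart_lift c I \<eta> t = (chart_map c (\<eta> t), chart_vel c I \<eta> t)"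

definition velocity :: "real set \<Rightarrow> (real \<Rightarrow> 'a) \<Rightarrow> real \<Rightarrow> 'n coord" where
  "velocity I \<eta> t = chart_vel (ref_chart A (\<eta> t)) I \<eta> t"

definition weight_along ::
    "('a \<Rightarrow> 'n coord \<Rightarrow> real) \<Rightarrow> real set \<Rightarrow> (real \<Rightarrow> 'a) \<Rightarrow> real \<Rightarrow> real" where
  "weight_along \<psi> I \<eta> t = \<psi> (\<eta> t) (velocity I \<eta> t)"

definition causal_geodesic ::
    "('a \<Rightarrow> 'n coord \<Rightarrow> real) \<Rightarrow> ('a \<Rightarrow> 'n coord) \<Rightarrow> real set \<Rightarrow> (real \<Rightarrow> 'a) \<Rightarrow> bool" where
  "causal_geodesic L X I \<eta> \<longleftrightarrow> nondeg_interval I \<and> smooth_curve I \<eta> \<and>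
     (\<forall>t\<in>I. future_causal L X (\<eta> t) (velocity I \<eta> t)) \<and>
     (\<forall>c\<in>A. \<forall>t\<in>I. \<eta> t \<in> chart_dom c \<longrightarrow>
        (\<forall>a. vector_derivative (chart_vel c I \<eta>) (at t within I) $ a
             + 2 * spray (in_chart A c L) a (chart_lift c I \<eta> t) = 0))"

definition unit_timelike_geodesic ::
    "('a \<Rightarrow> 'n coord \<Rightarrow> real) \<Rightarrow> ('a \<Rightarrow> 'n coord) \<Rightarrow> real set \<Rightarrow> (real \<Rightarrow> 'a) \<Rightarrow> bool" where
  "unit_timelike_geodesic L X I \<eta> \<longleftrightarrow> causal_geodesic L X I \<eta> \<and>
     (\<forall>t\<in>I. timelike L (\<eta> t) (velocity I \<eta> t) \<and> Fnorm L (\<eta> t) (velocity I \<eta> t) = 1)"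


section \<open>Weighted Ricci curvature\<close>

definition Ric :: "('a \<Rightarrow> 'n coord \<Rightarrow> real) \<Rightarrow> 'a \<Rightarrow> 'n coord \<Rightarrow> real" where
  "Ric L p v = (let r = ref_chart A p in trace (curv (in_chart A r L) (chart_map r p, v)))"

text \<open>The geodesic with initial velocity \<open>v\<close>. The parameter interval is not determined; the first
  and second derivatives at 0 of the weight along the geodesic depend only on \<open>v\<close>, by the
  geodesic equation.\<close>

definition geodesic_from ::
    "('a \<Rightarrow> 'n coord \<Rightarrow> real) \<Rightarrow> ('a \<Rightarrow> 'n coord) \<Rightarrow> 'a \<Rightarrow> 'n coord \<Rightarrow> real set \<times> (real \<Rightarrow> 'a)" where
  "geodesic_from L X p v = (SOME (I, \<eta>). 0 \<in> I \<and> causal_geodesic L X I \<eta> \<and>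
     \<eta> 0 = p \<and> velocity I \<eta> 0 = v)"

definition weight_d1 ::
    "('a \<Rightarrow> 'n coord \<Rightarrow> real) \<Rightarrow> ('a \<Rightarrow> 'n coord) \<Rightarrow> ('a \<Rightarrow> 'n coord \<Rightarrow> real) \<Rightarrow>
     'a \<Rightarrow> 'n coord \<Rightarrow> real" where
  "weight_d1 L X \<psi> p v = (case geodesic_from L X p v of (I, \<eta>) \<Rightarrow>
     vector_derivative (weight_along \<psi> I \<eta>) (at 0 within I))"

definition weight_d2 ::
    "('a \<Rightarrow> 'n coord \<Rightarrow> real) \<Rightarrow> ('a \<Rightarrow> 'n coord) \<Rightarrow> ('a \<Rightarrow> 'n coord \<Rightarrow> real) \<Rightarrow>
     'a \<Rightarrow> 'n coord \<Rightarrow> real" where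
  "weight_d2 L X \<psi> p v = (case geodesic_from L X p v of (I, \<eta>) \<Rightarrow>
     vector_derivative (\<lambda>t. vector_derivative (weight_along \<psi> I \<eta>) (at t within I)) (at 0 within I))"

definition Ric_N ::
    "('a \<Rightarrow> 'n coord \<Rightarrow> real) \<Rightarrow> ('a \<Rightarrow> 'n coord) \<Rightarrow> ('a \<Rightarrow> 'n coord \<Rightarrow> real) \<Rightarrow> ereal \<Rightarrow>
     'a \<Rightarrow> 'n coord \<Rightarrow> ereal" where
  "Ric_N L X \<psi> N p v = (let n = real CARD('n); d1 = weight_d1 L X \<psi> p v; d2 = weight_d2 L X \<psi> p v in
     case N of
       ereal r \<Rightarrow> if r \<noteq> n then ereal (Ric L p v + d2 - d1\<^sup>2 / (r - n))
                  else if d1 = 0 then ereal (Ric L p v + d2) else - \<infinity>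
     | PInfty \<Rightarrow> ereal (Ric L p v + d2)
     | MInfty \<Rightarrow> undefined)"

end


section \<open>Lagrange tensor fields\<close>

definition endo_on :: "'v::real_vector set \<Rightarrow> ('v \<Rightarrow> 'v) \<Rightarrow> bool" where
  "endo_on S f \<longleftrightarrow> f ` S \<subseteq> S \<and> (\<forall>x\<in>S. \<forall>y\<in>S. f (x + y) = f x + f y) \<and>
     (\<forall>x\<in>S. \<forall>s. f (s *\<^sub>R x) = s *\<^sub>R f x)"

definition transpose_on :: "'v set \<Rightarrow> ('v \<Rightarrow> 'v \<Rightarrow> real) \<Rightarrow> ('v \<Rightarrow> 'v) \<Rightarrow> 'v \<Rightarrow> 'v" where
  "transpose_on S b f u = (THE z. z \<in> S \<and> (\<forall>w\<in>S. b z w = b u (f w)))"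

text \<open>Determinant of an endomorphism of an \<open>n\<close>-dimensional subspace, with respect to any basis.\<close>

definition endo_det :: "'n::finite coord set \<Rightarrow> ('n coord \<Rightarrow> 'n coord) \<Rightarrow> real" where
  "endo_det S f = (THE d. \<exists>(b :: 'n \<Rightarrow> 'n coord) (B :: real ^ 'n ^ 'n).
     inj b \<and> independent (range b) \<and> span (range b) = S \<and>
     (\<forall>j. f (b j) = (\<Sum>i\<in>UNIV. B $ i $ j *\<^sub>R b i)) \<and> d = det B)"

context
  fixes A :: "('a::topological_space, 'n::finite) chart set"
    and L :: "'a \<Rightarrow> 'n coord \<Rightarrow> real"
    and I :: "real set"
    and \<eta> :: "real \<Rightarrow> 'a"
begin

text \<open>In the following definitions up to \<open>chart_endo\<close>, vectors and endomorphisms along the curve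
  are given by their components in the chart \<open>c\<close>.\<close>

definition chart_normal :: "('a, 'n) chart \<Rightarrow> real \<Rightarrow> 'n coord set" where
  "chart_normal c t =
     {w. gform (in_chart A c L) (chart_lift c I \<eta> t) (chart_vel c I \<eta> t) w = 0}"

definition cov_deriv :: "('a, 'n) chart \<Rightarrow> (real \<Rightarrow> 'n coord) \<Rightarrow> real \<Rightarrow> 'n coord" where
  "cov_deriv c Y t = vector_derivative Y (at t within I) +
     (\<chi> a. \<Sum>b\<in>UNIV. \<Sum>d\<in>UNIV. Gamma (in_chart A c L) a b d (chart_lift c I \<eta> t) *
        chart_vel c I \<eta> t $ b * Y t $ d)"

text \<open>Smooth sections of the normal bundle over the part of the curve with parameter in the
  open set \<open>U\<close>.\<close>

definition normal_section :: "('a, 'n) chart \<Rightarrow> real set \<Rightarrow> (real \<Rightarrow> 'n coord) \<Rightarrow> bool" where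
  "normal_section c U P \<longleftrightarrow> open U \<and> \<eta> ` (I \<inter> U) \<subseteq> chart_dom c \<and> smooth_on (I \<inter> U) P \<and>
     (\<forall>t\<in>I \<inter> U. P t \<in> chart_normal c t)"

definition smooth_endo :: "('a, 'n) chart \<Rightarrow> (real \<Rightarrow> 'n coord \<Rightarrow> 'n coord) \<Rightarrow> bool" where
  "smooth_endo c E \<longleftrightarrow> (\<forall>U P. normal_section c U P \<longrightarrow> smooth_on (I \<inter> U) (\<lambda>t. E t (P t)))"

text \<open>\<open>E'(P) = E(P)' - E(P')\<close>, where \<open>P\<close> is any section extending the given normal
  vector \<open>w\<close> at \<open>t\<close>.\<close>

definition endo_deriv ::
    "('a, 'n) chart \<Rightarrow> (real \<Rightarrow> 'n coord \<Rightarrow> 'n coord) \<Rightarrow> real \<Rightarrow> 'n coord \<Rightarrow> 'n coord" where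
  "endo_deriv c E t w =
     (let P = (SOME P. \<exists>U. t \<in> U \<and> normal_section c U P \<and> P t = w)
      in cov_deriv c (\<lambda>s. E s (P s)) t - E t (cov_deriv c P t))"

definition normal_fibre :: "real \<Rightarrow> 'n coord set" where
  "normal_fibre t = chart_normal (ref_chart A (\<eta> t)) t"

definition chart_endo ::
    "('a, 'n) chart \<Rightarrow> (real \<Rightarrow> 'n coord \<Rightarrow> 'n coord) \<Rightarrow> real \<Rightarrow> 'n coord \<Rightarrow> 'n coord" where
  "chart_endo c J t w = vec_to_chart A c (\<eta> t) (J t (vec_of_chart A c (\<eta> t) w))"

definition jacobi_tensor :: "(real \<Rightarrow> 'n coord \<Rightarrow> 'n coord) \<Rightarrow> bool" where
  "jacobi_tensor J \<longleftrightarrow> (\<forall>t\<in>I. endo_on (normal_fibre t) (J t)) \<and>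
     (\<forall>c\<in>A. let J0 = chart_endo c J; J1 = endo_deriv c J0; J2 = endo_deriv c J1 in
        smooth_endo c J0 \<and>
        (\<forall>t\<in>I. \<eta> t \<in> chart_dom c \<longrightarrow>
           (\<forall>w\<in>chart_normal c t.
              J2 t w + curv (in_chart A c L) (chart_lift c I \<eta> t) *v J0 t w = 0) \<and>
           {w\<in>chart_normal c t. J0 t w = 0} \<inter> {w\<in>chart_normal c t. J1 t w = 0} = {0}))"

definition lagrange_tensor :: "(real \<Rightarrow> 'n coord \<Rightarrow> 'n coord) \<Rightarrow> bool" where
  "lagrange_tensor J \<longleftrightarrow> jacobi_tensor J \<and>
     (\<forall>c\<in>A. let J0 = chart_endo c J; J1 = endo_deriv c J0;
              T = (\<lambda>t. transpose_on (chart_normal c t)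
                         (gform (in_chart A c L) (chart_lift c I \<eta> t))) in
        \<forall>t\<in>I. \<eta> t \<in> chart_dom c \<longrightarrow>
          (\<forall>w\<in>chart_normal c t. T t (J1 t) (J0 t w) - T t (J0 t) (J1 t w) = 0))"

definition nonsingular :: "(real \<Rightarrow> 'n coord \<Rightarrow> 'n coord) \<Rightarrow> bool" where
  "nonsingular J \<longleftrightarrow> (\<forall>t\<in>I. bij_betw (J t) (normal_fibre t) (normal_fibre t))"

definition weighted_tensor ::
    "('a \<Rightarrow> 'n coord \<Rightarrow> real) \<Rightarrow> (real \<Rightarrow> 'n coord \<Rightarrow> 'n coord) \<Rightarrow> real \<Rightarrow> 'n coord \<Rightarrow> 'n coord" where
  "weighted_tensor \<psi> J t w = exp (- weight_along A \<psi> I \<eta> t / real CARD('n)) *\<^sub>R J t w"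


section \<open>The \<open>\<epsilon>\<close>-proper time\<close>

text \<open>The factor \<open>dt / d\<tau>\<close> for the \<open>\<epsilon>\<close>-proper time \<open>\<tau>\<close>.\<close>

definition proper_factor :: "('a \<Rightarrow> 'n coord \<Rightarrow> real) \<Rightarrow> real \<Rightarrow> real \<Rightarrow> real" where
  "proper_factor \<psi> \<epsilon> t = exp (2 * (1 - \<epsilon>) / real CARD('n) * weight_along A \<psi> I \<eta> t)"

definition proper_deriv ::
    "('a \<Rightarrow> 'n coord \<Rightarrow> real) \<Rightarrow> real \<Rightarrow> (real \<Rightarrow> real) \<Rightarrow> real \<Rightarrow> real" where
  "proper_deriv \<psi> \<epsilon> f t = proper_factor \<psi> \<epsilon> t * vector_derivative f (at t within I)"

definition proper_velocity :: "('a \<Rightarrow> 'n coord \<Rightarrow> real) \<Rightarrow> real \<Rightarrow> real \<Rightarrow> 'n coord" where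
  "proper_velocity \<psi> \<epsilon> t = proper_factor \<psi> \<epsilon> t *\<^sub>R velocity A I \<eta> t"

end

definition epsilon_range :: "real \<Rightarrow> ereal \<Rightarrow> real \<Rightarrow> bool" where
  "epsilon_range n N \<epsilon> \<longleftrightarrow> (case N of
       ereal r \<Rightarrow> if r = 0 then \<epsilon> = 0 else r = n \<or> \<bar>\<epsilon>\<bar> < sqrt (r / (r - n))
     | PInfty \<Rightarrow> \<bar>\<epsilon>\<bar> < 1
     | MInfty \<Rightarrow> False)"

definition c_const :: "real \<Rightarrow> ereal \<Rightarrow> real \<Rightarrow> real" where
  "c_const n N \<epsilon> = (case N of
       ereal r \<Rightarrow> if r = 0 then 1 / n else 1 / n * (1 - \<epsilon>\<^sup>2 * ((r - n) / r))
     | PInfty \<Rightarrow> (1 - \<epsilon>\<^sup>2) / n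
     | MInfty \<Rightarrow> undefined)"

end

theory Submission
  imports Defs
begin

text \<open>Along the geodesic put \<open>B = J' J\<^sup>-\<^sup>1\<close> and \<open>\<theta> = trace B = (ln \<bar>det J\<bar>)'\<close>. The Jacobi equation gives the Riccati
  equation \<open>B' = - R - B\<^sup>2\<close>, hence \<open>\<theta>' = - Ric - trace (B\<^sup>2)\<close>; the Lagrange condition makes \<open>B\<close> symmetric
  for the positive definite metric of the \<open>n\<close>-dimensional normal space, so \<open>trace (B\<^sup>2) \<ge> \<theta>\<^sup>2 / n\<close>. Since
  \<open>ln \<xi> = c (ln \<bar>det J\<bar> - \<psi>)\<close>, what remains for \<open>a = \<theta> - \<psi>'\<close> and \<open>b = \<psi>'\<close> is that a quadratic form in
  \<open>a, b\<close> is nonnegative, and the choice of \<open>c\<close> makes it a multiple of a square.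

  The normal bundle needs no frame: extended by the identity on the velocity, \<open>J\<close> is a smooth matrix in chart
  coordinates, and the connection acts on it by commutators with a matrix, which the traces do not see.\<close>

section \<open>Smooth functions\<close>

text \<open>For a Lorentzian metric the bound trace (B^2) \<ge> \<theta>^2 / n fails in general; it
  is available because \<open>B\<close> annihilates the timelike velocity. The extension by the
  identity keeps this: the velocity is parallel, the curvature annihilates it, and the covariant
  derivative of the extended matrix annihilates it and has normal values. So the Jacobi equation and
  the Lagrange symmetry hold on the whole tangent space.

  Two choices hidden in the definitions must be made harmless. \<open>endo_deriv\<close>
  differentiates along a section picked arbitrarily, which the product rule makes irrelevant.
  \<open>Ric_N\<close> at a vector refers to a geodesic picked arbitrarily; moreover \<eta>^* is not
  the velocity of a geodesic, since dt/d\<tau> varies. The claim is pointwise, though, so the factor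
  is frozen at one parameter value, where an affine reparametrisation of \<eta> has the right
  tangent; curvature and second weight derivative then scale by its square. The derivative of the
  factor itself produces the mixed term in \<open>a\<close> and \<open>b\<close>.

  The inequality lives in the extended reals because \<open>Ric_N\<close> is minus infinity when N =
  n and \<psi>' is nonzero.\<close>

definition Cinf_on :: "'a::euclidean_space set \<Rightarrow> ('a \<Rightarrow> 'b::euclidean_space) \<Rightarrow> bool" where
  "Cinf_on U f \<longleftrightarrow> (\<forall>k. Ck_on_open k f U)"

text \<open>Derivatives at a point see only a neighbourhood, so on an open set equality of two
  functions passes to their differentials; the induction must therefore generalise over both
  functions.\<close>

lemma Ck_on_open_cong_imp:
  assumes "open U" "\<And>x. x \<in> U \<Longrightarrow> f x = g x" "Ck_on_open k f U"
  shows "Ck_on_open k g U"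
  using assms(2,3)
proof (induction k arbitrary: f g)
  case 0
  then show ?case by (simp cong: continuous_on_cong)
next
  case (Suc k)
  have d: "g differentiable (at x)" "frechet_derivative f (at x) = frechet_derivative g (at x)"
    if "x \<in> U" for x
  proof -
    have f: "f differentiable (at x)" using Suc.prems(2) that by simp
    then have "(f has_derivative frechet_derivative f (at x)) (at x)"
      by (simp add: frechet_derivative_works)
    then have "(g has_derivative frechet_derivative f (at x)) (at x)"
      by (rule has_derivative_transform_within_open[OF _ assms(1) that]) (use Suc.prems(1) in auto)
    then show "g differentiable (at x)" "frechet_derivative f (at x) = frechet_derivative g (at x)"
      by (auto simp: differentiable_def frechet_derivative_at)
  qed
  show ?case
    using Suc.prems(2) d Suc.IH[of "\<lambda>x. frechet_derivative f (at x) v" "\<lambda>x. frechet_derivative g (at x) v" for v]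
    by simp
qed

lemma Ck_on_open_subset: "Ck_on_open k f U \<Longrightarrow> V \<subseteq> U \<Longrightarrow> Ck_on_open k f V"
  by (induction k arbitrary: f) (auto intro: continuous_on_subset)

lemma Ck_on_open_SucD: "Ck_on_open (Suc k) f U \<Longrightarrow> Ck_on_open k f U"
proof (induction k arbitrary: f)
  case 0
  then show ?case
    by (auto intro!: continuous_at_imp_continuous_on differentiable_imp_continuous_within)
next
  case (Suc k)
  then show ?case by (metis Ck_on_open.simps(2))
qed

lemma Ck_on_open_local:
  assumes "\<And>x. x \<in> U \<Longrightarrow> \<exists>V. open V \<and> x \<in> V \<and> Ck_on_open k f V"
  shows "Ck_on_open k f U"
  using assms
proof (induction k arbitrary: f)
  case 0
  show ?case
    unfolding Ck_on_open.simps
  proof (rule continuous_at_imp_continuous_on, rule ballI)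
    fix x assume "x \<in> U"
    with 0 obtain V where "open V" "x \<in> V" "continuous_on V f" by auto
    then show "isCont f x" by (simp add: continuous_on_eq_continuous_at)
  qed
next
  case (Suc k)
  show ?case
    unfolding Ck_on_open.simps
  proof (intro conjI ballI allI)
    show "f differentiable (at x)" if "x \<in> U" for x
      using Suc.prems[OF that] by auto
    show "Ck_on_open k (\<lambda>x. frechet_derivative f (at x) v) U" for v
      by (rule Suc.IH) (use Suc.prems in fastforce)
  qed
qed

text \<open>\<open>Ck_on_open\<close> is phrased with \<open>frechet_derivative\<close>; this rule
  accepts any explicit differential and drives most of the closure proofs by induction on
  \<open>k\<close>.\<close>

lemma Ck_on_open_SucI:
  assumes "open U" "\<And>x. x \<in> U \<Longrightarrow> (f has_derivative f' x) (at x)"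
    and "\<And>v. Ck_on_open k (\<lambda>x. f' x v) U"
  shows "Ck_on_open (Suc k) f U"
proof -
  have "f' x v = frechet_derivative f (at x) v" if "x \<in> U" for x v
    using frechet_derivative_at[OF assms(2)[OF that]] by simp
  from Ck_on_open_cong_imp[OF assms(1) this assms(3)] assms(2)
  show ?thesis by (auto simp: differentiable_def)
qed

lemma Ck_on_open_SucE:
  assumes "Ck_on_open (Suc k) f U"
  shows "x \<in> U \<Longrightarrow> (f has_derivative frechet_derivative f (at x)) (at x)"
    and "Ck_on_open k (\<lambda>x. frechet_derivative f (at x) v) U"
  using assms by (auto simp: frechet_derivative_works)

lemma Ck_on_open_const [simp]: "Ck_on_open k (\<lambda>x. c) U"
  by (induction k arbitrary: c) auto

lemma Ck_on_open_bounded_linear: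
  assumes "bounded_linear h" "open U" shows "Ck_on_open k h U"
proof (cases k)
  case 0
  then show ?thesis using assms by (simp add: linear_continuous_on)
next
  case (Suc m)
  show ?thesis unfolding Suc
    by (rule Ck_on_open_SucI[where f' = "\<lambda>x. h"]) (use assms in \<open>simp_all add: bounded_linear_imp_has_derivative\<close>)
qed

lemma Ck_on_open_add:
  assumes "open U" "Ck_on_open k f U" "Ck_on_open k g U"
  shows "Ck_on_open k (\<lambda>x. f x + g x) U"
  using assms(2,3)
proof (induction k arbitrary: f g)
  case 0
  then show ?case by (auto intro: continuous_on_add)
next
  case (Suc k)
  note f = Ck_on_open_SucE[OF Suc.prems(1)] and g = Ck_on_open_SucE[OF Suc.prems(2)]
  show ?case
    by (rule Ck_on_open_SucI[OF assms(1) has_derivative_add[OF f(1) g(1)]]) (auto intro!: Suc.IH f(2) g(2))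
qed

lemma Ck_on_open_linear_comp:
  assumes "open U" "bounded_linear h" "Ck_on_open k f U"
  shows "Ck_on_open k (\<lambda>x. h (f x)) U"
  using assms(3)
proof (induction k arbitrary: f)
  case 0
  then show ?case using assms(2)
    by (auto intro: bounded_linear.continuous_on)
next
  case (Suc k)
  note f = Ck_on_open_SucE[OF Suc.prems]
  show ?case
    by (rule Ck_on_open_SucI[OF assms(1) bounded_linear.has_derivative[OF assms(2) f(1)]])
      (auto intro!: Suc.IH f(2))
qed

lemma Ck_on_open_scaleR:
  assumes "open U" "Ck_on_open k a U" "Ck_on_open k f U"
  shows "Ck_on_open k (\<lambda>x. a x *\<^sub>R f x) U"
  using assms(2,3)
proof (induction k arbitrary: a f)
  case 0
  then show ?case by (auto intro: continuous_on_scaleR)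
next
  case (Suc k)
  note a = Ck_on_open_SucE[OF Suc.prems(1)] and f = Ck_on_open_SucE[OF Suc.prems(2)]
  show ?case
    by (rule Ck_on_open_SucI[OF assms(1) has_derivative_scaleR[OF a(1) f(1)]])
      (auto intro!: Ck_on_open_add[OF assms(1)] Suc.IH a(2) f(2) Ck_on_open_SucD[OF Suc.prems(1)]
        Ck_on_open_SucD[OF Suc.prems(2)])
qed

lemma Ck_on_open_sum:
  assumes "open U" "\<And>i. i \<in> S \<Longrightarrow> Ck_on_open k (f i) U"
  shows "Ck_on_open k (\<lambda>x. \<Sum>i\<in>S. f i x) U"
  using assms(2) by (induction S rule: infinite_finite_induct) (auto intro: Ck_on_open_add assms(1))

lemma Ck_on_open_compose:
  fixes g :: "'a::euclidean_space \<Rightarrow> 'b::euclidean_space" and f :: "'b \<Rightarrow> 'c::euclidean_space"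
  assumes "open U" "open V" "\<And>x. x \<in> U \<Longrightarrow> g x \<in> V" "Ck_on_open k g U" "Ck_on_open k f V"
  shows "Ck_on_open k (\<lambda>x. f (g x)) U"
  using assms(4,5)
proof (induction k arbitrary: f)
  case 0
  then show ?case using assms(3) by (auto intro: continuous_on_compose2)
next
  case (Suc k)
  note g = Ck_on_open_SucE[OF Suc.prems(1)] and f = Ck_on_open_SucE[OF Suc.prems(2)]
  \<comment> \<open>The direction \<open>frechet_derivative g (at x) v\<close> moves with
    \<open>x\<close>, while the induction hypothesis needs a fixed direction. Expanding it in the
    basis leaves scalar coefficients times derivatives of \<open>f\<close> in fixed
    directions.\<close>
  let ?D = "\<lambda>x v. \<Sum>b\<in>Basis. (frechet_derivative g (at x) v \<bullet> b) *\<^sub>R frechet_derivative f (at (g x)) b"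
  show ?case
  proof (rule Ck_on_open_SucI[OF assms(1), where f' = ?D])
    fix x assume x: "x \<in> U"
    interpret F: bounded_linear "frechet_derivative f (at (g x))"
      by (rule has_derivative_bounded_linear[OF f(1)[OF assms(3)[OF x]]])
    have "frechet_derivative f (at (g x)) (frechet_derivative g (at x) v) = ?D x v" for v
      using F.sum[of "\<lambda>b. (frechet_derivative g (at x) v \<bullet> b) *\<^sub>R b" Basis]
      by (simp add: euclidean_representation F.scaleR)
    with diff_chain_at[OF g(1)[OF x] f(1)[OF assms(3)[OF x]]]
    show "((\<lambda>x. f (g x)) has_derivative ?D x) (at x)" by (simp add: o_def)
  next
    show "Ck_on_open k (\<lambda>x. ?D x v) U" for v
      by (intro Ck_on_open_sum Ck_on_open_scaleR assms(1) Suc.IH Ck_on_open_SucD[OF Suc.prems(1)] f(2)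
          Ck_on_open_linear_comp[OF assms(1) bounded_linear_inner_left] g(2))
  qed
qed

text \<open>The differential of the inverse is again built from the inverse, so the induction closes
  on itself with products alone.\<close>

lemma Ck_on_open_inverse_real: "Ck_on_open k (inverse :: real \<Rightarrow> real) (- {0})"
proof (induction k)
  case 0
  then show ?case by (auto intro!: continuous_intros)
next
  case (Suc k)
  show ?case
  proof (rule Ck_on_open_SucI[where f' = "\<lambda>x v. inverse x *\<^sub>R inverse x *\<^sub>R (- v)"])
    show "((inverse :: real \<Rightarrow> real) has_derivative (\<lambda>v. inverse x *\<^sub>R inverse x *\<^sub>R (- v))) (at x)"
      if "x \<in> - {0}" for x
      using has_derivative_inverse'[of x UNIV] that by (simp add: mult_ac)
    show "Ck_on_open k (\<lambda>x. inverse x *\<^sub>R inverse x *\<^sub>R (- v)) (- {0})" for v :: real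
      by (intro Ck_on_open_scaleR Suc.IH Ck_on_open_const) auto
  qed auto
qed

lemma Cinf_on_cong:
  assumes "open U" "\<And>x. x \<in> U \<Longrightarrow> f x = g x"
  shows "Cinf_on U f \<longleftrightarrow> Cinf_on U g"
  using Ck_on_open_cong_imp[OF assms(1), of f g] Ck_on_open_cong_imp[OF assms(1), of g f] assms(2)
  unfolding Cinf_on_def by metis

lemma Cinf_on_subset: "Cinf_on U f \<Longrightarrow> V \<subseteq> U \<Longrightarrow> Cinf_on V f"
  unfolding Cinf_on_def by (blast intro: Ck_on_open_subset)

lemma Cinf_on_const [simp]: "Cinf_on U (\<lambda>x. c)"
  unfolding Cinf_on_def by simp

lemma Cinf_on_bounded_linear: "open U \<Longrightarrow> bounded_linear h \<Longrightarrow> Cinf_on U h"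
  unfolding Cinf_on_def by (simp add: Ck_on_open_bounded_linear)

lemma Cinf_on_linear_comp: "open U \<Longrightarrow> bounded_linear h \<Longrightarrow> Cinf_on U f \<Longrightarrow> Cinf_on U (\<lambda>x. h (f x))"
  unfolding Cinf_on_def by (simp add: Ck_on_open_linear_comp)

lemma Cinf_on_add: "open U \<Longrightarrow> Cinf_on U f \<Longrightarrow> Cinf_on U g \<Longrightarrow> Cinf_on U (\<lambda>x. f x + g x)"
  unfolding Cinf_on_def by (simp add: Ck_on_open_add)

lemma Cinf_on_scaleR: "open U \<Longrightarrow> Cinf_on U a \<Longrightarrow> Cinf_on U f \<Longrightarrow> Cinf_on U (\<lambda>x. a x *\<^sub>R f x)"
  unfolding Cinf_on_def by (simp add: Ck_on_open_scaleR)

lemma Cinf_on_minus: "open U \<Longrightarrow> Cinf_on U f \<Longrightarrow> Cinf_on U (\<lambda>x. - f x)"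
  using Cinf_on_linear_comp[of U uminus f] by (simp add: bounded_linear_minus bounded_linear_ident)

lemma Cinf_on_diff: "open U \<Longrightarrow> Cinf_on U f \<Longrightarrow> Cinf_on U g \<Longrightarrow> Cinf_on U (\<lambda>x. f x - g x)"
  using Cinf_on_add[of U f "\<lambda>x. - g x"] Cinf_on_minus by auto

lemma Cinf_on_mult:
  fixes f g :: "'a::euclidean_space \<Rightarrow> real"
  shows "open U \<Longrightarrow> Cinf_on U f \<Longrightarrow> Cinf_on U g \<Longrightarrow> Cinf_on U (\<lambda>x. f x * g x)"
  using Cinf_on_scaleR[of U f g] by simp

lemma Cinf_on_sum: "open U \<Longrightarrow> (\<And>i. i \<in> S \<Longrightarrow> Cinf_on U (f i)) \<Longrightarrow> Cinf_on U (\<lambda>x. \<Sum>i\<in>S. f i x)"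
  unfolding Cinf_on_def by (simp add: Ck_on_open_sum)

lemma Cinf_on_prod:
  fixes f :: "'i \<Rightarrow> 'a::euclidean_space \<Rightarrow> real"
  shows "open U \<Longrightarrow> (\<And>i. i \<in> S \<Longrightarrow> Cinf_on U (f i)) \<Longrightarrow> Cinf_on U (\<lambda>x. \<Prod>i\<in>S. f i x)"
  by (induction S rule: infinite_finite_induct) (auto intro: Cinf_on_mult)

lemma Cinf_on_compose:
  assumes "open U" "open V" "\<And>x. x \<in> U \<Longrightarrow> g x \<in> V" "Cinf_on U g" "Cinf_on V f"
  shows "Cinf_on U (\<lambda>x. f (g x))"
  using assms Ck_on_open_compose[of U V g _ f] unfolding Cinf_on_def by blast

lemma Cinf_on_divide:
  fixes f g :: "'a::euclidean_space \<Rightarrow> real"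
  assumes "open U" "Cinf_on U f" "Cinf_on U g" "\<And>x. x \<in> U \<Longrightarrow> g x \<noteq> 0"
  shows "Cinf_on U (\<lambda>x. f x / g x)"
proof -
  have "Cinf_on (- {0}) (inverse :: real \<Rightarrow> real)"
    unfolding Cinf_on_def by (simp add: Ck_on_open_inverse_real)
  then have "Cinf_on U (\<lambda>x. inverse (g x))"
    using assms by (intro Cinf_on_compose[OF assms(1) _ _ assms(3), of "- {0}"]) auto
  then show ?thesis using assms by (simp add: divide_inverse Cinf_on_mult)
qed

lemma Cinf_on_frechet_derivative: "Cinf_on U f \<Longrightarrow> Cinf_on U (\<lambda>x. frechet_derivative f (at x) v)"
  unfolding Cinf_on_def by (metis Ck_on_open.simps(2))

lemma Cinf_on_differentiable: "Cinf_on U f \<Longrightarrow> x \<in> U \<Longrightarrow> f differentiable (at x)"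
  unfolding Cinf_on_def by (metis Ck_on_open.simps(2))

lemma Cinf_on_has_derivative:
  "Cinf_on U f \<Longrightarrow> x \<in> U \<Longrightarrow> (f has_derivative frechet_derivative f (at x)) (at x)"
  by (simp add: Cinf_on_differentiable frechet_derivative_works[symmetric])

lemma Cinf_on_continuous_on: "Cinf_on U f \<Longrightarrow> continuous_on U f"
  unfolding Cinf_on_def by (metis Ck_on_open.simps(1))

lemma Cinf_on_Pair:
  fixes f :: "'a::euclidean_space \<Rightarrow> 'b::euclidean_space" and g :: "'a \<Rightarrow> 'c::euclidean_space"
  assumes "open U" "Cinf_on U f" "Cinf_on U g"
  shows "Cinf_on U (\<lambda>x. (f x, g x))"
proof -
  have 1: "bounded_linear (\<lambda>y::'b. (y, 0::'c))" and 2: "bounded_linear (\<lambda>y::'c. (0::'b, y))"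
    by (auto intro!: bounded_linear_Pair bounded_linear_ident bounded_linear_zero)
  have "Cinf_on U (\<lambda>x. (f x, 0) + (0, g x))"
    using assms Cinf_on_linear_comp[OF assms(1) 1 assms(2)] Cinf_on_linear_comp[OF assms(1) 2 assms(3)]
    by (intro Cinf_on_add) auto
  then show ?thesis by simp
qed

lemma Cinf_on_vec_nth:
  fixes f :: "'a::euclidean_space \<Rightarrow> 'b::euclidean_space ^ 'm"
  shows "open U \<Longrightarrow> Cinf_on U f \<Longrightarrow> Cinf_on U (\<lambda>x. f x $ i)"
  using Cinf_on_linear_comp[OF _ bounded_linear_vec_nth] by blast

lemma Cinf_on_vec_lambda:
  fixes f :: "'a::euclidean_space \<Rightarrow> 'm::finite \<Rightarrow> 'b::euclidean_space"
  assumes "open U" "\<And>i. Cinf_on U (\<lambda>x. f x i)"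
  shows "Cinf_on U (\<lambda>x. \<chi> i. f x i)"
proof -
  have l: "bounded_linear (\<lambda>y::'b. axis i y)" for i :: 'm
    by (rule linear_conv_bounded_linear[THEN iffD1], rule linearI) (auto simp: axis_def vec_eq_iff)
  have "Cinf_on U (\<lambda>x. \<Sum>i\<in>UNIV. axis i (f x i))"
    using assms by (intro Cinf_on_sum Cinf_on_linear_comp[OF _ l]) auto
  moreover have "(\<Sum>i\<in>UNIV. axis i (f x i)) = (\<chi> i. f x i)" for x
    by (simp add: vec_eq_iff axis_def)
  ultimately show ?thesis by simp
qed

lemma Cinf_on_det:
  fixes M :: "'a::euclidean_space \<Rightarrow> real ^ 'm ^ 'm"
  assumes "open U" "\<And>i j. Cinf_on U (\<lambda>x. M x $ i $ j)"
  shows "Cinf_on U (\<lambda>x. det (M x))"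
  unfolding det_def using assms
  by (intro Cinf_on_sum Cinf_on_mult Cinf_on_prod Cinf_on_const) auto

section \<open>Smoothness of matrix inversion\<close>

lemma
  fixes M :: "real ^ 'm ^ 'm"
  assumes "det M \<noteq> 0"
  shows matrix_inv_right: "M ** matrix_inv M = mat 1" and matrix_inv_left: "matrix_inv M ** M = mat 1"
proof -
  have "\<exists>N. M ** N = mat 1 \<and> N ** M = mat 1"
    using assms by (simp add: invertible_det_nz[symmetric] invertible_def)
  from someI_ex[OF this] show "M ** matrix_inv M = mat 1" "matrix_inv M ** M = mat 1"
    by (auto simp: matrix_inv_def)
qed

text \<open>Cramer's rule exhibits the entries of the inverse as quotients of polynomials, and this
  is what makes inversion smooth.\<close>

lemma matrix_inv_cramer:
  fixes M :: "real ^ 'm ^ 'm"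
  assumes "det M \<noteq> 0"
  shows "matrix_inv M $ i $ j = det (\<chi> k l. if l = i then axis j 1 $ k else M $ k $ l) / det M"
proof -
  have "M *v (matrix_inv M *v axis j 1) = axis j 1"
    using assms by (simp add: matrix_vector_mul_assoc matrix_inv_right)
  then have "matrix_inv M *v axis j 1 = (\<chi> i. det (\<chi> k l. if l = i then axis j 1 $ k else M $ k $ l) / det M)"
    by (simp add: cramer[OF assms])
  then show ?thesis
    by (metis (no_types, lifting) column_def matrix_vector_mult_basis vec_lambda_beta)
qed

lemma Cinf_on_matrix_inv:
  fixes M :: "'a::euclidean_space \<Rightarrow> real ^ 'm ^ 'm"
  assumes U: "open U" and M: "\<And>i j. Cinf_on U (\<lambda>x. M x $ i $ j)" and nz: "\<And>x. x \<in> U \<Longrightarrow> det (M x) \<noteq> 0"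
  shows "Cinf_on U (\<lambda>x. matrix_inv (M x) $ i $ j)"
proof -
  have "Cinf_on U (\<lambda>x. (\<chi> k l. if l = i then axis j 1 $ k else M x $ k $ l) $ k $ l)" for k l
    using M by (cases "l = i") auto
  then have "Cinf_on U (\<lambda>x. det (\<chi> k l. if l = i then axis j 1 $ k else M x $ k $ l) / det (M x))"
    using U M nz by (intro Cinf_on_divide Cinf_on_det) auto
  then show ?thesis
    by (subst Cinf_on_cong[OF U]) (use nz in \<open>auto simp: matrix_inv_cramer\<close>)
qed

section \<open>Smooth maps on sets that need not be open\<close>

text \<open>Around a point of an open set a local extension coincides with \<open>f\<close> on a
  whole neighbourhood, and being of class C^k is a local property.\<close>

lemma smooth_on_open_iff: "open S \<Longrightarrow> smooth_on S f \<longleftrightarrow> Cinf_on S f"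
proof
  assume S: "open S" and "smooth_on S f"
  have "Ck_on_open k f S" for k
  proof (rule Ck_on_open_local)
    fix x assume "x \<in> S"
    with \<open>smooth_on S f\<close> obtain U g where U: "open U" "x \<in> U" and g: "\<forall>k. Ck_on_open k g U" "\<forall>y\<in>S \<inter> U. g y = f y"
      unfolding smooth_on_def by blast
    have "Ck_on_open k g (S \<inter> U)" using g by (blast intro: Ck_on_open_subset)
    then have "Ck_on_open k f (S \<inter> U)"
      by (rule Ck_on_open_cong_imp[rotated 2]) (use S U g in auto)
    then show "\<exists>V. open V \<and> x \<in> V \<and> Ck_on_open k f V" using S U \<open>x \<in> S\<close> by blast
  qed
  then show "Cinf_on S f" by (simp add: Cinf_on_def)
next
  assume "open S" "Cinf_on S f"
  then show "smooth_on S f" unfolding smooth_on_def Cinf_on_def by blast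
qed

lemma smooth_on_def2:
  "smooth_on S f \<longleftrightarrow> (\<forall>x\<in>S. \<exists>U g. open U \<and> x \<in> U \<and> Cinf_on U g \<and> (\<forall>y\<in>S \<inter> U. g y = f y))"
  unfolding smooth_on_def Cinf_on_def by simp

lemma smooth_on_subset:
  assumes "smooth_on S f" "T \<subseteq> S"
  shows "smooth_on T f"
  unfolding smooth_on_def
proof
  fix x assume "x \<in> T"
  then have "x \<in> S" using assms(2) by blast
  from assms(1)[unfolded smooth_on_def, rule_format, OF this]
  obtain U g where "open U" "x \<in> U" "\<forall>k. Ck_on_open k g U" and g: "\<forall>y\<in>S \<inter> U. g y = f y"
    by (elim exE conjE)
  moreover have "\<forall>y\<in>T \<inter> U. g y = f y" using g assms(2) by blast
  ultimately show "\<exists>U g. open U \<and> x \<in> U \<and> (\<forall>k. Ck_on_open k g U) \<and> (\<forall>y\<in>T \<inter> U. g y = f y)"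
    by (intro exI[of _ U] exI[of _ g] conjI)
qed

lemma smooth_on_continuous_on: "smooth_on S f \<Longrightarrow> continuous_on S f"
  unfolding continuous_on_eq_continuous_within
proof
  fix x assume "smooth_on S f" and x: "x \<in> S"
  then obtain U g where U: "open U" "x \<in> U" and g: "Cinf_on U g" "\<forall>y\<in>S \<inter> U. g y = f y"
    unfolding smooth_on_def2 by blast
  have "isCont g x" using Cinf_on_continuous_on[OF g(1)] U by (simp add: continuous_on_eq_continuous_at)
  then have "continuous (at x within S) g" by (rule continuous_at_imp_continuous_at_within)
  then show "continuous (at x within S) f"
    by (rule continuous_transform_within_openin[of _ _ _ "S \<inter> U"]) (use U g x in \<open>auto simp: openin_open\<close>)
qed

lemma smooth_on_compose:
  assumes g: "smooth_on S g" and V: "open V" "\<And>x. x \<in> S \<Longrightarrow> g x \<in> V" and f: "Cinf_on V f"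
  shows "smooth_on S (\<lambda>x. f (g x))"
  unfolding smooth_on_def2
proof
  fix x assume x: "x \<in> S"
  with g obtain U h where U: "open U" "x \<in> U" and h: "Cinf_on U h" "\<forall>y\<in>S \<inter> U. h y = g y"
    unfolding smooth_on_def2 by blast
  let ?U = "U \<inter> h -` V"
  have o: "open ?U"
    using continuous_open_preimage[OF Cinf_on_continuous_on[OF h(1)] U(1) V(1)] .
  moreover have "Cinf_on ?U (\<lambda>x. f (h x))"
    by (rule Cinf_on_compose[OF o V(1) _ _ f]) (use h in \<open>auto intro: Cinf_on_subset\<close>)
  moreover have "x \<in> ?U" using x U h V by auto
  moreover have "\<forall>y\<in>S \<inter> ?U. f (h y) = f (g y)" using h by auto
  ultimately show "\<exists>U h. open U \<and> x \<in> U \<and> Cinf_on U h \<and> (\<forall>y\<in>S \<inter> U. h y = f (g y))"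
    by (intro exI[of _ ?U] exI[of _ "\<lambda>x. f (h x)"]) blast
qed

lemma smooth_on_Pair:
  assumes "smooth_on S f" "smooth_on S g"
  shows "smooth_on S (\<lambda>x. (f x, g x))"
  unfolding smooth_on_def2
proof
  fix x assume x: "x \<in> S"
  obtain U h where U: "open U" "x \<in> U" and h: "Cinf_on U h" "\<forall>y\<in>S \<inter> U. h y = f y"
    using assms(1) x unfolding smooth_on_def2 by blast
  obtain V k where V: "open V" "x \<in> V" and k: "Cinf_on V k" "\<forall>y\<in>S \<inter> V. k y = g y"
    using assms(2) x unfolding smooth_on_def2 by blast
  have "Cinf_on (U \<inter> V) (\<lambda>x. (h x, k x))"
    using U V h k by (intro Cinf_on_Pair) (auto intro: Cinf_on_subset)
  then show "\<exists>U h. open U \<and> x \<in> U \<and> Cinf_on U h \<and> (\<forall>y\<in>S \<inter> U. h y = (f y, g y))"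
    using U V h k by (intro exI[of _ "U \<inter> V"] exI[of _ "\<lambda>x. (h x, k x)"]) auto
qed

lemma smooth_on_add:
  assumes "smooth_on S f" "smooth_on S g"
  shows "smooth_on S (\<lambda>x. f x + g x)"
proof -
  have "Cinf_on UNIV (\<lambda>p. fst p + snd p)"
    by (intro Cinf_on_add Cinf_on_bounded_linear bounded_linear_fst bounded_linear_snd open_UNIV)
  from smooth_on_compose[OF smooth_on_Pair[OF assms] _ _ this] show ?thesis by simp
qed

section \<open>Derivatives within an interval\<close>

text \<open>Makes derivatives within \<open>I\<close> unique, end points included: a connected set
  with more than one point has no isolated point.\<close>

lemma nondeg_interval_at_within_neq_bot:
  assumes "nondeg_interval I" "t \<in> I"
  shows "at t within I \<noteq> bot"
proof -
  obtain a b where ab: "a < b" "{a..b} \<subseteq> I"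
  proof -
    obtain x e where "e > 0" "cball x e \<subseteq> I"
      using assms unfolding nondeg_interval_def by (metis all_not_in_conv mem_interior_cball)
    then show thesis using that[of "x - e" "x + e"] by (simp add: cball_eq_atLeastAtMost)
  qed
  have I: "convex I" using assms by (simp add: nondeg_interval_def is_interval_convex_1)
  have "t islimpt I"
  proof (rule connected_imp_perfect)
    show "connected I" using I by (rule convex_connected)
    show "t \<in> I" by fact
    show "I \<noteq> {x}" for x
    proof
      assume "I = {x}"
      have "a \<in> {a..b}" "b \<in> {a..b}" using ab by auto
      then have "a \<in> I" "b \<in> I" using ab(2) by blast+
      with \<open>I = {x}\<close> ab(1) show False by simp
    qed
  qed
  then show ?thesis by (simp add: trivial_limit_within)
qed

lemma has_vector_derivative_cong_open:
  assumes "(f has_vector_derivative f') (at x within S)" "open U" "x \<in> S" "x \<in> U"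
    and "\<And>y. y \<in> S \<Longrightarrow> y \<in> U \<Longrightarrow> f y = g y"
  shows "(g has_vector_derivative f') (at x within S)"
proof -
  obtain d where "d > 0" "ball x d \<subseteq> U" using assms open_contains_ball by blast
  then show ?thesis
    by (intro has_vector_derivative_transform_within[OF assms(1), of d g])
      (use assms in \<open>auto simp: subset_iff dist_commute\<close>)
qed

lemma smooth_on_has_vector_derivative:
  fixes f :: "real \<Rightarrow> 'b::euclidean_space"
  assumes I: "nondeg_interval I" and U: "open U" and f: "smooth_on (I \<inter> U) f" and t: "t \<in> I \<inter> U"
  shows "(f has_vector_derivative vector_derivative f (at t within I)) (at t within I)"
proof -
  obtain V g where V: "open V" "t \<in> V" and g: "Cinf_on V g" "\<forall>y\<in>(I \<inter> U) \<inter> V. g y = f y"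
    using f t unfolding smooth_on_def2 by blast
  have "(g has_vector_derivative vector_derivative g (at t)) (at t)"
    using Cinf_on_differentiable[OF g(1) V(2)] by (simp add: vector_derivative_works)
  then have "(g has_vector_derivative vector_derivative g (at t)) (at t within I)"
    by (rule has_vector_derivative_at_within)
  then have "(f has_vector_derivative vector_derivative g (at t)) (at t within I)"
    by (rule has_vector_derivative_cong_open[of _ _ _ _ "U \<inter> V"]) (use U V g t in auto)
  then show ?thesis
    using vector_derivative_works differentiableI_vector by blast
qed

text \<open>At each point the derivative within \<open>I\<close> is the ordinary derivative of a
  local extension, end points included. It therefore extends smoothly itself, and differentiation
  can be repeated.\<close>

lemma smooth_on_vector_derivative:
  fixes f :: "real \<Rightarrow> 'b::euclidean_space"
  assumes I: "nondeg_interval I" and U: "open U" and f: "smooth_on (I \<inter> U) f"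
  shows "smooth_on (I \<inter> U) (\<lambda>t. vector_derivative f (at t within I))"
  unfolding smooth_on_def2
proof
  fix t assume t: "t \<in> I \<inter> U"
  obtain V g where V: "open V" "t \<in> V" and g: "Cinf_on V g" "\<forall>y\<in>(I \<inter> U) \<inter> V. g y = f y"
    using f t unfolding smooth_on_def2 by blast
  have "vector_derivative f (at s within I) = frechet_derivative g (at s) 1" if s: "s \<in> I \<inter> U \<inter> V" for s
  proof -
    have "(g has_vector_derivative frechet_derivative g (at s) 1) (at s)"
      using Cinf_on_has_derivative[OF g(1), of s] s linear_frechet_derivative[OF Cinf_on_differentiable[OF g(1), of s]]
      by (auto simp: has_vector_derivative_def linear_scale[symmetric] scaleR_conv_of_real)
    then have "(g has_vector_derivative frechet_derivative g (at s) 1) (at s within I)"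
      by (rule has_vector_derivative_at_within)
    then have "(f has_vector_derivative frechet_derivative g (at s) 1) (at s within I)"
      by (rule has_vector_derivative_cong_open[of _ _ _ _ "U \<inter> V"]) (use U V g s in auto)
    then show ?thesis
      using nondeg_interval_at_within_neq_bot[OF I, of s] s by (auto intro: vector_derivative_within)
  qed
  then show "\<exists>U' h. open U' \<and> t \<in> U' \<and> Cinf_on U' h \<and>
      (\<forall>y\<in>I \<inter> U \<inter> U'. h y = vector_derivative f (at y within I))"
    using V Cinf_on_frechet_derivative[OF g(1), of 1]
    by (intro exI[of _ V] exI[of _ "\<lambda>s. frechet_derivative g (at s) 1"]) auto
qed

section \<open>Symmetry of second derivatives\<close>

text \<open>The mean value theorem, used once in the direction \<open>u\<close> and once in the
  direction \<open>w\<close>. The left side is symmetric in \<open>u\<close> and \<open>w\<close>,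
  the right side not visibly so; this asymmetry is exploited next.\<close>

lemma second_difference_mvt:
  fixes f :: "'a::euclidean_space \<Rightarrow> real"
  assumes f: "Cinf_on (ball x d) f" and h: "h > 0" "h * (norm u + norm w) < d"
  shows "\<exists>y\<in>ball x d. f (x + h *\<^sub>R u + h *\<^sub>R w) - f (x + h *\<^sub>R u) - f (x + h *\<^sub>R w) + f x =
      h\<^sup>2 * frechet_derivative (\<lambda>z. frechet_derivative f (at z) u) (at y) w"
proof -
  have inb: "x + s *\<^sub>R u + r *\<^sub>R w \<in> ball x d" if "0 \<le> s" "s \<le> h" "0 \<le> r" "r \<le> h" for s r
  proof -
    have "dist x (x + s *\<^sub>R u + r *\<^sub>R w) \<le> s * norm u + r * norm w"
      using that norm_triangle_ineq[of "s *\<^sub>R u" "r *\<^sub>R w"]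
      by (metis (no_types, lifting) abs_of_nonneg add.assoc add_diff_cancel_left' dist_commute dist_norm norm_scaleR)
    also have "\<dots> \<le> h * (norm u + norm w)"
      using that by (simp add: distrib_left add_mono mult_right_mono)
    finally show ?thesis using h by simp
  qed
  have line: "((\<lambda>s. F (p + s *\<^sub>R e)) has_real_derivative frechet_derivative F (at (p + s *\<^sub>R e)) e) (at s)"
    if "Cinf_on (ball x d) F" "p + s *\<^sub>R e \<in> ball x d" for F :: "'a \<Rightarrow> real" and p e s
  proof -
    have F: "(F has_derivative frechet_derivative F (at (p + s *\<^sub>R e))) (at (p + s *\<^sub>R e))"
      using that by (rule Cinf_on_has_derivative)
    have "((\<lambda>s. p + s *\<^sub>R e) has_vector_derivative e) (at s)"
      by (auto intro!: derivative_eq_intros)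
    then have "((F \<circ> (\<lambda>s. p + s *\<^sub>R e)) has_vector_derivative frechet_derivative F (at (p + s *\<^sub>R e)) e) (at s)"
      using F by (intro vector_derivative_diff_chain_within) (auto intro: has_derivative_at_withinI)
    then show ?thesis by (simp add: o_def has_real_derivative_iff_has_vector_derivative)
  qed
  let ?D = "\<lambda>z. frechet_derivative f (at z) u"
  have D: "Cinf_on (ball x d) ?D" using f by (rule Cinf_on_frechet_derivative)
  have "\<exists>s. 0 < s \<and> s < h \<and>
     (f (x + h *\<^sub>R w + h *\<^sub>R u) - f (x + h *\<^sub>R u)) - (f (x + h *\<^sub>R w + 0 *\<^sub>R u) - f (x + 0 *\<^sub>R u)) =
     (h - 0) * (?D (x + h *\<^sub>R w + s *\<^sub>R u) - ?D (x + s *\<^sub>R u))"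
  proof (rule MVT2[OF h(1)])
    fix s assume s: "0 \<le> s" "s \<le> h"
    show "((\<lambda>s. f (x + h *\<^sub>R w + s *\<^sub>R u) - f (x + s *\<^sub>R u)) has_real_derivative
       ?D (x + h *\<^sub>R w + s *\<^sub>R u) - ?D (x + s *\<^sub>R u)) (at s)"
      using inb[of s h] inb[of s 0] s h(1)
      by (intro DERIV_diff line[OF f]) (auto simp: algebra_simps)
  qed
  then obtain s where s: "0 < s" "s < h" and e1: "f (x + h *\<^sub>R w + h *\<^sub>R u) - f (x + h *\<^sub>R u) - f (x + h *\<^sub>R w) + f x =
     h * (?D (x + h *\<^sub>R w + s *\<^sub>R u) - ?D (x + s *\<^sub>R u))"
    by (auto simp: algebra_simps)
  have "\<exists>r. 0 < r \<and> r < h \<and> ?D (x + s *\<^sub>R u + h *\<^sub>R w) - ?D (x + s *\<^sub>R u + 0 *\<^sub>R w) =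
     (h - 0) * frechet_derivative ?D (at (x + s *\<^sub>R u + r *\<^sub>R w)) w"
  proof (rule MVT2[OF h(1)])
    fix r assume "0 \<le> r" "r \<le> h"
    then show "((\<lambda>r. ?D (x + s *\<^sub>R u + r *\<^sub>R w)) has_real_derivative
        frechet_derivative ?D (at (x + s *\<^sub>R u + r *\<^sub>R w)) w) (at r)"
      using inb[of s r] s by (intro line[OF D]) auto
  qed
  then obtain r where r: "0 < r" "r < h" and e2: "?D (x + s *\<^sub>R u + h *\<^sub>R w) - ?D (x + s *\<^sub>R u) =
     h * frechet_derivative ?D (at (x + s *\<^sub>R u + r *\<^sub>R w)) w"
    by auto
  show ?thesis
  proof (rule bexI)
    show "x + s *\<^sub>R u + r *\<^sub>R w \<in> ball x d" using inb[of s r] s r by simp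
    show "f (x + h *\<^sub>R u + h *\<^sub>R w) - f (x + h *\<^sub>R u) - f (x + h *\<^sub>R w) + f x =
      h\<^sup>2 * frechet_derivative ?D (at (x + s *\<^sub>R u + r *\<^sub>R w)) w"
      using e1 e2 by (simp add: power2_eq_square algebra_simps)
  qed
qed

text \<open>Schwarz's theorem: each iterated derivative, taken at some point near \<open>x\<close>,
  equals the same second difference quotient, so continuity forces the two values at
  \<open>x\<close> to agree.\<close>

lemma frechet_derivative_commute:
  fixes f :: "'a::euclidean_space \<Rightarrow> real"
  assumes U: "open U" "x \<in> U" and f: "Cinf_on U f"
  shows "frechet_derivative (\<lambda>z. frechet_derivative f (at z) u) (at x) w =
         frechet_derivative (\<lambda>z. frechet_derivative f (at z) w) (at x) u"
    (is "?A x = ?B x")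
proof (rule ccontr)
  assume ne: "?A x \<noteq> ?B x"
  have A: "continuous_on U ?A" and B: "continuous_on U ?B"
    using f by (auto intro!: Cinf_on_continuous_on Cinf_on_frechet_derivative)
  define e where "e = \<bar>?A x - ?B x\<bar> / 2"
  have e: "e > 0" using ne by (simp add: e_def)
  obtain d1 where d1: "d1 > 0" "\<And>y. dist y x < d1 \<Longrightarrow> dist (?A y) (?A x) < e"
    using A U e unfolding continuous_on_eq_continuous_at[OF U(1)] continuous_at_eps_delta by metis
  obtain d2 where d2: "d2 > 0" "\<And>y. dist y x < d2 \<Longrightarrow> dist (?B y) (?B x) < e"
    using B U e unfolding continuous_on_eq_continuous_at[OF U(1)] continuous_at_eps_delta by metis
  obtain d3 where d3: "d3 > 0" "ball x d3 \<subseteq> U" using U open_contains_ball by blast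
  define d where "d = min d3 (min d1 d2)"
  have d: "d > 0" using d1 d2 d3 by (simp add: d_def)
  have fd: "Cinf_on (ball x d) f"
    using f by (rule Cinf_on_subset) (use d3 in \<open>auto simp: d_def\<close>)
  \<comment> \<open>Keeps the parallelogram with sides \<open>h *\<^sub>R u\<close> and
    \<open>h *\<^sub>R w\<close> inside the ball; the summand 1 covers the case that both directions
    vanish.\<close>
  define h where "h = d / (2 * (norm u + norm w + 1))"
  have pos: "norm u + norm w + 1 > 0" by (simp add: add_nonneg_pos)
  have h: "h > 0" using d pos by (simp add: h_def)
  have "h * (norm u + norm w) < h * (2 * (norm u + norm w + 1))"
    using h pos by (intro mult_strict_left_mono) (auto simp: add_nonneg_pos)
  also have "\<dots> = d" using pos by (simp add: h_def)
  finally have hd: "h * (norm u + norm w) < d" .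
  obtain y where y: "y \<in> ball x d"
    "f (x + h *\<^sub>R u + h *\<^sub>R w) - f (x + h *\<^sub>R u) - f (x + h *\<^sub>R w) + f x = h\<^sup>2 * ?A y"
    using second_difference_mvt[OF fd h hd] by blast
  obtain z where z: "z \<in> ball x d"
    "f (x + h *\<^sub>R w + h *\<^sub>R u) - f (x + h *\<^sub>R w) - f (x + h *\<^sub>R u) + f x = h\<^sup>2 * ?B z"
    using second_difference_mvt[OF fd h, of w u] hd by (auto simp: add.commute)
  have "h\<^sup>2 * ?A y = h\<^sup>2 * ?B z"
    using y(2) z(2) by (simp add: algebra_simps)
  then have "?A y = ?B z" using h by simp
  moreover have "dist (?A y) (?A x) < e" "dist (?B z) (?B x) < e"
    using y z d1(2)[of y] d2(2)[of z] by (auto simp: d_def dist_commute)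
  ultimately have "dist (?A x) (?B x) < 2 * e" by (simp add: dist_real_def)
  then show False by (simp add: e_def dist_real_def)
qed

section \<open>Matrices\<close>

lemma bounded_bilinear_matrix_matrix_mult:
  "bounded_bilinear ((**) :: real ^ 'n ^ 'm \<Rightarrow> real ^ 'k ^ 'n \<Rightarrow> real ^ 'k ^ 'm)"
  unfolding bilinear_conv_bounded_bilinear[symmetric] bilinear_def
  by (auto intro!: linearI simp: matrix_matrix_mult_def vec_eq_iff algebra_simps sum.distrib
      sum_distrib_left sum_distrib_right)

interpretation matrix_mult: bounded_bilinear "(**) :: real ^ 'n ^ 'm \<Rightarrow> real ^ 'k ^ 'n \<Rightarrow> real ^ 'k ^ 'm"
  by (rule bounded_bilinear_matrix_matrix_mult)

lemma bounded_bilinear_matrix_vector_mult: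
  "bounded_bilinear ((*v) :: real ^ 'n ^ 'm \<Rightarrow> real ^ 'n \<Rightarrow> real ^ 'm)"
  unfolding bilinear_conv_bounded_bilinear[symmetric] bilinear_def
  by (auto intro!: linearI simp: matrix_vector_mult_def vec_eq_iff algebra_simps sum.distrib
      sum_distrib_left sum_distrib_right)

interpretation matrix_vector: bounded_bilinear "(*v) :: real ^ 'n ^ 'm \<Rightarrow> real ^ 'n \<Rightarrow> real ^ 'm"
  by (rule bounded_bilinear_matrix_vector_mult)

lemma bounded_linear_trace: "bounded_linear (trace :: real ^ 'm ^ 'm \<Rightarrow> real)"
  by (auto intro!: linear_conv_bounded_linear[THEN iffD1] linearI
      simp: trace_def sum.distrib sum_distrib_left)

lemma trace_scaleR: "trace (c *\<^sub>R A) = c * trace A" and trace_minus: "trace (- A) = - trace A"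
  for A :: "real ^ 'm ^ 'm"
  by (simp_all add: trace_def sum_distrib_left sum_negf)

section \<open>Derivatives of determinant and inverse; the Riccati equation\<close>

text \<open>A permutation other than the identity moves at least two points, so after
  differentiating one factor an off-diagonal zero of the identity matrix is still present. Only the
  diagonal product contributes.\<close>

lemma det_has_vector_derivative_at_id:
  fixes A :: "real \<Rightarrow> real ^ 'm ^ 'm"
  assumes A: "(A has_vector_derivative A') (at t within S)" and id: "A t = mat 1"
  shows "((\<lambda>s. det (A s)) has_vector_derivative trace A') (at t within S)"
proof -
  let ?D = "\<lambda>p. \<Sum>i\<in>UNIV. A' $ i $ p i * (\<Prod>j\<in>UNIV - {i}. A t $ j $ p j)"
  have e: "((\<lambda>s. A s $ i $ j) has_derivative (\<lambda>h. h * A' $ i $ j)) (at t within S)" for i j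
    using bounded_linear.has_derivative[OF bounded_linear_vec_nth
        bounded_linear.has_derivative[OF bounded_linear_vec_nth A[unfolded has_vector_derivative_def]]]
    by simp
  have z: "?D p = 0" if p: "p permutes (UNIV :: 'm set)" "p \<noteq> id" for p
  proof (rule sum.neutral, rule ballI)
    fix i :: 'm
    obtain k where k: "p k \<noteq> k" using p(2) by (auto simp: fun_eq_iff)
    have inj: "inj p" using p(1) by (rule permutes_inj)
    have "\<exists>j. j \<noteq> i \<and> p j \<noteq> j"
      using k inj by (metis injD)
    then obtain j where "j \<noteq> i" "p j \<noteq> j" by blast
    then have "(\<Prod>j\<in>UNIV - {i}. A t $ j $ p j) = 0"
      by (intro prod_zero) (auto simp: id mat_def intro!: bexI[of _ j])
    then show "A' $ i $ p i * (\<Prod>j\<in>UNIV - {i}. A t $ j $ p j) = 0" by simp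
  qed
  have "((\<lambda>s. det (A s)) has_derivative
      (\<lambda>h. \<Sum>p | p permutes (UNIV :: 'm set). of_int (sign p) * (\<Sum>i\<in>UNIV. h * A' $ i $ p i * (\<Prod>j\<in>UNIV - {i}. A t $ j $ p j))))
      (at t within S)"
    unfolding det_def by (intro has_derivative_sum has_derivative_mult_right has_derivative_prod e)
  also have "(\<lambda>h. \<Sum>p | p permutes (UNIV :: 'm set). of_int (sign p) * (\<Sum>i\<in>UNIV. h * A' $ i $ p i * (\<Prod>j\<in>UNIV - {i}. A t $ j $ p j)))
     = (\<lambda>h. h * (\<Sum>p | p permutes (UNIV :: 'm set). of_int (sign p) * ?D p))"
    by (simp add: sum_distrib_left mult_ac)
  also have "(\<Sum>p | p permutes (UNIV :: 'm set). of_int (sign p) * ?D p) =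
     (\<Sum>p\<in>{id}. of_int (sign p) * ?D p)"
    by (rule sum.mono_neutral_right) (auto simp: z permutes_id finite_permutations)
  also have "\<dots> = trace A'" by (simp add: id mat_def trace_def)
  finally show ?thesis by (simp add: has_vector_derivative_def mult.commute)
qed

text \<open>Jacobi's formula, reduced to the identity matrix by multiplying with the constant
  \<open>matrix_inv (A t)\<close>.\<close>

lemma det_has_vector_derivative:
  fixes A :: "real \<Rightarrow> real ^ 'm ^ 'm"
  assumes A: "(A has_vector_derivative A') (at t within S)" and nz: "det (A t) \<noteq> 0"
  shows "((\<lambda>s. det (A s)) has_vector_derivative det (A t) * trace (A' ** matrix_inv (A t))) (at t within S)"
proof -
  let ?K = "matrix_inv (A t)"
  have "((\<lambda>s. ?K ** A s) has_vector_derivative ?K ** A') (at t within S)"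
    using A by (rule bounded_linear.has_vector_derivative[OF matrix_mult.bounded_linear_right])
  then have "((\<lambda>s. det (?K ** A s)) has_vector_derivative trace (?K ** A')) (at t within S)"
    by (rule det_has_vector_derivative_at_id) (rule matrix_inv_left[OF nz])
  then have "((\<lambda>s. det (A t) * det (?K ** A s)) has_vector_derivative det (A t) * trace (?K ** A')) (at t within S)"
    by (rule bounded_linear.has_vector_derivative[OF bounded_linear_mult_right])
  moreover have "det (A t) * det ?K = 1"
    by (simp add: det_mul[symmetric] matrix_inv_right[OF nz])
  then have "det (A t) * det (?K ** A s) = det (A s)" for s
    by (simp add: det_mul mult.assoc[symmetric])
  ultimately show ?thesis by (simp add: trace_mul_sym[of ?K])
qed

lemma continuous_on_det: "continuous_on UNIV (det :: real ^ 'm ^ 'm \<Rightarrow> real)"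
  unfolding det_def by (intro continuous_intros)

lemma open_det_nonzero: "open {X :: real ^ 'm ^ 'm. det X \<noteq> 0}"
  using continuous_open_preimage[OF continuous_on_det open_UNIV, of "- {0}"]
  by (simp add: vimage_def Collect_neg_eq open_Compl)

text \<open>Cramer's rule already gives differentiability; the formula is then forced by
  differentiating \<open>matrix_inv X ** X\<close>, which is constant on the open set of invertible
  matrices.\<close>

lemma matrix_inv_has_derivative:
  fixes A :: "real ^ 'm ^ 'm"
  assumes nz: "det A \<noteq> 0"
  shows "(matrix_inv has_derivative (\<lambda>X. - (matrix_inv A ** X ** matrix_inv A))) (at A)"
proof -
  let ?V = "{X :: real ^ 'm ^ 'm. det X \<noteq> 0}" and ?K = "matrix_inv A"
  have "Cinf_on ?V (\<lambda>X. \<chi> i j. matrix_inv X $ i $ j)"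
    using open_det_nonzero
    by (intro Cinf_on_vec_lambda Cinf_on_matrix_inv Cinf_on_vec_nth Cinf_on_bounded_linear bounded_linear_ident)
       auto
  then have "Cinf_on ?V (matrix_inv :: real ^ 'm ^ 'm \<Rightarrow> _)" by simp
  then obtain D where D: "(matrix_inv has_derivative D) (at A)"
    using Cinf_on_has_derivative nz by blast
  have "((\<lambda>X. matrix_inv X ** X) has_derivative (\<lambda>X. ?K ** X + D X ** A)) (at A)"
    by (rule matrix_mult.FDERIV[OF D has_derivative_ident])
  moreover have "((\<lambda>X. matrix_inv X ** X) has_derivative (\<lambda>X. 0)) (at A)"
    by (rule has_derivative_transform_within_open[OF has_derivative_const[of "mat 1"] open_det_nonzero])
       (use nz in \<open>auto simp: matrix_inv_left\<close>)
  ultimately have "(\<lambda>X. ?K ** X + D X ** A) = (\<lambda>X. 0)" by (rule has_derivative_unique)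
  then have "D X ** A = - (?K ** X)" for X by (metis add_eq_0_iff)
  then have "D X ** A ** ?K = - (?K ** X ** ?K)" for X by (simp add: matrix_mult.minus_left)
  then have "D = (\<lambda>X. - (?K ** X ** ?K))"
    by (simp add: fun_eq_iff matrix_mul_assoc[symmetric] matrix_inv_right[OF nz])
  with D show ?thesis by simp
qed

lemma matrix_inv_has_vector_derivative:
  fixes A :: "real \<Rightarrow> real ^ 'm ^ 'm"
  assumes "(A has_vector_derivative A') (at t within S)" "det (A t) \<noteq> 0"
  shows "((\<lambda>s. matrix_inv (A s)) has_vector_derivative - (matrix_inv (A t) ** A' ** matrix_inv (A t))) (at t within S)"
  using vector_derivative_diff_chain_within[OF assms(1) has_derivative_at_withinI[OF matrix_inv_has_derivative[OF assms(2)]]]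
  by (simp add: o_def)

lemma trace_commutator: "trace (A ** B - B ** A) = (0 :: real)" for A B :: "real ^ 'm ^ 'm"
  by (simp add: trace_sub trace_mul_sym[of A B])

text \<open>With \<open>w\<close> as connection matrix, \<open>MJ\<close> says that \<open>M\<close>
  is the covariant derivative of \<open>Jm\<close>, and \<open>MM\<close> is the Jacobi equation.
  They give B' = - R - B^2 + [B, w], and the trace removes the commutator.\<close>

lemma raychaudhuri:
  fixes Jm :: "real \<Rightarrow> real ^ 'm ^ 'm"
  assumes J: "(Jm has_vector_derivative J') (at t within S)" and nz: "det (Jm t) \<noteq> 0"
    and M: "(M has_vector_derivative M') (at t within S)"
    and MJ: "M t = J' + w ** Jm t - Jm t ** w"
    and MM: "M' + w ** M t - M t ** w = - (R ** Jm t)"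
  defines "B \<equiv> M t ** matrix_inv (Jm t)"
  shows "((\<lambda>s. trace (M s ** matrix_inv (Jm s))) has_vector_derivative - trace R - trace (B ** B)) (at t within S)"
    and "trace (J' ** matrix_inv (Jm t)) = trace B"
proof -
  let ?K = "matrix_inv (Jm t)"
  note K = matrix_inv_right[OF nz] matrix_inv_left[OF nz]
  have KJ: "X ** ?K ** Jm t = X" "X ** Jm t ** ?K = X" for X :: "real ^ 'm ^ 'm"
    using K by (simp_all add: matrix_mul_assoc[symmetric])
  note bil = matrix_mult.add_left matrix_mult.add_right matrix_mult.diff_left matrix_mult.diff_right
    matrix_mult.minus_left matrix_mult.minus_right matrix_mul_assoc
  have J'_eq: "J' = M t - w ** Jm t + Jm t ** w" using MJ by simp
  have M'_eq: "M' = - (R ** Jm t) - w ** M t + M t ** w"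
    using MM[symmetric] by simp
  have "((\<lambda>s. M s ** matrix_inv (Jm s)) has_vector_derivative
      M t ** - (?K ** J' ** ?K) + M' ** ?K) (at t within S)"
    using matrix_mult.has_vector_derivative[OF M matrix_inv_has_vector_derivative[OF J nz]] .
  also have "M t ** - (?K ** J' ** ?K) + M' ** ?K = - (B ** B) - R + (B ** w - w ** B)"
    unfolding J'_eq M'_eq B_def by (simp add: bil KJ K)
  finally have "((\<lambda>s. trace (M s ** matrix_inv (Jm s))) has_vector_derivative
      trace (- (B ** B) - R + (B ** w - w ** B))) (at t within S)"
    by (rule bounded_linear.has_vector_derivative[OF bounded_linear_trace])
  moreover have "trace (- (B ** B) - R + (B ** w - w ** B)) = - trace R - trace (B ** B)"
    using trace_commutator[of B w] by (simp add: trace_add trace_sub trace_minus)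
  ultimately show "((\<lambda>s. trace (M s ** matrix_inv (Jm s))) has_vector_derivative - trace R - trace (B ** B)) (at t within S)"
    by simp
  \<comment> \<open>The ordinary derivative differs from \<open>M t\<close> by a commutator with
    \<open>w\<close>; times the inverse of \<open>Jm t\<close> this is \<open>w\<close> minus a
    conjugate of \<open>w\<close>, of trace zero. So \<open>B\<close> may stand in Jacobi's formula
    for the determinant.\<close>
  have "J' ** ?K = B - (w ** (Jm t ** ?K) - Jm t ** (w ** ?K))"
    unfolding J'_eq B_def by (simp add: bil)
  moreover have "trace (Jm t ** (w ** ?K)) = trace w"
    by (subst trace_mul_sym) (simp add: matrix_mul_assoc[symmetric] K)
  ultimately show "trace (J' ** ?K) = trace B" by (simp add: trace_sub K)
qed

section \<open>The trace inequality in Lorentzian signature\<close>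

lemma sum_UNIV_option: "(\<Sum>i\<in>(UNIV :: 'n::finite option set). f i) = f None + (\<Sum>i\<in>UNIV. f (Some i))"
  by (simp add: UNIV_option_conv sum.reindex)

lemma minkowski_mult: "(minkowski ** C) $ a $ b = (if a = None then - C $ a $ b else C $ a $ b)"
proof -
  have "(minkowski ** C) $ a $ b = (\<Sum>k\<in>UNIV. if a = k then (if a = None then - 1 else 1) * C $ k $ b else 0)"
    unfolding minkowski_def matrix_matrix_mult_def vec_lambda_beta by (rule sum.cong) auto
  then show ?thesis by simp
qed

lemma minkowski_mult_vec: "(minkowski *v u) $ a = (if a = None then - u $ a else u $ a)"
proof -
  have "(minkowski *v u) $ a = (\<Sum>k\<in>UNIV. if a = k then (if a = None then - 1 else 1) * u $ k else 0)"
    unfolding minkowski_def matrix_vector_mult_def vec_lambda_beta by (rule sum.cong) auto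
  then show ?thesis by simp
qed

text \<open>After dividing \<open>u\<close> by its time component, \<open>u = (1, q)\<close>, the trace is the squared Frobenius norm
  of \<open>W D W\<close>, where \<open>D\<close> is the spatial block and \<open>W = 1 - s q q\<^sup>T\<close> is the square root of
  \<open>1 - q q\<^sup>T\<close>.\<close>

lemma trace_square_nonneg_minkowski:
  fixes C :: "real ^ 'n::finite option ^ 'n option"
  assumes sym: "transpose (minkowski ** C) = minkowski ** C" and Cu: "C *v u = 0"
    and u: "u \<bullet> (minkowski *v u) = - 1"
  shows "trace (C ** C) \<ge> 0"
proof -
  define a where "a = C $ None $ None"
  define b where "b i = C $ None $ Some i" for i
  define d where "d i j = C $ Some i $ Some j" for i j
  define q where "q i = u $ Some i / u $ None" for i
  have sy: "(minkowski ** C) $ j $ i = (minkowski ** C) $ i $ j" for i j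
    using arg_cong[OF sym, of "\<lambda>M. M $ i $ j"] by (simp add: transpose_def)
  \<comment> \<open>\<open>minkowski\<close> flips the sign of the time row only, so symmetry of
    \<open>minkowski ** C\<close> makes the time row and the time column of \<open>C\<close>
    opposite, while the spatial block is symmetric.\<close>
  have cb: "C $ Some i $ None = - b i" for i
    using sy[of None "Some i"] by (simp add: minkowski_mult b_def)
  have dsym: "d i j = d j i" for i j
    using sy[of "Some i" "Some j"] by (simp add: minkowski_mult d_def)
  have u2: "(u $ None)\<^sup>2 = 1 + (\<Sum>i\<in>UNIV. (u $ Some i)\<^sup>2)"
    using u by (simp add: inner_vec_def sum_UNIV_option minkowski_mult_vec power2_eq_square)
  have "(u $ None)\<^sup>2 > 0" unfolding u2 by (intro add_pos_nonneg sum_nonneg) auto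
  then have u0: "u $ None \<noteq> 0" by simp
  define Q where "Q = (\<Sum>i\<in>UNIV. (q i)\<^sup>2)"
  have "Q * (u $ None)\<^sup>2 = (\<Sum>i\<in>UNIV. (u $ Some i)\<^sup>2)"
    using u0 by (simp add: Q_def q_def power_divide sum_distrib_right)
  then have "Q * (u $ None)\<^sup>2 = (u $ None)\<^sup>2 - 1" using u2 by simp
  then have Q1: "Q < 1"
    using \<open>(u $ None)\<^sup>2 > 0\<close> by (smt (verit) mult_le_cancel_right1)
  have r0: "(C *v u) $ None = 0" "(C *v u) $ Some i = 0" for i using Cu by simp_all
  have "a * u $ None + (\<Sum>i\<in>UNIV. b i * u $ Some i) = 0"
    using r0(1) by (simp add: matrix_vector_mult_def sum_UNIV_option a_def b_def)
  then have "a + (\<Sum>i\<in>UNIV. b i * u $ Some i) / u $ None = 0" using u0 by (simp add: field_simps)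
  then have qb: "(\<Sum>i\<in>UNIV. q i * b i) = - a"
    by (simp add: q_def sum_divide_distrib mult.commute)
  have Dq: "(\<Sum>j\<in>UNIV. d i j * q j) = b i" for i
  proof -
    have "(\<Sum>j\<in>UNIV. d i j * u $ Some j) = b i * u $ None"
      using r0(2)[of i] by (simp add: matrix_vector_mult_def sum_UNIV_option cb d_def)
    then have "(\<Sum>j\<in>UNIV. d i j * u $ Some j) / u $ None = b i" using u0 by simp
    then show ?thesis by (simp add: q_def sum_divide_distrib)
  qed
  define r where "r = sqrt (1 - Q)"
  \<comment> \<open>The square of 1 - s q q^T is 1 - (2 s - s^2 Q) q q^T, so \<open>s\<close> has to
    solve 2 s - s^2 Q = 1. Written as 1 / (1 + r) the root makes sense for Q = 0 as well.\<close>
  define s where "s = 1 / (1 + r)"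
  have r: "r \<ge> 0" "r\<^sup>2 = 1 - Q" using Q1 by (auto simp: r_def)
  have s: "2 * s - s\<^sup>2 * Q = 1"
  proof -
    have Qr: "Q = 1 - r\<^sup>2" using r by simp
    have "1 + r \<noteq> 0" using r(1) by simp
    then have s1: "s * (1 + r) = 1" by (simp add: s_def)
    have "2 * s - s\<^sup>2 * Q = 2 * s * (s * (1 + r)) - s\<^sup>2 * (1 - r\<^sup>2)" unfolding Qr s1 by simp
    also have "\<dots> = (s * (1 + r))\<^sup>2" by (simp add: power2_eq_square algebra_simps)
    finally show ?thesis by (simp add: s1)
  qed
  define B where "B = (\<Sum>i\<in>UNIV. (b i)\<^sup>2)"
  define F where "F = (\<Sum>i\<in>UNIV. \<Sum>j\<in>UNIV. (d i j)\<^sup>2)"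
  have tr: "trace (C ** C) = a\<^sup>2 - 2 * B + F"
  proof -
    have "trace (C ** C) = (\<Sum>i\<in>UNIV. \<Sum>k\<in>UNIV. C $ i $ k * C $ k $ i)"
      by (simp add: trace_def matrix_matrix_mult_def)
    also have "\<dots> = a * a + (\<Sum>k\<in>UNIV. b k * - b k) + (\<Sum>i\<in>UNIV. - b i * b i + (\<Sum>k\<in>UNIV. d i k * d k i))"
      by (simp add: sum_UNIV_option a_def b_def[symmetric] cb d_def)
    also have "\<dots> = a\<^sup>2 - 2 * B + F"
      by (simp add: B_def F_def sum.distrib sum_negf sum_subtractf dsym[of _ "_"] power2_eq_square flip: dsym)
    finally show ?thesis .
  qed
  \<comment> \<open>Entries of W D W, simplified by D q = b and q . b = - a, the spatial and the
    time component of \<open>C *v u = 0\<close>.\<close>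
  define E where "E i j = d i j - s * (q i * b j + b i * q j) - s\<^sup>2 * a * q i * q j" for i j
  have "(\<Sum>i\<in>UNIV. \<Sum>j\<in>UNIV. (E i j)\<^sup>2) =
     F + s\<^sup>2 * (2 * Q * B + 2 * (- a)\<^sup>2) + s\<^sup>2 * s\<^sup>2 * a\<^sup>2 * Q * Q
     - 4 * s * B - 2 * s\<^sup>2 * a * (- a) + 4 * s * s\<^sup>2 * a * (- a) * Q"
  proof -
    have 1: "(\<Sum>i\<in>UNIV. \<Sum>j\<in>UNIV. d i j * q i * b j) = B"
    proof -
      have "(\<Sum>i\<in>UNIV. \<Sum>j\<in>UNIV. d i j * q i * b j) = (\<Sum>j\<in>UNIV. (\<Sum>i\<in>UNIV. d j i * q i) * b j)"
        by (subst sum.swap) (simp add: sum_distrib_right dsym)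
      then show ?thesis by (simp add: Dq B_def power2_eq_square)
    qed
    have 2: "(\<Sum>i\<in>UNIV. \<Sum>j\<in>UNIV. d i j * b i * q j) = B"
    proof -
      have "(\<Sum>i\<in>UNIV. \<Sum>j\<in>UNIV. d i j * b i * q j) = (\<Sum>i\<in>UNIV. b i * (\<Sum>j\<in>UNIV. d i j * q j))"
        by (simp add: sum_distrib_left mult_ac)
      then show ?thesis by (simp add: Dq B_def power2_eq_square)
    qed
    have 3: "(\<Sum>i\<in>UNIV. \<Sum>j\<in>UNIV. d i j * q i * q j) = - a"
    proof -
      have "(\<Sum>i\<in>UNIV. \<Sum>j\<in>UNIV. d i j * q i * q j) = (\<Sum>i\<in>UNIV. q i * (\<Sum>j\<in>UNIV. d i j * q j))"
        by (simp add: sum_distrib_left mult_ac)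
      then show ?thesis by (simp add: Dq qb)
    qed
    have "(E i j)\<^sup>2 = (d i j)\<^sup>2 + s\<^sup>2 * ((q i)\<^sup>2 * (b j)\<^sup>2) + s\<^sup>2 * ((b i)\<^sup>2 * (q j)\<^sup>2) + 2 * s\<^sup>2 * ((q i * b i) * (q j * b j))
       + s\<^sup>2 * s\<^sup>2 * a\<^sup>2 * ((q i)\<^sup>2 * (q j)\<^sup>2) - 2 * s * (d i j * q i * b j) - 2 * s * (d i j * b i * q j)
       - 2 * s\<^sup>2 * a * (d i j * q i * q j) + 2 * s * s\<^sup>2 * a * ((q i)\<^sup>2 * (q j * b j)) + 2 * s * s\<^sup>2 * a * ((q i * b i) * (q j)\<^sup>2)" for i j
      unfolding E_def by (simp add: power2_eq_square algebra_simps)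
    then have "(\<Sum>i\<in>UNIV. \<Sum>j\<in>UNIV. (E i j)\<^sup>2) =
       F + s\<^sup>2 * (Q * B) + s\<^sup>2 * (B * Q) + 2 * s\<^sup>2 * ((- a) * (- a)) + s\<^sup>2 * s\<^sup>2 * a\<^sup>2 * (Q * Q)
       - 2 * s * B - 2 * s * B - 2 * s\<^sup>2 * a * (- a) + 2 * s * s\<^sup>2 * a * (Q * (- a)) + 2 * s * s\<^sup>2 * a * ((- a) * Q)"
      by (simp only: sum.distrib sum_subtractf sum_distrib_left[symmetric] sum_distrib_right[symmetric] 1 2 3 qb F_def[symmetric] Q_def[symmetric] B_def[symmetric])
    then show ?thesis by (simp add: power2_eq_square algebra_simps)
  qed
  also have "\<dots> = F - 2 * B * (2 * s - s\<^sup>2 * Q) + a\<^sup>2 * (2 * s - s\<^sup>2 * Q)\<^sup>2"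
    by (simp add: power2_eq_square algebra_simps)
  also have "\<dots> = trace (C ** C)" by (simp add: s tr)
  finally have "trace (C ** C) = (\<Sum>i\<in>UNIV. \<Sum>j\<in>UNIV. (E i j)\<^sup>2)" by simp
  then show ?thesis by (simp add: sum_nonneg)
qed

lemma inner_matrix_vector: "x \<bullet> (A *v y) = (transpose A *v x) \<bullet> y" for A :: "real ^ 'n ^ 'm"
  by (metis dot_lmul_matrix inner_commute transpose_matrix_vector transpose_transpose)

text \<open>A basis \<open>P\<close> that brings \<open>G\<close> to Minkowski form replaces
  \<open>C\<close> by a conjugate, whose square has the same trace, and transports the
  hypotheses.\<close>

lemma trace_square_nonneg:
  fixes G C :: "real ^ 'n::finite option ^ 'n option"
  assumes G: "lorentz_signature G" and sym: "transpose (G ** C) = G ** C" and Cv: "C *v v = 0"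
    and v: "v \<bullet> (G *v v) = - 1"
  shows "trace (C ** C) \<ge> 0"
proof -
  obtain P :: "real ^ 'n option ^ 'n option" where P: "invertible P" "transpose P ** G ** P = minkowski"
    using G unfolding lorentz_signature_def by blast
  have nz: "det P \<noteq> 0" using P(1) by (simp add: invertible_det_nz)
  let ?S = "matrix_inv P" and ?C = "matrix_inv P ** C ** P"
  have PS: "X ** P ** ?S = X" "X ** ?S ** P = X" for X :: "real ^ 'n option ^ 'n option"
    by (simp_all add: matrix_mul_assoc[symmetric] matrix_inv_right[OF nz] matrix_inv_left[OF nz])
  define H where "H = G ** C"
  have H: "transpose H = H" using sym by (simp add: H_def)
  have mC: "minkowski ** ?C = transpose P ** H ** P"
    unfolding P(2)[symmetric] H_def by (simp add: matrix_mul_assoc PS)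
  have "trace (?C ** ?C) \<ge> 0"
  proof (rule trace_square_nonneg_minkowski[where u = "?S *v v"])
    show "transpose (minkowski ** ?C) = minkowski ** ?C"
      unfolding mC by (simp only: matrix_transpose_mul transpose_transpose H matrix_mul_assoc)
    show "?C *v (?S *v v) = 0"
      by (simp add: matrix_vector_mul_assoc PS) (simp add: matrix_vector_mul_assoc[symmetric] Cv)
    have "(?S *v v) \<bullet> (minkowski *v (?S *v v)) = (P *v (?S *v v)) \<bullet> (G *v (P *v (?S *v v)))"
      unfolding P(2)[symmetric]
      by (simp only: matrix_vector_mul_assoc[symmetric] inner_matrix_vector[of _ "transpose P"] transpose_transpose)
    also have "P *v (?S *v v) = v" by (simp add: matrix_vector_mul_assoc matrix_inv_right[OF nz])
    finally show "(?S *v v) \<bullet> (minkowski *v (?S *v v)) = - 1" using v by simp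
  qed
  also have "trace (?C ** ?C) = trace (C ** C)"
  proof -
    have "?C ** ?C = ?S ** (C ** C ** P)" by (simp add: matrix_mul_assoc PS)
    then show ?thesis by (simp add: trace_mul_sym[of ?S] PS)
  qed
  finally show ?thesis .
qed

lemma lorentz_signature_transpose:
  fixes G :: "real ^ 'n::finite option ^ 'n option"
  assumes "lorentz_signature G" shows "transpose G = G" and "det G \<noteq> 0"
proof -
  obtain P :: "real ^ 'n option ^ 'n option" where P: "invertible P" "transpose P ** G ** P = minkowski"
    using assms unfolding lorentz_signature_def by blast
  have nz: "det P \<noteq> 0" using P(1) by (simp add: invertible_det_nz)
  have nz': "det (transpose P) \<noteq> 0" using nz by (simp add: det_transpose)
  have tm: "transpose minkowski = (minkowski :: real ^ 'n::finite option ^ 'n option)"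
    by (auto simp: minkowski_def transpose_def vec_eq_iff)
  have "transpose P ** transpose G ** P = transpose (transpose P ** G ** P)"
    by (simp only: matrix_transpose_mul transpose_transpose matrix_mul_assoc)
  then have "transpose P ** transpose G ** P = transpose P ** G ** P"
    by (simp only: P(2) tm)
  then have "matrix_inv (transpose P) ** (transpose P ** transpose G ** P) ** matrix_inv P =
      matrix_inv (transpose P) ** (transpose P ** G ** P) ** matrix_inv P" by simp
  moreover have "matrix_inv (transpose P) ** (transpose P ** X ** P) ** matrix_inv P = X" for X
  proof -
    have "matrix_inv (transpose P) ** (transpose P ** X ** P) ** matrix_inv P =
        (matrix_inv (transpose P) ** transpose P) ** X ** (P ** matrix_inv P)"
      by (simp only: matrix_mul_assoc)
    then show ?thesis by (simp add: matrix_inv_right[OF nz] matrix_inv_left[OF nz'])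
  qed
  ultimately show "transpose G = G" by simp
  have "minkowski ** minkowski = (mat 1 :: real ^ 'n option ^ 'n option)"
    by (auto simp: vec_eq_iff minkowski_mult) (auto simp: minkowski_def mat_def)
  then have "det (minkowski :: real ^ 'n option ^ 'n option) * det (minkowski :: real ^ 'n option ^ 'n option) = 1"
    by (simp flip: det_mul)
  then have "det (minkowski :: real ^ 'n option ^ 'n option) \<noteq> 0" by auto
  then have "det (transpose P ** G ** P) \<noteq> 0" by (simp add: P(2))
  then show "det G \<noteq> 0" by (simp add: det_mul)
qed

definition outer :: "real ^ 'm \<Rightarrow> real ^ 'm \<Rightarrow> real ^ 'm ^ 'm" where
  "outer x y = (\<chi> i j. x $ i * y $ j)"

lemma outer_mult_vec: "outer x y *v z = (y \<bullet> z) *\<^sub>R x"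
  by (simp add: outer_def matrix_vector_mult_def vec_eq_iff inner_vec_def sum_distrib_left sum_distrib_right mult_ac)

lemma mult_outer: "A ** outer x y = outer (A *v x) y"
  by (simp add: outer_def matrix_matrix_mult_def matrix_vector_mult_def vec_eq_iff sum_distrib_left mult_ac)

lemma outer_zero [simp]: "outer 0 y = 0" "outer x 0 = 0"
  by (simp_all add: outer_def vec_eq_iff)

lemma transpose_outer: "transpose (outer x y) = outer y x"
  by (simp add: outer_def transpose_def vec_eq_iff mult.commute)

lemma trace_outer: "trace (outer x y) = x \<bullet> y"
  by (simp add: outer_def trace_def inner_vec_def)

lemma transpose_add: "transpose (A + B) = transpose A + transpose (B :: real ^ 'n ^ 'm)"
  and transpose_scaleR: "transpose (c *\<^sub>R A) = c *\<^sub>R transpose A"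
  and transpose_diff: "transpose (A - B) = transpose A - transpose (B :: real ^ 'n ^ 'm)"
  by (simp_all add: transpose_def vec_eq_iff)

text \<open>Cauchy-Schwarz for the trace form by completing the square: \<open>?\<Pi>\<close> is the
  orthogonal projection along \<open>v\<close>, and \<open>B\<close> without its trace part
  \<open>m *\<^sub>R ?\<Pi>\<close> is still self-adjoint and still annihilates
  \<open>v\<close>.\<close>

lemma trace_square_ge:
  fixes G B :: "real ^ 'n::finite option ^ 'n option"
  assumes G: "lorentz_signature G" and sym: "transpose (G ** B) = G ** B" and Bv: "B *v v = 0"
    and v: "v \<bullet> (G *v v) = - 1"
  shows "(trace B)\<^sup>2 / real CARD('n) \<le> trace (B ** B)"
proof -
  let ?n = "real CARD('n)" and ?\<Pi> = "mat 1 + outer v (G *v v)"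
  define m where "m = trace B / ?n"
  define C where "C = B - m *\<^sub>R ?\<Pi>"
  have n: "?n > 0" by simp
  have GP: "G ** ?\<Pi> = G + outer (G *v v) (G *v v)"
    by (simp add: matrix_mult.add_right mult_outer)
  have "(G *v v) \<bullet> v = - 1" using v by (simp add: inner_commute)
  then have Pv: "?\<Pi> *v v = 0"
    by (simp add: matrix_vector.add_left outer_mult_vec)
  have "trace (C ** C) \<ge> 0"
  proof (rule trace_square_nonneg[OF G _ _ v])
    show "transpose (G ** C) = G ** C"
      unfolding C_def matrix_mult.diff_right matrix_mult.scaleR_right GP transpose_diff transpose_scaleR sym
      by (simp add: transpose_add transpose_outer lorentz_signature_transpose(1)[OF G])
    show "C *v v = 0"
      unfolding C_def matrix_vector.diff_left matrix_vector.scaleR_left Pv Bv by simp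
  qed
  also have "C ** C = B ** B - m *\<^sub>R (B ** ?\<Pi>) - m *\<^sub>R (?\<Pi> ** B) + (m * m) *\<^sub>R (?\<Pi> ** ?\<Pi>)"
    unfolding C_def
    by (simp only: matrix_mult.diff_right matrix_mult.diff_left matrix_mult.scaleR_right matrix_mult.scaleR_left
        scaleR_diff_right) (simp add: algebra_simps)
  also have "trace \<dots> = trace (B ** B) - 2 * m * trace (B ** ?\<Pi>) + m * m * trace (?\<Pi> ** ?\<Pi>)"
    by (simp only: trace_add trace_sub trace_scaleR trace_mul_sym[of ?\<Pi> B])
  also have "B ** ?\<Pi> = B" by (simp add: matrix_mult.add_right mult_outer Bv)
  also have "?\<Pi> ** ?\<Pi> = ?\<Pi>"
    by (subst matrix_mult.add_right) (simp add: mult_outer Pv)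
  \<comment> \<open>The identity contributes n + 1, and \<open>outer v (G *v v)\<close> contributes
    g(v, v) = - 1.\<close>
  also have "trace ?\<Pi> = ?n"
    using v by (simp add: trace_add trace_I trace_outer card_UNIV_option)
  finally have "0 \<le> trace (B ** B) - 2 * m * trace B + m * m * ?n" .
  then show ?thesis using n by (simp add: m_def power2_eq_square field_simps)
qed

section \<open>Determinants of endomorphisms of a hyperplane\<close>

text \<open>Relabelling along an injection sends transpositions to transpositions. Needed to match
  permutations of \<open>'n\<close> with permutations of its copy inside
  \<open>'n option\<close>.\<close>

lemma sign_map_permutation:
  assumes "inj_on f A" "finite A" "p permutes A"
  shows "sign (map_permutation A f p) = sign p"
  using assms(3,2)
proof (induction rule: permutes_induct)
  case id
  then show ?case using assms(1) by (simp add: map_permutation_id' id_def map_permutation_ident')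
next
  case (swap a b p)
  have bij: "bij_betw f A (f ` A)" using assms(1) by (simp add: bij_betw_def)
  have t: "Transposition.transpose a b permutes A" using swap by (simp add: permutes_swap_id)
  have pm: "permutation (map_permutation A f p)" "permutation p"
    using map_permutation_permutes[OF bij swap(4)] swap(4) assms(2)
    by (auto intro: permutes_imp_permutation)
  have ne: "f a \<noteq> f b" using swap assms(1) by (auto dest: inj_onD)
  have "map_permutation A f (Transposition.transpose a b \<circ> p) = Transposition.transpose (f a) (f b) \<circ> map_permutation A f p"
    using map_permutation_compose'[OF assms(1) swap(4)] map_permutation_transpose[OF assms(1)] swap by metis
  then show ?case
    using swap ne by (simp only: sign_compose[OF permutation_swap_id pm(1)] sign_compose[OF permutation_swap_id pm(2)] sign_swap_id if_False)
qed

text \<open>A permutation that moves \<open>None\<close> picks up a zero from the column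
  \<open>None\<close>; those that fix it are the permutations of the image of
  \<open>Some\<close>.\<close>

lemma det_option_block:
  fixes M :: "real ^ 'n::finite option ^ 'n option"
  assumes 1: "M $ None $ None = 1" and 0: "\<And>i. M $ Some i $ None = 0"
  shows "det M = det (\<chi> i j. M $ Some i $ Some j :: real ^ 'n ^ 'n)"
proof -
  let ?P = "{p. p permutes (UNIV :: 'n option set)}" and ?Q = "{p. p permutes range (Some :: 'n \<Rightarrow> _)}"
  let ?R = "{p. p permutes (UNIV :: 'n set)}"
  let ?m = "map_permutation UNIV (Some :: 'n \<Rightarrow> _)"
  have inj: "inj (Some :: 'n \<Rightarrow> _)" by simp
  have bij: "bij_betw (Some :: 'n \<Rightarrow> _) UNIV (range Some)" by (simp add: bij_betw_def)
  have ap: "?m p (Some i) = Some (p i)" for p i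
    using inj by (simp add: map_permutation_def restrict_id_def)
  have apN: "?m p None = None" for p
    by (simp add: map_permutation_def restrict_id_def)
  have "det M = (\<Sum>p\<in>?P. of_int (sign p) * (\<Prod>i\<in>UNIV. M $ i $ p i))" by (simp add: det_def)
  also have "\<dots> = (\<Sum>p\<in>?Q. of_int (sign p) * (\<Prod>i\<in>UNIV. M $ i $ p i))"
  proof (rule sum.mono_neutral_right)
    show "finite ?P" by (simp add: finite_permutations)
    show "?Q \<subseteq> ?P" by (auto intro: permutes_subset)
    show "\<forall>p\<in>?P - ?Q. of_int (sign p) * (\<Prod>i\<in>UNIV. M $ i $ p i) = 0"
    proof
      fix p assume p: "p \<in> ?P - ?Q"
      then have pp: "p permutes UNIV" by simp
      have "p None \<noteq> None"
      proof
        assume N: "p None = None"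
        have "p permutes range Some"
          using pp N by (auto intro!: permutes_superset[OF pp] simp: UNIV_option_conv)
        then show False using p by simp
      qed
      obtain i where i: "p i = None" using permutes_surj[OF pp] by (metis surjD)
      then have "i \<noteq> None" using \<open>p None \<noteq> None\<close> by metis
      then have "M $ i $ p i = 0" using 0 i by (cases i) auto
      then have "(\<Prod>i\<in>UNIV. M $ i $ p i) = 0" by (intro prod_zero) auto
      then show "of_int (sign p) * (\<Prod>i\<in>UNIV. M $ i $ p i) = 0" by simp
    qed
  qed
  also have "\<dots> = (\<Sum>p\<in>?R. of_int (sign p) * (\<Prod>i\<in>UNIV. M $ Some i $ Some (p i)))"
  proof (rule sum.reindex_bij_witness[where i = ?m and j = "map_permutation (range Some) the"])
    show "map_permutation (range Some) the (?m q) = q" if "q \<in> ?R" for q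
      using that by (intro map_permutation_compose_inv[OF bij]) auto
    show "?m q \<in> ?Q" if "q \<in> ?R" for q
      using that map_permutation_permutes[OF bij] by auto
    show "?m (map_permutation (range Some) the p) = p" if "p \<in> ?Q" for p
      using that by (intro map_permutation_compose_inv) (auto simp: bij_betw_def inj_on_def)
    show "map_permutation (range Some) the p \<in> ?R" if "p \<in> ?Q" for p
    proof -
      have "bij_betw the (range (Some :: 'n \<Rightarrow> _)) UNIV" by (auto simp: bij_betw_def inj_on_def image_image)
      then show ?thesis using that map_permutation_permutes by blast
    qed
    fix p assume "p \<in> ?Q"
    then have p: "p permutes range Some" by simp
    let ?q = "map_permutation (range Some) the p"
    have inj': "inj_on the (range (Some :: 'n \<Rightarrow> _))" by (auto simp: inj_on_def)
    have s: "sign ?q = sign p" using sign_map_permutation[OF inj' _ p] by simp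
    have pi: "p (Some i) = Some (?q i)" for i
    proof -
      have "p = ?m ?q" using p by (intro map_permutation_compose_inv[symmetric]) (auto simp: bij_betw_def inj_on_def)
      then show ?thesis using ap by metis
    qed
    have pN: "p None = None" using p by (auto simp: permutes_def)
    have "(\<Prod>i\<in>UNIV. M $ i $ p i) = (\<Prod>i\<in>UNIV. M $ Some i $ Some (?q i))"
      by (simp add: UNIV_option_conv prod.reindex pN 1 pi)
    then show "of_int (sign ?q) * (\<Prod>i\<in>UNIV. M $ Some i $ Some (?q i)) = of_int (sign p) * (\<Prod>i\<in>UNIV. M $ i $ p i)"
      by (simp add: s)
  qed
  also have "\<dots> = det (\<chi> i j. M $ Some i $ Some j :: real ^ 'n ^ 'n)" by (simp add: det_def)
  finally show ?thesis .
qed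

lemma det_scaleR:
  fixes A :: "real ^ 'n ^ 'n"
  shows "det (c *\<^sub>R A) = c ^ CARD('n) * det A"
proof -
  have "c *\<^sub>R A = (\<chi> i. c *s row i A)" by (simp add: vec_eq_iff row_def)
  then have "det (c *\<^sub>R A) = prod (\<lambda>i. c) (UNIV :: 'n set) * det (\<chi> i. row i A)"
    using det_rows_mul[of "\<lambda>i. c" "\<lambda>i. row i A"] by simp
  moreover have "(\<chi> i. row i A) = A" by (simp add: vec_eq_iff row_def)
  ultimately show ?thesis by simp
qed

text \<open>In the basis consisting of \<open>v\<close> and \<open>b\<close> the matrix
  \<open>F\<close> is block diagonal with blocks 1 and \<open>B\<close>. So the determinant on the
  hyperplane is one of full size, whichever basis is chosen.\<close>

lemma endo_matrix_det:
  fixes S :: "'n::finite coord set" and b :: "'n \<Rightarrow> 'n coord" and B :: "real ^ 'n ^ 'n"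
    and F :: "real ^ 'n option ^ 'n option"
  assumes v: "v \<notin> S" and F: "F *v v = v" "\<And>w. w \<in> S \<Longrightarrow> F *v w = f w"
    and b: "inj b" "independent (range b)" "span (range b) = S"
    and B: "\<And>j. f (b j) = (\<Sum>i\<in>UNIV. B $ i $ j *\<^sub>R b i)"
  shows "det B = det F"
proof -
  define Q :: "real ^ 'n option ^ 'n option" where
    "Q = (\<chi> i j. case j of None \<Rightarrow> v $ i | Some k \<Rightarrow> b k $ i)"
  define B' :: "real ^ 'n option ^ 'n option" where
    "B' = (\<chi> i j. case (i, j) of (None, None) \<Rightarrow> 1 | (Some k, Some l) \<Rightarrow> B $ k $ l | _ \<Rightarrow> 0)"
  have Qx: "Q *v x = x $ None *\<^sub>R v + (\<Sum>k\<in>UNIV. x $ Some k *\<^sub>R b k)" for x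
    by (simp add: Q_def matrix_vector_mult_def vec_eq_iff sum_UNIV_option mult.commute)
  have bS: "b k \<in> S" for k unfolding b(3)[symmetric] by (rule span_base) simp
  have "x = 0" if x: "Q *v x = 0" for x
  proof -
    have sS: "(\<Sum>k\<in>UNIV. x $ Some k *\<^sub>R b k) \<in> S"
      unfolding b(3)[symmetric] by (intro span_sum span_scale span_base) auto
    have S: "subspace S" using b(3) subspace_span by blast
    have N: "x $ None = 0"
    proof (rule ccontr)
      assume nz: "x $ None \<noteq> 0"
      have "x $ None *\<^sub>R v = - (\<Sum>k\<in>UNIV. x $ Some k *\<^sub>R b k)"
        using x unfolding Qx by (rule eq_neg_iff_add_eq_0[THEN iffD2])
      then have "x $ None *\<^sub>R v \<in> S" using sS S by (simp add: subspace_neg)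
      then have "(1 / x $ None) *\<^sub>R (x $ None *\<^sub>R v) \<in> S" using S by (rule subspace_scale[rotated])
      then show False using nz v by simp
    qed
    then have "(\<Sum>k\<in>UNIV. x $ Some k *\<^sub>R b k) = 0" using x Qx by simp
    then have z: "(\<Sum>w\<in>range b. x $ Some (inv b w) *\<^sub>R w) = 0"
      using b(1) by (simp add: sum.reindex)
    have "x $ Some k = 0" for k
      using independentD[OF b(2) _ _ z, of "b k"] b(1) by simp
    with N have "x $ k = 0" for k by (cases k) auto
    then show "x = 0" by (simp add: vec_eq_iff)
  qed
  then have "det Q \<noteq> 0"
    unfolding invertible_det_nz[symmetric] invertible_left_inverse matrix_left_invertible_ker by blast
  have "(F ** Q) $ a $ j = (Q ** B') $ a $ j" for a j
  proof (cases j)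
    case None
    have "(F ** Q) $ a $ None = (F *v v) $ a"
      by (simp add: Q_def matrix_matrix_mult_def matrix_vector_mult_def)
    moreover have "(Q ** B') $ a $ None = v $ a"
      by (simp add: Q_def B'_def matrix_matrix_mult_def sum_UNIV_option)
    ultimately show ?thesis using None F(1) by simp
  next
    case (Some l)
    have "(F ** Q) $ a $ Some l = (F *v b l) $ a"
      by (simp add: Q_def matrix_matrix_mult_def matrix_vector_mult_def)
    also have "\<dots> = (\<Sum>i\<in>UNIV. B $ i $ l *\<^sub>R b i) $ a" using F(2)[OF bS] B by simp
    also have "\<dots> = (Q ** B') $ a $ Some l"
      by (simp add: Q_def B'_def matrix_matrix_mult_def sum_UNIV_option mult.commute)
    finally show ?thesis using Some by simp
  qed
  then have "F ** Q = Q ** B'" by (simp add: vec_eq_iff)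
  then have "det F * det Q = det Q * det B'" by (simp flip: det_mul)
  then have "det F = det B'" using \<open>det Q \<noteq> 0\<close> by simp
  also have "det B' = det B"
    by (subst det_option_block) (auto simp: B'_def)
  finally show ?thesis by simp
qed

section \<open>Lagrangians in a chart\<close>

lemma gform_inner: "gform L z u w = u \<bullet> (gmat L z *v w)"
  by (simp add: gform_def gmat_def inner_vec_def matrix_vector_mult_def sum_distrib_left mult_ac)

lemma frechet_derivative_ddx_ddv:
  assumes "f differentiable (at z)"
  shows "frechet_derivative f (at z) (h, w) = (\<Sum>a\<in>UNIV. h $ a * ddx a f z) + (\<Sum>a\<in>UNIV. w $ a * ddv a f z)"
proof -
  interpret D: linear "frechet_derivative f (at z)" by (rule linear_frechet_derivative[OF assms])
  have "(h, w) = (\<Sum>a\<in>UNIV. h $ a *\<^sub>R (axis a 1, 0)) + (\<Sum>a\<in>UNIV. w $ a *\<^sub>R (0, axis a 1))"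
    by (simp add: prod_eq_iff fst_sum snd_sum vec_eq_iff axis_def if_distrib cong: if_cong)
  then show ?thesis by (simp only: D.add D.sum D.scaleR ddx_def ddv_def real_scaleR_def)
qed

lemma
  assumes "f differentiable (at z)" "g differentiable (at z)"
  shows ddx_mult: "ddx a (\<lambda>z. f z * g z) z = f z * ddx a g z + ddx a f z * g z"
    and ddv_mult: "ddv a (\<lambda>z. f z * g z) z = f z * ddv a g z + ddv a f z * g z"
proof -
  have "((\<lambda>z. f z * g z) has_derivative
      (\<lambda>h. f z * frechet_derivative g (at z) h + frechet_derivative f (at z) h * g z)) (at z)"
    using assms by (intro has_derivative_mult) (auto simp: frechet_derivative_works[symmetric])
  note frechet_derivative_at[OF this, symmetric]
  then show "ddx a (\<lambda>z. f z * g z) z = f z * ddx a g z + ddx a f z * g z"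
    "ddv a (\<lambda>z. f z * g z) z = f z * ddv a g z + ddv a f z * g z"
    by (simp_all add: ddx_def ddv_def)
qed

lemma
  assumes "\<And>i. i \<in> S \<Longrightarrow> f i differentiable (at z)"
  shows ddx_sum: "ddx a (\<lambda>z. \<Sum>i\<in>S. f i z) z = (\<Sum>i\<in>S. ddx a (f i) z)"
    and ddv_sum: "ddv a (\<lambda>z. \<Sum>i\<in>S. f i z) z = (\<Sum>i\<in>S. ddv a (f i) z)"
proof -
  have "((\<lambda>z. \<Sum>i\<in>S. f i z) has_derivative (\<lambda>h. \<Sum>i\<in>S. frechet_derivative (f i) (at z) h)) (at z)"
    using assms by (intro has_derivative_sum) (auto simp: frechet_derivative_works[symmetric])
  note frechet_derivative_at[OF this, symmetric]
  then show "ddx a (\<lambda>z. \<Sum>i\<in>S. f i z) z = (\<Sum>i\<in>S. ddx a (f i) z)"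
    "ddv a (\<lambda>z. \<Sum>i\<in>S. f i z) z = (\<Sum>i\<in>S. ddv a (f i) z)"
    by (simp_all add: ddx_def ddv_def)
qed

lemma bounded_linear_snd_nth: "bounded_linear (\<lambda>z :: 'n::finite coord \<times> 'n coord. snd z $ b)"
  by (rule bounded_linear_compose[OF bounded_linear_vec_nth bounded_linear_snd])

lemma
  shows ddx_snd_nth: "ddx a (\<lambda>z. snd z $ b) z = 0"
    and ddv_snd_nth: "ddv a (\<lambda>z. snd z $ b) z = (if a = b then 1 else 0)"
    and differentiable_snd_nth: "(\<lambda>z. snd z $ b) differentiable (at z)"
  using frechet_derivative_at[OF bounded_linear_imp_has_derivative[OF bounded_linear_snd_nth], symmetric, of b z]
    bounded_linear_imp_has_derivative[OF bounded_linear_snd_nth]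
  by (auto simp: ddx_def ddv_def axis_def differentiable_def)

locale finsler_chart =
  fixes L :: "'n::finite coord \<times> 'n coord \<Rightarrow> real" and U :: "'n coord set"
  assumes U: "open U" and smooth: "Cinf_on (U \<times> - {0}) L"
    and hom: "\<And>x v s. x \<in> U \<Longrightarrow> v \<noteq> 0 \<Longrightarrow> s > 0 \<Longrightarrow> L (x, s *\<^sub>R v) = s\<^sup>2 * L (x, v)"
    and sig: "\<And>x v. x \<in> U \<Longrightarrow> v \<noteq> 0 \<Longrightarrow> lorentz_signature (gmat L (x, v))"
begin

text \<open>The tangent bundle over the chart without its zero section, where \<open>L\<close> need
  not be smooth.\<close>

definition W :: "('n coord \<times> 'n coord) set" where "W = U \<times> - {0}"

lemma W: "open W" by (auto simp: W_def U open_Times open_Compl)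

lemma smooth_L: "Cinf_on W L" using smooth by (simp add: W_def)

lemma W_iff: "(x, v) \<in> W \<longleftrightarrow> x \<in> U \<and> v \<noteq> 0" by (auto simp: W_def)

section \<open>Homogeneity and Euler relations\<close>

definition homogeneous :: "nat \<Rightarrow> ('n coord \<times> 'n coord \<Rightarrow> real) \<Rightarrow> bool" where
  "homogeneous k f \<longleftrightarrow> (\<forall>(x, v)\<in>W. \<forall>s>0. f (x, s *\<^sub>R v) = s ^ k * f (x, v))"

lemma homogeneousD: "homogeneous k f \<Longrightarrow> (x, v) \<in> W \<Longrightarrow> s > 0 \<Longrightarrow> f (x, s *\<^sub>R v) = s ^ k * f (x, v)"
  by (auto simp: homogeneous_def)

lemma homogeneousI: "(\<And>x v s. (x, v) \<in> W \<Longrightarrow> s > 0 \<Longrightarrow> f (x, s *\<^sub>R v) = s ^ k * f (x, v)) \<Longrightarrow> homogeneous k f"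
  by (auto simp: homogeneous_def)

lemma homogeneous_L: "homogeneous 2 L"
  using hom by (auto simp: homogeneous_def W_iff)

lemma Cinf_ddx: "Cinf_on W f \<Longrightarrow> Cinf_on W (ddx a f)"
  unfolding ddx_def[abs_def] by (rule Cinf_on_frechet_derivative)

lemma Cinf_ddv: "Cinf_on W f \<Longrightarrow> Cinf_on W (ddv a f)"
  unfolding ddv_def[abs_def] by (rule Cinf_on_frechet_derivative)

lemma
  assumes "\<And>z. z \<in> W \<Longrightarrow> f z = g z" "z \<in> W" "Cinf_on W f"
  shows ddx_cong: "ddx a f z = ddx a g z" and ddv_cong: "ddv a f z = ddv a g z"
  using frechet_derivative_transform_within_open[OF Cinf_on_differentiable[OF assms(3,2)] W assms(2) assms(1)]
  by (auto simp: ddx_def ddv_def)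

lemma ddv_commute: "Cinf_on W f \<Longrightarrow> z \<in> W \<Longrightarrow> ddv a (ddv b f) z = ddv b (ddv a f) z"
  unfolding ddv_def[abs_def] by (rule frechet_derivative_commute[OF W])

text \<open>Differentiates f(x, s v) = s^k f(x, v). The factor \<open>s\<close> sits in the fibre
  direction only, so base derivatives keep the degree and fibre derivatives lower it by one.\<close>

lemma frechet_derivative_homogeneous:
  assumes f: "Cinf_on W f" and h: "homogeneous k f" and z: "(x, v) \<in> W" and s: "s > 0"
  shows "frechet_derivative f (at (x, s *\<^sub>R v)) (h, s *\<^sub>R w) = s ^ k * frechet_derivative f (at (x, v)) (h, w)"
proof -
  let ?m = "\<lambda>z :: 'n coord \<times> 'n coord. (fst z, s *\<^sub>R snd z)"
  have z': "(x, s *\<^sub>R v) \<in> W" using z s by (simp add: W_iff)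
  have m: "(?m has_derivative ?m) (at (x, v))"
    by (auto intro!: derivative_eq_intros)
  have "((f \<circ> ?m) has_derivative (frechet_derivative f (at (x, s *\<^sub>R v)) \<circ> ?m)) (at (x, v))"
    using Cinf_on_has_derivative[OF f z'] by (intro diff_chain_at m) simp
  moreover have "((\<lambda>z. s ^ k * f z) has_derivative (\<lambda>h. s ^ k * frechet_derivative f (at (x, v)) h)) (at (x, v))"
    by (intro has_derivative_mult_right Cinf_on_has_derivative[OF f z])
  then have "((f \<circ> ?m) has_derivative (\<lambda>h. s ^ k * frechet_derivative f (at (x, v)) h)) (at (x, v))"
    by (rule has_derivative_transform_within_open[OF _ W z]) (use homogeneousD[OF h _ s] in auto)
  ultimately have "frechet_derivative f (at (x, s *\<^sub>R v)) \<circ> ?m = (\<lambda>h. s ^ k * frechet_derivative f (at (x, v)) h)"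
    by (rule has_derivative_unique)
  from fun_cong[OF this, of "(h, w)"] show ?thesis by simp
qed

lemma homogeneous_ddx: "Cinf_on W f \<Longrightarrow> homogeneous k f \<Longrightarrow> homogeneous k (ddx a f)"
  using frechet_derivative_homogeneous[of f k _ _ _ "axis a 1" 0]
  by (intro homogeneousI) (simp add: ddx_def)

lemma homogeneous_ddv:
  assumes "Cinf_on W f" "homogeneous (Suc k) f" shows "homogeneous k (ddv a f)"
proof (rule homogeneousI)
  fix x v and s :: real assume z: "(x, v) \<in> W" and s: "s > 0"
  then have "(x, s *\<^sub>R v) \<in> W" by (simp add: W_iff)
  then interpret D: linear "frechet_derivative f (at (x, s *\<^sub>R v))"
    by (intro linear_frechet_derivative Cinf_on_differentiable[OF assms(1)])
  have "(0, s *\<^sub>R axis a 1) = s *\<^sub>R (0 :: 'n coord, axis a (1::real))" by simp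
  then have "s * ddv a f (x, s *\<^sub>R v) = s ^ Suc k * ddv a f (x, v)"
    using frechet_derivative_homogeneous[OF assms z s, of 0 "axis a 1"] D.scaleR
    by (metis ddv_def real_scaleR_def)
  then show "ddv a f (x, s *\<^sub>R v) = s ^ k * ddv a f (x, v)" using s by simp
qed

text \<open>Both sides are the derivative of f(x, s v) in \<open>s\<close> at
  \<open>s = 1\<close>.\<close>

lemma euler:
  assumes f: "Cinf_on W f" and h: "homogeneous k f" and z: "(x, v) \<in> W"
  shows "(\<Sum>b\<in>UNIV. v $ b * ddv b f (x, v)) = k * f (x, v)"
proof -
  have l: "((\<lambda>s. (x, s *\<^sub>R v)) has_vector_derivative (0, v)) (at 1)"
    by (auto intro!: derivative_eq_intros)
  have "(f has_derivative frechet_derivative f (at (x, v))) (at (x, 1 *\<^sub>R v))"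
    using Cinf_on_has_derivative[OF f z] by simp
  from vector_derivative_diff_chain_within[OF l has_derivative_at_withinI[OF this]]
  have "((\<lambda>s. f (x, s *\<^sub>R v)) has_vector_derivative frechet_derivative f (at (x, v)) (0, v)) (at 1)"
    by (simp add: o_def)
  moreover have "((\<lambda>s. s ^ k * f (x, v)) has_vector_derivative k * f (x, v)) (at 1)"
    by (auto intro!: derivative_eq_intros simp: has_real_derivative_iff_has_vector_derivative[symmetric])
  then have "((\<lambda>s. f (x, s *\<^sub>R v)) has_vector_derivative k * f (x, v)) (at 1)"
    by (rule has_vector_derivative_transform_within_open[of _ _ _ "{0<..}"]) (auto simp: homogeneousD[OF h z])
  ultimately have "frechet_derivative f (at (x, v)) (0, v) = k * f (x, v)"
    by (rule vector_derivative_unique_at)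
  then show ?thesis by (simp add: frechet_derivative_ddx_ddv[OF Cinf_on_differentiable[OF f z]])
qed

lemma Cinf_snd_nth: "Cinf_on W (\<lambda>z. snd z $ b)"
  by (rule Cinf_on_bounded_linear[OF W bounded_linear_snd_nth])

lemma Cinf_gcomp: "Cinf_on W (gcomp L a b)"
  unfolding gcomp_def by (intro Cinf_ddv smooth_L)

lemma gcomp_commute: "z \<in> W \<Longrightarrow> gcomp L a b z = gcomp L b a z"
  unfolding gcomp_def by (rule ddv_commute[OF smooth_L])

lemma homogeneous_ddv_L: "homogeneous 1 (ddv a L)"
  using homogeneous_ddv[OF smooth_L, of 1] homogeneous_L by (simp add: numeral_2_eq_2)

lemma homogeneous_gcomp: "homogeneous 0 (gcomp L a b)"
  unfolding gcomp_def using homogeneous_ddv[OF Cinf_ddv[OF smooth_L], of 0] homogeneous_ddv_L by simp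

lemma signature: "z \<in> W \<Longrightarrow> lorentz_signature (gmat L z)"
  using sig by (cases z) (auto simp: W_iff)

lemma Cinf_ginv: "Cinf_on W (ginv L a b)"
proof -
  have "Cinf_on W (\<lambda>z. matrix_inv (gmat L z) $ a $ b)"
  proof (rule Cinf_on_matrix_inv[OF W])
    show "Cinf_on W (\<lambda>z. gmat L z $ i $ j)" for i j
      using Cinf_gcomp[of i j] by (simp add: gmat_def)
    show "det (gmat L z) \<noteq> 0" if "z \<in> W" for z
      by (rule lorentz_signature_transpose(2)[OF signature[OF that]])
  qed
  then show ?thesis by (simp add: ginv_def[abs_def])
qed

lemma homogeneous_ginv: "homogeneous 0 (ginv L a b)"
proof (rule homogeneousI)
  fix x v and s :: real assume "(x, v) \<in> W" "s > 0"
  then have "gmat L (x, s *\<^sub>R v) = gmat L (x, v)"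
    by (simp add: gmat_def homogeneousD[OF homogeneous_gcomp])
  then show "ginv L a b (x, s *\<^sub>R v) = s ^ 0 * ginv L a b (x, v)" by (simp add: ginv_def)
qed

lemma gcomp_ginv:
  assumes "z \<in> W"
  shows "(\<Sum>c\<in>UNIV. gcomp L a c z * ginv L c b z) = (if a = b then 1 else 0)"
proof -
  have "(gmat L z ** matrix_inv (gmat L z)) $ a $ b = mat 1 $ a $ b"
    using matrix_inv_right[OF lorentz_signature_transpose(2)[OF signature[OF assms]]] by simp
  then show ?thesis by (simp add: matrix_matrix_mult_def ginv_def mat_def gmat_def)
qed

lemma Cinf_Gamma_tilde: "Cinf_on W (Gamma_tilde L a b c)"
  unfolding Gamma_tilde_def[abs_def]
  by (intro Cinf_on_mult Cinf_on_sum Cinf_on_add Cinf_on_diff Cinf_ddx Cinf_ginv Cinf_gcomp Cinf_on_const W)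

lemma Cinf_spray: "Cinf_on W (spray L a)"
  unfolding spray_def[abs_def]
  by (intro Cinf_on_mult Cinf_on_sum Cinf_Gamma_tilde Cinf_snd_nth Cinf_on_const W)

lemma Cinf_Ncoef: "Cinf_on W (Ncoef L a b)"
  unfolding Ncoef_def by (intro Cinf_ddv Cinf_spray)

lemma Cinf_Gamma: "Cinf_on W (Gamma L a b c)"
  unfolding Gamma_def[abs_def]
  by (intro Cinf_on_mult Cinf_on_sum Cinf_on_add Cinf_on_diff Cinf_ddv Cinf_ginv Cinf_gcomp Cinf_on_const
      Cinf_Gamma_tilde Cinf_Ncoef W)

lemma homogeneous_Gamma_tilde: "homogeneous 0 (Gamma_tilde L a b c)"
  by (rule homogeneousI)
    (simp add: Gamma_tilde_def homogeneousD[OF homogeneous_ginv] homogeneousD[OF homogeneous_ddx[OF Cinf_gcomp homogeneous_gcomp]])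

lemma homogeneous_spray: "homogeneous 2 (spray L a)"
  by (rule homogeneousI)
    (simp add: spray_def homogeneousD[OF homogeneous_Gamma_tilde] sum_distrib_left power2_eq_square mult_ac)

lemma homogeneous_Ncoef: "homogeneous 1 (Ncoef L a b)"
  unfolding Ncoef_def using homogeneous_ddv[OF Cinf_spray, of 1] homogeneous_spray by (simp add: numeral_2_eq_2)

lemma gcomp_velocity:
  assumes "(x, v) \<in> W" shows "(\<Sum>b\<in>UNIV. gcomp L a b (x, v) * v $ b) = ddv a L (x, v)"
proof -
  have "(\<Sum>b\<in>UNIV. gcomp L a b (x, v) * v $ b) = (\<Sum>b\<in>UNIV. v $ b * ddv b (ddv a L) (x, v))"
    using gcomp_commute[OF assms] by (simp add: gcomp_def mult.commute)
  then show ?thesis using euler[OF Cinf_ddv[OF smooth_L] homogeneous_ddv_L assms] by simp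
qed

lemma gform_velocity_velocity:
  assumes "(x, v) \<in> W" shows "gform L (x, v) v v = 2 * L (x, v)"
proof -
  have "gform L (x, v) v v = (\<Sum>a\<in>UNIV. v $ a * (\<Sum>b\<in>UNIV. gcomp L a b (x, v) * v $ b))"
    by (simp add: gform_def sum_distrib_left mult_ac)
  then show ?thesis using euler[OF smooth_L homogeneous_L assms] by (simp add: gcomp_velocity[OF assms])
qed

text \<open>The fibre derivative of the metric is a third derivative of \<open>L\<close>, hence
  totally symmetric; moving the contracted index into the derivative leaves Euler's relation for a
  function of degree 0.\<close>

lemma cartan:
  assumes z: "(x, v) \<in> W" shows "(\<Sum>c\<in>UNIV. ddv m (gcomp L d c) (x, v) * v $ c) = 0"
proof -
  have "ddv m (gcomp L d c) (x, v) = ddv c (gcomp L m d) (x, v)" for c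
  proof -
    have "ddv m (gcomp L d c) (x, v) = ddv m (gcomp L c d) (x, v)"
      by (rule ddv_cong[OF gcomp_commute z Cinf_gcomp])
    also have "\<dots> = ddv c (gcomp L m d) (x, v)"
      unfolding gcomp_def by (rule ddv_commute[OF Cinf_ddv[OF smooth_L] z])
    finally show ?thesis .
  qed
  then show ?thesis
    using euler[OF Cinf_gcomp homogeneous_gcomp z, of m d] by (simp add: mult.commute)
qed

lemma Ncoef_velocity:
  assumes "(x, v) \<in> W" shows "(\<Sum>b\<in>UNIV. Ncoef L a b (x, v) * v $ b) = 2 * spray L a (x, v)"
  using euler[OF Cinf_spray homogeneous_spray assms, of a] by (simp add: Ncoef_def mult.commute)

text \<open>Base and fibre derivatives of N v = 2 G. In the fibre direction the left side also
  yields \<open>Ncoef L a c\<close> from the factor \<open>v\<close>, and the right side is twice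
  that, so one copy remains.\<close>

lemma
  assumes z: "(x, v) \<in> W"
  shows ddx_Ncoef_velocity: "(\<Sum>b\<in>UNIV. ddx c (Ncoef L a b) (x, v) * v $ b) = 2 * ddx c (spray L a) (x, v)"
    and ddv_Ncoef_velocity: "(\<Sum>b\<in>UNIV. ddv c (Ncoef L a b) (x, v) * v $ b) = Ncoef L a c (x, v)"
proof -
  have dN: "Ncoef L a b differentiable (at (x, v))" "spray L a differentiable (at (x, v))" for b
    using Cinf_Ncoef Cinf_spray z by (auto intro: Cinf_on_differentiable)
  have dNv: "(\<lambda>z. Ncoef L a b z * snd z $ b) differentiable (at (x, v))" for b
    by (intro differentiable_mult dN differentiable_snd_nth)
  have C: "Cinf_on W (\<lambda>z. \<Sum>b\<in>UNIV. Ncoef L a b z * snd z $ b)"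
    by (intro Cinf_on_sum Cinf_on_mult Cinf_Ncoef Cinf_snd_nth W)
  have eq: "(\<Sum>b\<in>UNIV. Ncoef L a b z * snd z $ b) = 2 * spray L a z" if "z \<in> W" for z
    using Ncoef_velocity[of "fst z" "snd z"] that by simp
  have d: "(\<Sum>b\<in>UNIV. N b * (if c = b then 1 else 0)) = N c" for N :: "'n option \<Rightarrow> real"
  proof -
    have "(\<Sum>b\<in>UNIV. N b * (if c = b then 1 else 0)) = (\<Sum>b\<in>UNIV. if b = c then N b else 0)"
      by (rule sum.cong) auto
    then show ?thesis by simp
  qed
  have 2: "ddx c (\<lambda>z. 2 * spray L a z) (x, v) = 2 * ddx c (spray L a) (x, v)"
     "ddv c (\<lambda>z. 2 * spray L a z) (x, v) = 2 * ddv c (spray L a) (x, v)"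
    using ddx_mult[of "\<lambda>z. 2" "(x, v)" "spray L a" c] ddv_mult[of "\<lambda>z. 2" "(x, v)" "spray L a" c] dN
    by (simp_all add: ddx_def ddv_def)
  show "(\<Sum>b\<in>UNIV. ddx c (Ncoef L a b) (x, v) * v $ b) = 2 * ddx c (spray L a) (x, v)"
    using ddx_cong[OF eq z C, of c] unfolding 2 ddx_sum[OF dNv] ddx_mult[OF dN(1) differentiable_snd_nth]
    by (simp add: ddx_snd_nth)
  show "(\<Sum>b\<in>UNIV. ddv c (Ncoef L a b) (x, v) * v $ b) = Ncoef L a c (x, v)"
    using ddv_cong[OF eq z C, of c] unfolding 2 ddv_sum[OF dNv] ddv_mult[OF dN(1) differentiable_snd_nth]
    using d[of "\<lambda>b. Ncoef L a b (x, v)"] by (simp add: ddv_snd_nth sum.distrib) (simp add: Ncoef_def)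
qed

text \<open>After contraction with \<open>v\<close> the Euler relations make the four terms cancel
  in pairs. This lets the extended tensor satisfy the Jacobi equation on the velocity too.\<close>

lemma curv_velocity:
  assumes z: "(x, v) \<in> W" shows "curv L (x, v) *v v = 0"
proof -
  have "(curv L (x, v) *v v) $ a = 0" for a
  proof -
    let ?z = "(x, v)"
    have sw: "(\<Sum>b\<in>UNIV. \<Sum>c\<in>UNIV. f b c) = (\<Sum>c\<in>UNIV. \<Sum>b\<in>UNIV. f b c)" for f :: "'n option \<Rightarrow> 'n option \<Rightarrow> real"
      by (rule sum.swap)
    have "(curv L ?z *v v) $ a = (\<Sum>b\<in>UNIV. 2 * (ddx b (spray L a) ?z * v $ b))
        - (\<Sum>b\<in>UNIV. \<Sum>c\<in>UNIV. v $ c * (ddx c (Ncoef L a b) ?z * v $ b))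
        + (\<Sum>b\<in>UNIV. \<Sum>c\<in>UNIV. 2 * spray L c ?z * (ddv c (Ncoef L a b) ?z * v $ b))
        - (\<Sum>b\<in>UNIV. \<Sum>c\<in>UNIV. Ncoef L a c ?z * (Ncoef L c b ?z * v $ b))"
      by (simp add: curv_def matrix_vector_mult_def left_diff_distrib right_diff_distrib sum_distrib_left
          sum_distrib_right sum_subtractf sum.distrib mult_ac)
    also have "\<dots> = (\<Sum>b\<in>UNIV. 2 * (ddx b (spray L a) ?z * v $ b))
        - (\<Sum>c\<in>UNIV. v $ c * (\<Sum>b\<in>UNIV. ddx c (Ncoef L a b) ?z * v $ b))
        + (\<Sum>c\<in>UNIV. 2 * spray L c ?z * (\<Sum>b\<in>UNIV. ddv c (Ncoef L a b) ?z * v $ b))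
        - (\<Sum>c\<in>UNIV. Ncoef L a c ?z * (\<Sum>b\<in>UNIV. Ncoef L c b ?z * v $ b))"
      by (simp only: sum_distrib_left sw[of "\<lambda>b c. v $ c * (ddx c (Ncoef L a b) ?z * v $ b)"]
          sw[of "\<lambda>b c. 2 * spray L c ?z * (ddv c (Ncoef L a b) ?z * v $ b)"]
          sw[of "\<lambda>b c. Ncoef L a c ?z * (Ncoef L c b ?z * v $ b)"])
    also have "\<dots> = 0"
      unfolding ddx_Ncoef_velocity[OF z] ddv_Ncoef_velocity[OF z] Ncoef_velocity[OF z]
      by (simp add: mult_ac)
    finally show ?thesis .
  qed
  then show ?thesis by (simp add: vec_eq_iff)
qed

text \<open>\<open>spray\<close> has degree 2 and \<open>Ncoef\<close> degree 1, so every term of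
  the curvature has degree 2.\<close>

lemma curv_scaleR:
  assumes z: "(x, v) \<in> W" and s: "s > 0" shows "curv L (x, s *\<^sub>R v) = s\<^sup>2 *\<^sub>R curv L (x, v)"
proof -
  have 1: "ddx b (spray L a) (x, s *\<^sub>R v) = s\<^sup>2 * ddx b (spray L a) (x, v)" for a b
    by (rule homogeneousD[OF homogeneous_ddx[OF Cinf_spray homogeneous_spray] z s])
  have 2: "ddx c (Ncoef L a b) (x, s *\<^sub>R v) = s * ddx c (Ncoef L a b) (x, v)" for a b c
    using homogeneousD[OF homogeneous_ddx[OF Cinf_Ncoef homogeneous_Ncoef] z s] by simp
  have 3: "ddv c (Ncoef L a b) (x, s *\<^sub>R v) = ddv c (Ncoef L a b) (x, v)" for a b c
    using homogeneousD[OF homogeneous_ddv[OF Cinf_Ncoef, of 0] z s] homogeneous_Ncoef by simp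
  have 4: "spray L a (x, s *\<^sub>R v) = s\<^sup>2 * spray L a (x, v)" "Ncoef L a b (x, s *\<^sub>R v) = s * Ncoef L a b (x, v)" for a b
    using homogeneousD[OF homogeneous_spray z s] homogeneousD[OF homogeneous_Ncoef z s] by simp_all
  show ?thesis
    by (simp add: vec_eq_iff curv_def 1 2 3 4 power2_eq_square right_diff_distrib sum_distrib_left mult_ac)
qed

section \<open>The connection along geodesics\<close>

text \<open>The horizontal derivative of Finsler geometry: the base derivative corrected by the
  nonlinear connection.\<close>

definition hderiv :: "'n option \<Rightarrow> ('n coord \<times> 'n coord \<Rightarrow> real) \<Rightarrow> 'n coord \<times> 'n coord \<Rightarrow> real" where
  "hderiv b f z = ddx b f z - (\<Sum>m\<in>UNIV. ddv m f z * Ncoef L m b z)"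

text \<open>The correction terms of \<open>Gamma\<close> are exactly those that turn base
  derivatives into horizontal ones: the Chern connection is the Levi-Civita formula for
  \<open>hderiv\<close>.\<close>

lemma Gamma_hderiv:
  "Gamma L a b c z = (\<Sum>d\<in>UNIV. ginv L a d z *
     ((hderiv b (gcomp L d c) z + hderiv c (gcomp L b d) z - hderiv d (gcomp L b c) z) / 2))"
proof -
  have m: "(\<Sum>m\<in>UNIV. ginv L a d z * (p m + q m - r m)) = ginv L a d z * ((\<Sum>m\<in>UNIV. p m) + (\<Sum>m\<in>UNIV. q m) - (\<Sum>m\<in>UNIV. r m))"
    for d and p q r :: "'n option \<Rightarrow> real"
    by (simp only: sum_distrib_left[symmetric] sum.distrib sum_subtractf)
  show ?thesis
    unfolding Gamma_def Gamma_tilde_def m right_diff_distrib[symmetric] sum_subtractf[symmetric]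
    unfolding sum_distrib_left
    by (rule sum.cong) (simp_all add: hderiv_def field_simps)
qed

lemma gcomp_Gamma:
  assumes z: "z \<in> W"
  shows "(\<Sum>a\<in>UNIV. gcomp L e a z * Gamma L a b c z) =
    (hderiv b (gcomp L e c) z + hderiv c (gcomp L b e) z - hderiv e (gcomp L b c) z) / 2"
proof -
  let ?Y = "\<lambda>d. (hderiv b (gcomp L d c) z + hderiv c (gcomp L b d) z - hderiv d (gcomp L b c) z) / 2"
  have "(\<Sum>a\<in>UNIV. gcomp L e a z * Gamma L a b c z) = (\<Sum>d\<in>UNIV. (\<Sum>a\<in>UNIV. gcomp L e a z * ginv L a d z) * ?Y d)"
    unfolding Gamma_hderiv sum_distrib_left sum_distrib_right by (subst sum.swap) (simp only: mult.assoc)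
  also have "\<dots> = (\<Sum>d\<in>UNIV. if e = d then ?Y d else 0)"
    unfolding gcomp_ginv[OF z] by (rule sum.cong) auto
  finally show ?thesis by simp
qed

text \<open>Matrix of the linear map \<open>Y \<mapsto> D Y - dY/dt\<close> along a geodesic with tangent \<open>z = (x, v)\<close>.\<close>

definition conn :: "'n coord \<times> 'n coord \<Rightarrow> real ^ 'n option ^ 'n option" where
  "conn z = (\<chi> a d. \<Sum>b\<in>UNIV. Gamma L a b d z * snd z $ b)"

definition geodesic_field :: "'n coord \<times> 'n coord \<Rightarrow> 'n coord \<times> 'n coord" where
  "geodesic_field z = (snd z, \<chi> a. - 2 * spray L a z)"

lemma Cinf_conn: "Cinf_on W (\<lambda>z. conn z $ a $ d)"
  unfolding conn_def by (simp, intro Cinf_on_sum Cinf_on_mult Cinf_Gamma Cinf_snd_nth W)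

lemma Cinf_gmat: "Cinf_on W (gmat L)"
  unfolding gmat_def[abs_def] by (intro Cinf_on_vec_lambda W Cinf_gcomp)

lemma Cinf_geodesic_field: "Cinf_on W geodesic_field"
  unfolding geodesic_field_def[abs_def]
  by (intro Cinf_on_Pair Cinf_on_vec_lambda Cinf_on_mult Cinf_on_const Cinf_spray W
      Cinf_on_bounded_linear bounded_linear_snd W)

text \<open>Since N v = 2 G, horizontal differentiation along \<open>v\<close> is differentiation
  along the geodesic flow.\<close>

lemma sum_hderiv_velocity:
  assumes z: "(x, v) \<in> W" and f: "Cinf_on W f"
  shows "(\<Sum>b\<in>UNIV. hderiv b f (x, v) * v $ b) = frechet_derivative f (at (x, v)) (geodesic_field (x, v))"
proof -
  have "(\<Sum>b\<in>UNIV. hderiv b f (x, v) * v $ b) =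
     (\<Sum>b\<in>UNIV. v $ b * ddx b f (x, v)) - (\<Sum>b\<in>UNIV. \<Sum>m\<in>UNIV. ddv m f (x, v) * (Ncoef L m b (x, v) * v $ b))"
    by (simp add: hderiv_def left_diff_distrib right_diff_distrib sum_subtractf sum_distrib_left sum_distrib_right mult_ac)
  also have "\<dots> = (\<Sum>b\<in>UNIV. v $ b * ddx b f (x, v)) - (\<Sum>m\<in>UNIV. ddv m f (x, v) * (2 * spray L m (x, v)))"
    by (subst sum.swap) (simp add: sum_distrib_left[symmetric] Ncoef_velocity[OF z])
  also have "\<dots> = frechet_derivative f (at (x, v)) (geodesic_field (x, v))"
    by (simp add: geodesic_field_def frechet_derivative_ddx_ddv[OF Cinf_on_differentiable[OF f z]] sum_negf mult_ac)
  finally show ?thesis .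
qed

text \<open>Metric compatibility along geodesics: when the lowered connection is added to its
  transpose, the last two terms of the Christoffel formula cancel and only the derivative along the
  flow survives.\<close>

lemma gmat_derivative_entry:
  assumes z: "(x, v) \<in> W"
  shows "frechet_derivative (gcomp L e d) (at (x, v)) (geodesic_field (x, v)) =
    (gmat L (x, v) ** conn (x, v)) $ e $ d + (gmat L (x, v) ** conn (x, v)) $ d $ e"
proof -
  let ?z = "(x, v)"
  have h: "hderiv b (gcomp L p q) ?z = hderiv b (gcomp L q p) ?z" for b p q
    unfolding hderiv_def
    using ddx_cong[OF gcomp_commute z Cinf_gcomp] ddv_cong[OF gcomp_commute z Cinf_gcomp] by simp
  have gc: "(gmat L ?z ** conn ?z) $ p $ q =
     (\<Sum>b\<in>UNIV. (hderiv b (gcomp L p q) ?z + hderiv q (gcomp L b p) ?z - hderiv p (gcomp L b q) ?z) / 2 * v $ b)" for p q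
  proof -
    have "(gmat L ?z ** conn ?z) $ p $ q = (\<Sum>b\<in>UNIV. (\<Sum>a\<in>UNIV. gcomp L p a ?z * Gamma L a b q ?z) * v $ b)"
      unfolding matrix_matrix_mult_def gmat_def conn_def
      by (simp add: sum_distrib_left sum_distrib_right mult.assoc, rule sum.swap)
    then show ?thesis unfolding gcomp_Gamma[OF z] .
  qed
  have "frechet_derivative (gcomp L e d) (at ?z) (geodesic_field ?z) = (\<Sum>b\<in>UNIV. hderiv b (gcomp L e d) ?z * v $ b)"
    by (rule sum_hderiv_velocity[OF z Cinf_gcomp, symmetric])
  also have "\<dots> = (gmat L ?z ** conn ?z) $ e $ d + (gmat L ?z ** conn ?z) $ d $ e"
    unfolding gc sum.distrib[symmetric]
    by (rule sum.cong) (simp_all add: h[of _ d e] field_simps)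
  finally show ?thesis .
qed

lemma gmat_derivative:
  assumes z: "z \<in> W"
  shows "(gmat L has_derivative frechet_derivative (gmat L) (at z)) (at z)"
    and "frechet_derivative (gmat L) (at z) (geodesic_field z) =
      gmat L z ** conn z + transpose (gmat L z ** conn z)"
proof -
  show d: "(gmat L has_derivative frechet_derivative (gmat L) (at z)) (at z)"
    by (rule Cinf_on_has_derivative[OF Cinf_gmat z])
  have "((\<lambda>y. gmat L y $ e $ d) has_derivative (\<lambda>h. frechet_derivative (gmat L) (at z) h $ e $ d)) (at z)" for e d
    by (intro bounded_linear.has_derivative[OF bounded_linear_vec_nth] d)
  then have "(gcomp L e d has_derivative (\<lambda>h. frechet_derivative (gmat L) (at z) h $ e $ d)) (at z)" for e d
    by (simp add: gmat_def)
  from frechet_derivative_at[OF this]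
  have "frechet_derivative (gmat L) (at z) h $ e $ d = frechet_derivative (gcomp L e d) (at z) h" for e d h
    by (rule fun_cong)
  then show "frechet_derivative (gmat L) (at z) (geodesic_field z) =
      gmat L z ** conn z + transpose (gmat L z ** conn z)"
    using gmat_derivative_entry[of "fst z" "snd z"] z by (simp add: vec_eq_iff transpose_def)
qed

text \<open>The vertical correction contains a Cartan tensor contracted with the velocity.\<close>

lemma sum_hderiv_gcomp_velocity:
  assumes z: "(x, v) \<in> W"
  shows "(\<Sum>c\<in>UNIV. hderiv b (gcomp L d c) (x, v) * v $ c) = (\<Sum>c\<in>UNIV. ddx b (gcomp L d c) (x, v) * v $ c)"
proof -
  let ?z = "(x, v)"
  have "(\<Sum>c\<in>UNIV. (\<Sum>m\<in>UNIV. ddv m (gcomp L d c) ?z * Ncoef L m b ?z) * v $ c) =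
      (\<Sum>m\<in>UNIV. Ncoef L m b ?z * (\<Sum>c\<in>UNIV. ddv m (gcomp L d c) ?z * v $ c))"
    unfolding sum_distrib_right sum_distrib_left by (subst sum.swap) (simp add: mult_ac)
  also have "\<dots> = 0" by (simp add: cartan[OF z])
  finally show ?thesis by (simp add: hderiv_def left_diff_distrib sum_subtractf)
qed

text \<open>Contracted twice with \<open>v\<close>, the Christoffel expression depends on
  \<open>H\<close> only through the contraction of its last index. There base and horizontal
  derivatives of the metric agree, so \<open>Gamma\<close> and \<open>Gamma_tilde\<close> yield the
  same spray.\<close>

lemma christoffel_contraction:
  fixes H :: "'n option \<Rightarrow> 'n option \<Rightarrow> 'n option \<Rightarrow> real" and v :: "'n coord"
  shows "(\<Sum>b\<in>UNIV. \<Sum>c\<in>UNIV. (\<Sum>d\<in>UNIV. q d * ((H b d c + H c d b - H d b c) / 2)) * v $ b * v $ c) =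
    (\<Sum>d\<in>UNIV. q d * ((2 * (\<Sum>b\<in>UNIV. v $ b * (\<Sum>c\<in>UNIV. H b d c * v $ c)) -
      (\<Sum>b\<in>UNIV. v $ b * (\<Sum>c\<in>UNIV. H d b c * v $ c))) / 2))"
    (is "?l = ?r")
proof -
  let ?T = "\<lambda>b c d. q d * ((H b d c + H c d b - H d b c) / 2) * v $ b * v $ c"
  have "?l = (\<Sum>b\<in>UNIV. \<Sum>d\<in>UNIV. \<Sum>c\<in>UNIV. ?T b c d)"
    unfolding sum_distrib_right by (rule sum.cong[OF refl], rule sum.swap)
  also have "\<dots> = (\<Sum>d\<in>UNIV. \<Sum>b\<in>UNIV. \<Sum>c\<in>UNIV. ?T b c d)" by (rule sum.swap)
  also have "\<dots> = ?r"
  proof (rule sum.cong[OF refl])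
    fix d
    have e: "(\<Sum>b\<in>UNIV. \<Sum>c\<in>UNIV. H c d b * (v $ b * v $ c)) = (\<Sum>b\<in>UNIV. \<Sum>c\<in>UNIV. H b d c * (v $ b * v $ c))"
      by (subst sum.swap) (intro sum.cong refl, simp add: mult.commute)
    have "(\<Sum>b\<in>UNIV. \<Sum>c\<in>UNIV. ?T b c d) = q d * (((\<Sum>b\<in>UNIV. \<Sum>c\<in>UNIV. H b d c * (v $ b * v $ c)) +
       (\<Sum>b\<in>UNIV. \<Sum>c\<in>UNIV. H c d b * (v $ b * v $ c)) - (\<Sum>b\<in>UNIV. \<Sum>c\<in>UNIV. H d b c * (v $ b * v $ c))) / 2)"
      by (simp add: sum_distrib_left sum_divide_distrib sum.distrib[symmetric] sum_subtractf[symmetric] field_simps)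
    then show "(\<Sum>b\<in>UNIV. \<Sum>c\<in>UNIV. ?T b c d) = q d * ((2 * (\<Sum>b\<in>UNIV. v $ b * (\<Sum>c\<in>UNIV. H b d c * v $ c)) -
      (\<Sum>b\<in>UNIV. v $ b * (\<Sum>c\<in>UNIV. H d b c * v $ c))) / 2)"
      unfolding e by (simp add: sum_distrib_left mult_ac)
  qed
  finally show ?thesis .
qed

text \<open>Turns the geodesic equation into the statement that the velocity is parallel for
  \<open>conn\<close>.\<close>

lemma conn_velocity:
  assumes z: "(x, v) \<in> W" shows "conn (x, v) *v v = - snd (geodesic_field (x, v))"
proof -
  let ?z = "(x, v)"
  have sym: "ddx c (gcomp L b d) ?z = ddx c (gcomp L d b) ?z" "hderiv c (gcomp L b d) ?z = hderiv c (gcomp L d b) ?z" for b c d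
    unfolding hderiv_def using ddx_cong[OF gcomp_commute z Cinf_gcomp] ddv_cong[OF gcomp_commute z Cinf_gcomp] by simp_all
  have "(conn ?z *v v) $ a = 2 * spray L a ?z" for a
  proof -
    have G: "Gamma L a b c ?z = (\<Sum>d\<in>UNIV. ginv L a d ?z *
        ((hderiv b (gcomp L d c) ?z + hderiv c (gcomp L d b) ?z - hderiv d (gcomp L b c) ?z) / 2))" for b c
      unfolding Gamma_hderiv by (simp add: sym(2)[where b = b and c = c])
    have G_tilde: "Gamma_tilde L a b c ?z = (\<Sum>d\<in>UNIV. ginv L a d ?z *
        ((ddx b (gcomp L d c) ?z + ddx c (gcomp L d b) ?z - ddx d (gcomp L b c) ?z) / 2))" for b c
      unfolding Gamma_tilde_def by (simp add: sym(1)[where b = b and c = c] sum_divide_distrib)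
    have "(conn ?z *v v) $ a = (\<Sum>c\<in>UNIV. \<Sum>b\<in>UNIV. Gamma L a b c ?z * v $ b * v $ c)"
      by (simp add: conn_def matrix_vector_mult_def sum_distrib_right)
    also have "\<dots> = (\<Sum>b\<in>UNIV. \<Sum>c\<in>UNIV. Gamma L a b c ?z * v $ b * v $ c)" by (rule sum.swap)
    also have "\<dots> = (\<Sum>b\<in>UNIV. \<Sum>c\<in>UNIV. (\<Sum>d\<in>UNIV. ginv L a d ?z *
        ((ddx b (gcomp L d c) ?z + ddx c (gcomp L d b) ?z - ddx d (gcomp L b c) ?z) / 2)) * v $ b * v $ c)"
      unfolding G christoffel_contraction[of _ "\<lambda>b d c. ddx b (gcomp L d c) ?z"]
        christoffel_contraction[of _ "\<lambda>b d c. hderiv b (gcomp L d c) ?z"] sum_hderiv_gcomp_velocity[OF z] ..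
    also have "\<dots> = 2 * spray L a ?z"
      unfolding G_tilde[symmetric] by (simp add: spray_def)
    finally show ?thesis .
  qed
  then show ?thesis by (simp add: vec_eq_iff geodesic_field_def)
qed

end

section \<open>Changes of charts\<close>

text \<open>Over a fixed base point a change of charts acts on the fibre by one linear map
  \<open>T\<close>. Comparing fibre directions only, no derivative of \<open>T\<close> in the base
  point enters.\<close>

lemma frechet_derivative_pullback:
  fixes f g :: "'a::euclidean_space \<times> 'b::euclidean_space \<Rightarrow> real"
  assumes f: "f differentiable (at (x, v))" and g: "g differentiable (at (y, T v))" and T: "linear T"
    and V: "open V" "v \<in> V" and eq: "\<And>v. v \<in> V \<Longrightarrow> f (x, v) = g (y, T v)"
  shows "frechet_derivative f (at (x, v)) (0, w) = frechet_derivative g (at (y, T v)) (0, T w)"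
proof -
  have 1: "((\<lambda>v. (x, v)) has_derivative (\<lambda>w. (0, w))) (at v)"
    by (auto intro!: derivative_eq_intros)
  have 2: "((\<lambda>v. (y, T v)) has_derivative (\<lambda>w. (0, T w))) (at v)"
    using linear_imp_has_derivative[OF T] by (auto intro!: derivative_eq_intros)
  have "((f \<circ> (\<lambda>v. (x, v))) has_derivative (frechet_derivative f (at (x, v)) \<circ> (\<lambda>w. (0, w)))) (at v)"
    using f by (intro diff_chain_at 1) (simp add: frechet_derivative_works)
  then have a: "((g \<circ> (\<lambda>v. (y, T v))) has_derivative (frechet_derivative f (at (x, v)) \<circ> (\<lambda>w. (0, w)))) (at v)"
    by (rule has_derivative_transform_within_open[OF _ V]) (simp add: eq)
  have "((g \<circ> (\<lambda>v. (y, T v))) has_derivative (frechet_derivative g (at (y, T v)) \<circ> (\<lambda>w. (0, T w)))) (at v)"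
    using g by (intro diff_chain_at 2) (simp add: frechet_derivative_works)
  from has_derivative_unique[OF a this] show ?thesis by (metis comp_apply)
qed

text \<open>As a second fibre derivative in arbitrary directions, the metric transforms by two uses
  of the pullback rule.\<close>

lemma (in finsler_chart) gform_frechet_derivative:
  assumes z: "(x, v) \<in> W"
  shows "gform L (x, v) u w = frechet_derivative (\<lambda>z. frechet_derivative L (at z) (0, w)) (at (x, v)) (0, u)"
proof -
  have e: "frechet_derivative L (at z) (0, w) = (\<Sum>b\<in>UNIV. w $ b * ddv b L z)" if "z \<in> W" for z
    using frechet_derivative_ddx_ddv[OF Cinf_on_differentiable[OF smooth_L that], of 0 w] by simp
  have C: "Cinf_on W (\<lambda>z. frechet_derivative L (at z) (0, w))"
    by (rule Cinf_on_frechet_derivative[OF smooth_L])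
  have d: "(\<lambda>z. w $ b * ddv b L z) differentiable (at (x, v))" "ddv b L differentiable (at (x, v))" for b
    by (intro differentiable_mult differentiable_const Cinf_on_differentiable[OF Cinf_ddv[OF smooth_L] z])
       (rule Cinf_on_differentiable[OF Cinf_ddv[OF smooth_L] z])
  have c: "ddv a (\<lambda>z. w $ b) z = 0" for a b and z :: "'n coord \<times> 'n coord" by (simp add: ddv_def)
  have "frechet_derivative (\<lambda>z. frechet_derivative L (at z) (0, w)) (at (x, v)) (0, u) =
      (\<Sum>a\<in>UNIV. u $ a * ddv a (\<lambda>z. frechet_derivative L (at z) (0, w)) (x, v))"
    using frechet_derivative_ddx_ddv[OF Cinf_on_differentiable[OF C z], of 0 u] by simp
  also have "\<dots> = (\<Sum>a\<in>UNIV. u $ a * (\<Sum>b\<in>UNIV. w $ b * ddv a (ddv b L) (x, v)))"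
  proof (rule sum.cong)
    fix a :: "'n option"
    have "ddv a (\<lambda>z. frechet_derivative L (at z) (0, w)) (x, v) = ddv a (\<lambda>z. \<Sum>b\<in>UNIV. w $ b * ddv b L z) (x, v)"
      by (rule ddv_cong[OF e z C])
    then show "u $ a * ddv a (\<lambda>z. frechet_derivative L (at z) (0, w)) (x, v) =
        u $ a * (\<Sum>b\<in>UNIV. w $ b * ddv a (ddv b L) (x, v))"
      unfolding ddv_sum[OF d(1)] by (simp add: ddv_mult d(2) c)
  qed simp
  finally show ?thesis by (simp add: gform_def gcomp_def sum_distrib_left mult_ac)
qed

locale finsler_atlas =
  fixes A :: "('a::{t2_space,second_countable_topology}, 'n::finite) chart set"
    and L :: "'a \<Rightarrow> 'n coord \<Rightarrow> real"
  assumes atlas: "smooth_atlas A" and finsler: "lorentz_finsler A L"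
begin

lemma
  assumes "c \<in> A"
  shows open_chart_dom: "open (chart_dom c)" and open_chart_img: "open (chart_img c)"
    and chart_homeomorphism: "homeomorphism (chart_dom c) (chart_img c) (chart_map c) (chart_inv c)"
  using atlas assms unfolding smooth_atlas_def by auto

lemma chart_inv_map: "c \<in> A \<Longrightarrow> p \<in> chart_dom c \<Longrightarrow> chart_inv c (chart_map c p) = p"
  using chart_homeomorphism unfolding homeomorphism_def by blast

lemma chart_map_inv: "c \<in> A \<Longrightarrow> x \<in> chart_img c \<Longrightarrow> chart_map c (chart_inv c x) = x"
  using chart_homeomorphism unfolding homeomorphism_def by blast

lemma chart_map_img: "p \<in> chart_dom c \<Longrightarrow> chart_map c p \<in> chart_img c"
  by (simp add: chart_img_def)

lemma chart_inv_dom: "c \<in> A \<Longrightarrow> x \<in> chart_img c \<Longrightarrow> chart_inv c x \<in> chart_dom c"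
  using chart_homeomorphism unfolding homeomorphism_def by blast

lemma ref_chart: "ref_chart A p \<in> A" "p \<in> chart_dom (ref_chart A p)"
proof -
  have "p \<in> (\<Union>c\<in>A. chart_dom c)" using atlas unfolding smooth_atlas_def by simp
  then have "\<exists>c. c \<in> A \<and> p \<in> chart_dom c" by blast
  from someI_ex[OF this] show "ref_chart A p \<in> A" "p \<in> chart_dom (ref_chart A p)"
    by (simp_all add: ref_chart_def)
qed

lemma open_chart_overlap:
  assumes "c \<in> A" "open S" shows "open (chart_map c ` (chart_dom c \<inter> S))"
proof -
  have "chart_map c ` (chart_dom c \<inter> S) = chart_img c \<inter> chart_inv c -` S"
    using chart_inv_map[OF assms(1)] chart_map_inv[OF assms(1)] chart_inv_dom[OF assms(1)]
    by (force simp: chart_img_def)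
  also have "open \<dots>"
    using chart_homeomorphism[OF assms(1)]
    by (intro continuous_open_preimage open_chart_img assms) (auto simp: homeomorphism_def)
  finally show ?thesis .
qed

lemma Cinf_transition:
  assumes "c \<in> A" "d \<in> A"
  shows "Cinf_on (chart_map c ` (chart_dom c \<inter> chart_dom d)) (chart_map d \<circ> chart_inv c)"
  using atlas assms smooth_on_open_iff[OF open_chart_overlap[OF assms(1) open_chart_dom[OF assms(2)]]]
  unfolding smooth_atlas_def by blast

lemma transition_has_derivative:
  assumes "c \<in> A" "d \<in> A" "p \<in> chart_dom c" "p \<in> chart_dom d"
  shows "((chart_map d \<circ> chart_inv c) has_derivative transition_deriv c d p) (at (chart_map c p))"
  unfolding transition_deriv_def using assms by (intro Cinf_on_has_derivative[OF Cinf_transition]) auto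

lemma transition_deriv_linear:
  assumes "c \<in> A" "d \<in> A" "p \<in> chart_dom c" "p \<in> chart_dom d"
  shows "linear (transition_deriv c d p)"
  using transition_has_derivative[OF assms] by (rule has_derivative_linear)

lemma transition_deriv_cocycle:
  assumes "c \<in> A" "d \<in> A" "e \<in> A" "p \<in> chart_dom c" "p \<in> chart_dom d" "p \<in> chart_dom e"
  shows "transition_deriv d e p (transition_deriv c d p v) = transition_deriv c e p v"
proof -
  have "((chart_map e \<circ> chart_inv d) has_derivative transition_deriv d e p) (at ((chart_map d \<circ> chart_inv c) (chart_map c p)))"
    using transition_has_derivative[of d e p] assms by (simp add: chart_inv_map)
  with transition_has_derivative[of c d p] assms
  have "(((chart_map e \<circ> chart_inv d) \<circ> (chart_map d \<circ> chart_inv c)) has_derivative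
      (transition_deriv d e p \<circ> transition_deriv c d p)) (at (chart_map c p))"
    by (intro diff_chain_at) auto
  then have "((chart_map e \<circ> chart_inv c) has_derivative
      (transition_deriv d e p \<circ> transition_deriv c d p)) (at (chart_map c p))"
    by (rule has_derivative_transform_within_open[OF _ open_chart_overlap[of c "chart_dom d"]])
      (use assms in \<open>auto simp: open_chart_dom chart_inv_map\<close>)
  from has_derivative_unique[OF this transition_has_derivative[of c e p]] assms
  show ?thesis by (metis comp_apply)
qed

lemma transition_deriv_same: "c \<in> A \<Longrightarrow> p \<in> chart_dom c \<Longrightarrow> transition_deriv c c p v = v"
proof -
  assume c: "c \<in> A" "p \<in> chart_dom c"
  have "((chart_map c \<circ> chart_inv c) has_derivative id) (at (chart_map c p))"
    by (rule has_derivative_transform_within_open[OF has_derivative_id open_chart_img[OF c(1)] chart_map_img[OF c(2)]])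
      (simp add: chart_map_inv c)
  from has_derivative_unique[OF this transition_has_derivative[OF c(1) c(1) c(2) c(2)]]
  show ?thesis by (metis id_apply)
qed

lemma
  assumes "c \<in> A" "p \<in> chart_dom c"
  shows vec_to_of_chart: "vec_to_chart A c p (vec_of_chart A c p v) = v"
    and vec_of_to_chart: "vec_of_chart A c p (vec_to_chart A c p v) = v"
    and linear_vec_to_chart: "linear (vec_to_chart A c p)"
    and linear_vec_of_chart: "linear (vec_of_chart A c p)"
  using assms ref_chart[of p]
  by (simp_all add: vec_to_chart_def vec_of_chart_def transition_deriv_cocycle transition_deriv_same)
    (simp_all add: vec_to_chart_def[abs_def] vec_of_chart_def[abs_def] transition_deriv_linear)

lemma vec_of_chart_eq_0_iff:
  assumes "c \<in> A" "p \<in> chart_dom c" shows "vec_of_chart A c p v = 0 \<longleftrightarrow> v = 0"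
  using vec_to_of_chart[OF assms] linear_0[OF linear_vec_to_chart[OF assms]] linear_0[OF linear_vec_of_chart[OF assms]]
  by metis

lemma vec_of_chart_transition:
  assumes "c \<in> A" "d \<in> A" "p \<in> chart_dom c" "p \<in> chart_dom d"
  shows "vec_of_chart A d p (transition_deriv c d p v) = vec_of_chart A c p v"
  using assms ref_chart[of p] by (simp add: vec_of_chart_def transition_deriv_cocycle)

lemma in_chart_map: "c \<in> A \<Longrightarrow> p \<in> chart_dom c \<Longrightarrow> in_chart A c f (chart_map c p, v) = f p (vec_of_chart A c p v)"
  by (simp add: in_chart_def chart_inv_map)

lemma finsler_chart_in_chart: "c \<in> A \<Longrightarrow> finsler_chart (in_chart A c L) (chart_img c)"
proof
  assume c: "c \<in> A"
  show "open (chart_img c)" using c by (rule open_chart_img)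
  then have o: "open (chart_img c \<times> (UNIV - {0 :: 'n coord}))" by (intro open_Times) auto
  have "smooth_on (chart_img c \<times> (UNIV - {0})) (in_chart A c L)"
    using finsler c unfolding lorentz_finsler_def by blast
  then show "Cinf_on (chart_img c \<times> - {0}) (in_chart A c L)"
    unfolding smooth_on_open_iff[OF o] by (simp add: Compl_eq_Diff_UNIV)
  show "in_chart A c L (x, s *\<^sub>R v) = s\<^sup>2 * in_chart A c L (x, v)" if x: "x \<in> chart_img c" "s > 0" for x v s
  proof -
    have "vec_of_chart A c (chart_inv c x) (s *\<^sub>R v) = s *\<^sub>R vec_of_chart A c (chart_inv c x) v"
      using linear_vec_of_chart[OF c chart_inv_dom[OF c x(1)]] by (rule linear_scale)
    moreover have "L p (s *\<^sub>R w) = s\<^sup>2 * L p w" for p w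
      using finsler x(2) unfolding lorentz_finsler_def by blast
    ultimately show ?thesis by (simp add: in_chart_def)
  qed
  show "lorentz_signature (gmat (in_chart A c L) (x, v))" if "x \<in> chart_img c" "v \<noteq> 0" for x v
    using finsler c that unfolding lorentz_finsler_def by blast
qed

lemma gform_transition:
  assumes c: "c \<in> A" "d \<in> A" "p \<in> chart_dom c" "p \<in> chart_dom d" and v: "v \<noteq> 0"
  defines "T \<equiv> transition_deriv c d p"
  shows "gform (in_chart A c L) (chart_map c p, v) u w =
    gform (in_chart A d L) (chart_map d p, T v) (T u) (T w)"
proof -
  interpret C: finsler_chart "in_chart A c L" "chart_img c" by (rule finsler_chart_in_chart[OF c(1)])
  interpret D: finsler_chart "in_chart A d L" "chart_img d" by (rule finsler_chart_in_chart[OF c(2)])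
  let ?x = "chart_map c p" and ?y = "chart_map d p"
  let ?f = "in_chart A c L" and ?g = "in_chart A d L"
  have T: "linear T" unfolding T_def by (rule transition_deriv_linear[OF c])
  have T0: "T v \<noteq> 0" if "v \<noteq> 0" for v
  proof -
    have "vec_of_chart A d p (T v) \<noteq> 0"
      using that c by (simp add: T_def vec_of_chart_transition vec_of_chart_eq_0_iff)
    then show ?thesis using vec_of_chart_eq_0_iff[OF c(2,4)] by blast
  qed
  have W: "(?x, v) \<in> C.W" "(?y, T v) \<in> D.W" if "v \<noteq> 0" for v
    using that T0 c by (simp_all add: C.W_iff D.W_iff chart_map_img)
  have eq: "?f (?x, v) = ?g (?y, T v)" for v
    using c by (simp add: in_chart_map T_def vec_of_chart_transition)
  have 1: "frechet_derivative ?f (at (?x, v)) (0, w) = frechet_derivative ?g (at (?y, T v)) (0, T w)"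
    if "v \<in> - {0}" for v w
    by (rule frechet_derivative_pullback[where T = T and V = "- {0}"])
      (use that W eq T in \<open>auto intro!: Cinf_on_differentiable[OF C.smooth_L] Cinf_on_differentiable[OF D.smooth_L]\<close>)
  \<comment> \<open>The first fibre derivatives already correspond at all nonzero vectors, so the
    pullback rule applies to them once more.\<close>
  have "frechet_derivative (\<lambda>z. frechet_derivative ?f (at z) (0, w)) (at (?x, v)) (0, u) =
     frechet_derivative (\<lambda>z. frechet_derivative ?g (at z) (0, T w)) (at (?y, T v)) (0, T u)"
    by (rule frechet_derivative_pullback[where T = T and V = "- {0}"])
      (use v W 1 T in \<open>auto intro!: Cinf_on_differentiable[OF Cinf_on_frechet_derivative[OF C.smooth_L]]
         Cinf_on_differentiable[OF Cinf_on_frechet_derivative[OF D.smooth_L]]\<close>)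
  then show ?thesis using W[OF v] by (simp add: C.gform_frechet_derivative D.gform_frechet_derivative)
qed

section \<open>Curves and geodesics in charts\<close>

text \<open>\<open>U\<close> is open in the real line, but only \<open>I \<inter> U\<close> has to
  be mapped into the chart, as \<open>I\<close> may contain end points.\<close>

definition param_nbhd :: "real set \<Rightarrow> (real \<Rightarrow> 'a) \<Rightarrow> ('a, 'n) chart \<Rightarrow> real set \<Rightarrow> bool" where
  "param_nbhd I \<kappa> c U \<longleftrightarrow> open U \<and> (\<forall>t\<in>I \<inter> U. \<kappa> t \<in> chart_dom c)"

lemma param_nbhd_exists:
  assumes "smooth_curve A I \<kappa>" "c \<in> A" "t \<in> I" "\<kappa> t \<in> chart_dom c"
  obtains U where "t \<in> U" "param_nbhd I \<kappa> c U"
proof -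
  have "continuous_on I \<kappa>" using assms(1) by (simp add: smooth_curve_def)
  from this[unfolded continuous_on_open_invariant, rule_format, OF open_chart_dom[OF assms(2)]]
  obtain U where "open U" "U \<inter> I = \<kappa> -` chart_dom c \<inter> I" by blast
  then show thesis using that[of U] assms(3,4) by (auto simp: param_nbhd_def)
qed

lemma
  assumes \<kappa>: "nondeg_interval I" "smooth_curve A I \<kappa>" and c: "c \<in> A" and U: "param_nbhd I \<kappa> c U"
  shows smooth_on_chart_lift: "smooth_on (I \<inter> U) (chart_lift c I \<kappa>)"
    and chart_curve_has_vector_derivative:
      "t \<in> I \<inter> U \<Longrightarrow> ((\<lambda>t. chart_map c (\<kappa> t)) has_vector_derivative chart_vel c I \<kappa> t) (at t within I)"
    and chart_vel_has_vector_derivative: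
      "t \<in> I \<inter> U \<Longrightarrow> (chart_vel c I \<kappa> has_vector_derivative vector_derivative (chart_vel c I \<kappa>) (at t within I)) (at t within I)"
proof -
  have "smooth_on {t \<in> I. \<kappa> t \<in> chart_dom c} (chart_map c \<circ> \<kappa>)"
    using \<kappa>(2) c by (simp add: smooth_curve_def)
  then have s: "smooth_on (I \<inter> U) (chart_map c \<circ> \<kappa>)"
    by (rule smooth_on_subset) (use U in \<open>auto simp: param_nbhd_def\<close>)
  then have s1: "smooth_on (I \<inter> U) (\<lambda>t. chart_map c (\<kappa> t))" by (simp add: o_def)
  have oU: "open U" using U by (simp add: param_nbhd_def)
  have s2: "smooth_on (I \<inter> U) (chart_vel c I \<kappa>)"
    using smooth_on_vector_derivative[OF \<kappa>(1) oU s] unfolding chart_vel_def[abs_def] .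
  show "smooth_on (I \<inter> U) (chart_lift c I \<kappa>)"
    unfolding chart_lift_def[abs_def] by (rule smooth_on_Pair[OF s1 s2])
  show "((\<lambda>t. chart_map c (\<kappa> t)) has_vector_derivative chart_vel c I \<kappa> t) (at t within I)" if "t \<in> I \<inter> U"
    using smooth_on_has_vector_derivative[OF \<kappa>(1) oU s that] unfolding chart_vel_def o_def .
  show "(chart_vel c I \<kappa> has_vector_derivative vector_derivative (chart_vel c I \<kappa>) (at t within I)) (at t within I)"
    if "t \<in> I \<inter> U"
    by (rule smooth_on_has_vector_derivative[OF \<kappa>(1) oU s2 that])
qed

lemma chart_vel_transition:
  assumes \<kappa>: "nondeg_interval I" "smooth_curve A I \<kappa>" and c: "c \<in> A" "d \<in> A"
    and t: "t \<in> I" "\<kappa> t \<in> chart_dom c" "\<kappa> t \<in> chart_dom d"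
  shows "chart_vel d I \<kappa> t = transition_deriv c d (\<kappa> t) (chart_vel c I \<kappa> t)"
proof -
  obtain U where U: "t \<in> U" "param_nbhd I \<kappa> c U" using param_nbhd_exists[OF \<kappa>(2) c(1) t(1,2)] .
  obtain V where V: "t \<in> V" "param_nbhd I \<kappa> d V" using param_nbhd_exists[OF \<kappa>(2) c(2) t(1,3)] .
  have "((\<lambda>t. chart_map c (\<kappa> t)) has_vector_derivative chart_vel c I \<kappa> t) (at t within I)"
    by (rule chart_curve_has_vector_derivative[OF \<kappa> c(1) U(2) IntI[OF t(1) U(1)]])
  from vector_derivative_diff_chain_within[OF this has_derivative_at_withinI[OF transition_has_derivative[OF c t(2,3)]]]
  have "(((chart_map d \<circ> chart_inv c) \<circ> (\<lambda>t. chart_map c (\<kappa> t))) has_vector_derivative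
      transition_deriv c d (\<kappa> t) (chart_vel c I \<kappa> t)) (at t within I)" .
  then have 1: "((\<lambda>t. chart_map d (\<kappa> t)) has_vector_derivative
      transition_deriv c d (\<kappa> t) (chart_vel c I \<kappa> t)) (at t within I)"
    by (rule has_vector_derivative_cong_open[of _ _ _ _ "U \<inter> V"])
      (use U V t c in \<open>auto simp: param_nbhd_def chart_inv_map\<close>)
  have 2: "((\<lambda>t. chart_map d (\<kappa> t)) has_vector_derivative chart_vel d I \<kappa> t) (at t within I)"
    by (rule chart_curve_has_vector_derivative[OF \<kappa> c(2) V(2) IntI[OF t(1) V(1)]])
  show ?thesis
    using vector_derivative_unique_within[OF nondeg_interval_at_within_neq_bot[OF \<kappa>(1) t(1)] 2 1] .
qed

lemma
  assumes \<kappa>: "nondeg_interval I" "smooth_curve A I \<kappa>" and c: "c \<in> A" and t: "t \<in> I" "\<kappa> t \<in> chart_dom c"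
  shows vec_of_chart_vel: "vec_of_chart A c (\<kappa> t) (chart_vel c I \<kappa> t) = velocity A I \<kappa> t"
    and in_chart_lift: "in_chart A c f (chart_lift c I \<kappa> t) = f (\<kappa> t) (velocity A I \<kappa> t)"
proof -
  show 1: "vec_of_chart A c (\<kappa> t) (chart_vel c I \<kappa> t) = velocity A I \<kappa> t"
    unfolding vec_of_chart_def velocity_def
    by (rule chart_vel_transition[OF \<kappa> c ref_chart(1) t ref_chart(2), symmetric])
  show "in_chart A c f (chart_lift c I \<kappa> t) = f (\<kappa> t) (velocity A I \<kappa> t)"
    using c t by (simp add: chart_lift_def in_chart_map 1)
qed

text \<open>Homogeneity with factor 2 at the zero vector. Timelike vectors are therefore nonzero,
  and timelike lifts avoid the zero section.\<close>

lemma L_zero: "L p 0 = 0"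
proof -
  have "L p (2 *\<^sub>R 0) = 2\<^sup>2 * L p 0"
    using finsler unfolding lorentz_finsler_def by (metis zero_less_numeral)
  then show ?thesis by simp
qed

lemma chart_vel_nonzero:
  assumes "nondeg_interval I" "smooth_curve A I \<kappa>" "c \<in> A" "t \<in> I" "\<kappa> t \<in> chart_dom c"
    and "L (\<kappa> t) (velocity A I \<kappa> t) < 0"
  shows "chart_vel c I \<kappa> t \<noteq> 0"
  using vec_of_chart_vel[OF assms(1-5)] vec_of_chart_eq_0_iff[OF assms(3,5)] L_zero assms(6)
  by (metis order_less_irrefl)

lemma
  assumes geo: "causal_geodesic A L X I \<kappa>" and c: "c \<in> A" and U: "param_nbhd I \<kappa> c U" and t: "t \<in> I \<inter> U"
  defines "F \<equiv> finsler_chart.geodesic_field (in_chart A c L) (chart_lift c I \<kappa> t)"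
  shows geodesic_vel_derivative: "vector_derivative (chart_vel c I \<kappa>) (at t within I) = snd F"
    and geodesic_lift_derivative: "(chart_lift c I \<kappa> has_vector_derivative F) (at t within I)"
proof -
  interpret C: finsler_chart "in_chart A c L" "chart_img c" by (rule finsler_chart_in_chart[OF c])
  have \<kappa>: "nondeg_interval I" "smooth_curve A I \<kappa>" using geo by (auto simp: causal_geodesic_def)
  have "\<kappa> t \<in> chart_dom c" using U t by (auto simp: param_nbhd_def)
  then have "vector_derivative (chart_vel c I \<kappa>) (at t within I) $ a + 2 * spray (in_chart A c L) a (chart_lift c I \<kappa> t) = 0" for a
    using geo c t unfolding causal_geodesic_def by blast
  then show 1: "vector_derivative (chart_vel c I \<kappa>) (at t within I) = snd F"
    by (simp add: F_def vec_eq_iff C.geodesic_field_def eq_neg_iff_add_eq_0)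
  have "((\<lambda>t. (chart_map c (\<kappa> t), chart_vel c I \<kappa> t)) has_vector_derivative (chart_vel c I \<kappa> t, snd F)) (at t within I)"
    using chart_vel_has_vector_derivative[OF \<kappa> c U t]
    by (intro has_vector_derivative_Pair chart_curve_has_vector_derivative[OF \<kappa> c U t]) (simp add: 1)
  moreover have "(chart_vel c I \<kappa> t, snd F) = F"
    by (simp add: F_def C.geodesic_field_def chart_lift_def)
  ultimately show "(chart_lift c I \<kappa> has_vector_derivative F) (at t within I)"
    unfolding chart_lift_def[abs_def] by simp
qed

end

section \<open>The normal bundle along a geodesic\<close>

lemma smooth_on_linear_comp:
  "smooth_on S f \<Longrightarrow> bounded_linear h \<Longrightarrow> smooth_on S (\<lambda>x. h (f x))"
  by (rule smooth_on_compose[where V = UNIV]) (auto intro: Cinf_on_bounded_linear)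

lemma smooth_on_const: "smooth_on S (\<lambda>x. c)"
  unfolding smooth_on_def2 by (intro ballI exI[of _ UNIV] exI[of _ "\<lambda>x. c"]) auto

lemma smooth_on_sum:
  "(\<And>i. i \<in> T \<Longrightarrow> smooth_on S (f i)) \<Longrightarrow> smooth_on S (\<lambda>x. \<Sum>i\<in>T. f i x)"
  by (induction T rule: infinite_finite_induct) (auto intro: smooth_on_const smooth_on_add)

lemma Cinf_on_inner:
  fixes f g :: "'a::euclidean_space \<Rightarrow> 'b::euclidean_space"
  assumes "open U" "Cinf_on U f" "Cinf_on U g"
  shows "Cinf_on U (\<lambda>x. f x \<bullet> g x)"
proof -
  have "Cinf_on U (\<lambda>x. \<Sum>b\<in>Basis. (f x \<bullet> b) * (g x \<bullet> b))"
    by (intro Cinf_on_sum Cinf_on_mult Cinf_on_linear_comp[OF _ bounded_linear_inner_left] assms)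
  then show ?thesis by (simp add: euclidean_inner[symmetric])
qed

lemma Cinf_on_matrix_vector:
  fixes M :: "'a::euclidean_space \<Rightarrow> real ^ 'n ^ 'm"
  assumes "open U" "Cinf_on U M" "Cinf_on U f"
  shows "Cinf_on U (\<lambda>x. M x *v f x)"
  unfolding matrix_vector_mult_def
  by (intro Cinf_on_vec_lambda Cinf_on_sum Cinf_on_mult Cinf_on_vec_nth assms)

locale unit_geodesic = finsler_atlas A L
  for A :: "('a::{t2_space,second_countable_topology}, 'n::finite) chart set"
    and L :: "'a \<Rightarrow> 'n coord \<Rightarrow> real" +
  fixes X :: "'a \<Rightarrow> 'n coord" and I :: "real set" and \<eta> :: "real \<Rightarrow> 'a"
  assumes geodesic: "unit_timelike_geodesic A L X I \<eta>"
begin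

lemma causal: "causal_geodesic A L X I \<eta>"
  using geodesic by (simp add: unit_timelike_geodesic_def)

lemma nondeg: "nondeg_interval I" and curve: "smooth_curve A I \<eta>"
  using causal by (auto simp: causal_geodesic_def)

lemma at_neq_bot: "t \<in> I \<Longrightarrow> at t within I \<noteq> bot"
  by (rule nondeg_interval_at_within_neq_bot[OF nondeg])

lemma L_velocity: "t \<in> I \<Longrightarrow> L (\<eta> t) (velocity A I \<eta> t) = - 1 / 2"
  using geodesic by (auto simp: unit_timelike_geodesic_def Fnorm_def)

end

locale unit_geodesic_chart = unit_geodesic A L X I \<eta>
  for A :: "('a::{t2_space,second_countable_topology}, 'n::finite) chart set"
    and L :: "'a \<Rightarrow> 'n coord \<Rightarrow> real" and X :: "'a \<Rightarrow> 'n coord" and I :: "real set" and \<eta> :: "real \<Rightarrow> 'a" +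
  fixes c :: "('a, 'n) chart" and U :: "real set"
  assumes c: "c \<in> A" and nbhd: "param_nbhd I \<eta> c U"
begin

sublocale finsler_chart "in_chart A c L" "chart_img c"
  by (rule finsler_chart_in_chart[OF c])

abbreviation "z \<equiv> chart_lift c I \<eta>"
abbreviation "v \<equiv> chart_vel c I \<eta>"
abbreviation "\<omega> t \<equiv> conn (z t)"
abbreviation "g t \<equiv> gmat (in_chart A c L) (z t)"
abbreviation "N \<equiv> chart_normal A L I \<eta> c"

lemma open_U: "open U" and in_dom: "t \<in> I \<inter> U \<Longrightarrow> \<eta> t \<in> chart_dom c"
  using nbhd by (auto simp: param_nbhd_def)

lemma snd_z: "snd (z t) = v t" by (simp add: chart_lift_def)

lemma z_Pair: "z t = (fst (z t), v t)" by (simp add: chart_lift_def)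

lemma smooth_z: "smooth_on (I \<inter> U) z" by (rule smooth_on_chart_lift[OF nondeg curve c nbhd])

lemma in_chart_L_z: "t \<in> I \<inter> U \<Longrightarrow> in_chart A c L (z t) = - 1 / 2"
  using in_chart_lift[OF nondeg curve c _ in_dom] L_velocity by simp

lemma z_W: assumes "t \<in> I \<inter> U" shows "z t \<in> W"
proof -
  have "v t \<noteq> 0"
    using chart_vel_nonzero[OF nondeg curve c _ in_dom[OF assms]] L_velocity assms by simp
  then show ?thesis
    using in_dom[OF assms] by (simp add: chart_lift_def W_iff chart_map_img)
qed

lemma g_sym: "t \<in> I \<inter> U \<Longrightarrow> transpose (g t) = g t"
  and g_det: "t \<in> I \<inter> U \<Longrightarrow> det (g t) \<noteq> 0"
  using lorentz_signature_transpose[OF signature[OF z_W]] by auto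

lemma g_commute: "t \<in> I \<inter> U \<Longrightarrow> x \<bullet> (g t *v y) = (g t *v x) \<bullet> y"
  using inner_matrix_vector[of x "g t" y] by (simp add: g_sym)

lemma g_unit: assumes "t \<in> I \<inter> U" shows "v t \<bullet> (g t *v v t) = - 1" "(g t *v v t) \<bullet> v t = - 1"
  using gform_velocity_velocity[of "fst (z t)" "v t"] z_W[OF assms] in_chart_L_z[OF assms]
  unfolding gform_inner z_Pair[symmetric] by (auto simp: inner_commute)

lemma v_derivative: assumes "t \<in> I \<inter> U"
  shows "(v has_vector_derivative - (\<omega> t *v v t)) (at t within I)"
proof -
  have "\<omega> t *v v t = - snd (geodesic_field (z t))"
    using conn_velocity[of "fst (z t)" "v t"] z_W[OF assms] unfolding z_Pair[symmetric] by simp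
  then have "vector_derivative v (at t within I) = - (\<omega> t *v v t)"
    using geodesic_vel_derivative[OF causal c nbhd assms] by simp
  then show ?thesis using chart_vel_has_vector_derivative[OF nondeg curve c nbhd assms] by metis
qed

lemma z_derivative: assumes "t \<in> I \<inter> U"
  shows "(z has_vector_derivative geodesic_field (z t)) (at t within I)"
  by (rule geodesic_lift_derivative[OF causal c nbhd assms])

lemma chain_z:
  assumes "t \<in> I \<inter> U" "Cinf_on W f"
  shows "((\<lambda>t. f (z t)) has_vector_derivative frechet_derivative f (at (z t)) (geodesic_field (z t))) (at t within I)"
  using vector_derivative_diff_chain_within[OF z_derivative[OF assms(1)]
      has_derivative_at_withinI[OF Cinf_on_has_derivative[OF assms(2) z_W[OF assms(1)]]]]
  by (simp add: o_def)

lemma smooth_comp_z: "Cinf_on W f \<Longrightarrow> smooth_on (I \<inter> U) (\<lambda>t. f (z t))"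
  by (rule smooth_on_compose[OF smooth_z W z_W])

lemma g_derivative: assumes "t \<in> I \<inter> U"
  shows "(g has_vector_derivative g t ** \<omega> t + transpose (g t ** \<omega> t)) (at t within I)"
  using chain_z[OF assms Cinf_gmat] gmat_derivative(2)[OF z_W[OF assms]] by simp

lemma omega_derivative: assumes "t \<in> I \<inter> U"
  obtains w' where "(\<omega> has_vector_derivative w') (at t within I)"
proof -
  have "Cinf_on W (\<lambda>z. \<chi> a d. conn z $ a $ d)"
    by (intro Cinf_on_vec_lambda Cinf_conn W)
  then have "Cinf_on W conn" by simp
  then show thesis using chain_z[OF assms] that by blast
qed

lemma N_iff: "u \<in> N t \<longleftrightarrow> (g t *v v t) \<bullet> u = 0" if "t \<in> I \<inter> U"
  using g_commute[OF that] by (simp add: chart_normal_def gform_inner)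

lemma subspace_N: "t \<in> I \<inter> U \<Longrightarrow> subspace (N t)"
  by (auto simp: subspace_def N_iff inner_right_distrib)

lemma v_notin_N: "t \<in> I \<inter> U \<Longrightarrow> v t \<notin> N t"
  using g_unit(2) by (simp add: N_iff)

lemma cov_deriv_eq:
  "cov_deriv A L I \<eta> c Y t = vector_derivative Y (at t within I) + \<omega> t *v Y t"
  by (simp add: cov_deriv_def conn_def matrix_vector_mult_def vec_eq_iff sum_distrib_right snd_z, subst sum.swap, simp)

text \<open>Differentiate g(v, Y) = 0: the connection is metric along the geodesic and the velocity
  is parallel, so g(v, DY) = 0 is all that remains.\<close>

lemma cov_deriv_normal:
  assumes t: "t \<in> I \<inter> U" and Y: "(Y has_vector_derivative Y') (at t within I)"
    and V: "open V" "t \<in> V" and N: "\<And>s. s \<in> I \<Longrightarrow> s \<in> V \<Longrightarrow> Y s \<in> N s"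
  shows "Y' + \<omega> t *v Y t \<in> N t"
proof -
  let ?v' = "- (\<omega> t *v v t)" and ?g' = "g t ** \<omega> t + transpose (g t ** \<omega> t)"
  have d: "((\<lambda>s. v s \<bullet> (g s *v Y s)) has_vector_derivative
      v t \<bullet> (g t *v Y' + ?g' *v Y t) + ?v' \<bullet> (g t *v Y t)) (at t within I)"
    by (intro bounded_bilinear.has_vector_derivative[OF bounded_bilinear_inner]
        matrix_vector.has_vector_derivative v_derivative g_derivative Y t)
  have "v s \<bullet> (g s *v Y s) = 0" if "s \<in> I" "s \<in> U \<inter> V" for s
    using that N[of s] N_iff[of s "Y s"] g_commute[of s "v s" "Y s"] by simp
  then have "((\<lambda>s. 0) has_vector_derivative
      v t \<bullet> (g t *v Y' + ?g' *v Y t) + ?v' \<bullet> (g t *v Y t)) (at t within I)"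
    by (intro has_vector_derivative_cong_open[OF d, of "U \<inter> V"]) (use t V open_U in auto)
  then have "v t \<bullet> (g t *v Y' + ?g' *v Y t) + ?v' \<bullet> (g t *v Y t) = 0"
    using vector_derivative_unique_within[OF at_neq_bot _ has_vector_derivative_const] t by blast
  moreover have "v t \<bullet> (transpose (g t ** \<omega> t) *v Y t) = (\<omega> t *v v t) \<bullet> (g t *v Y t)"
    using g_commute[OF t, of "\<omega> t *v v t" "Y t"]
    by (simp only: inner_matrix_vector[of _ "transpose _"] transpose_transpose matrix_vector_mul_assoc[symmetric])
  ultimately have "v t \<bullet> (g t *v (Y' + \<omega> t *v Y t)) = 0"
    by (simp add: matrix_vector.add_left matrix_vector.add_right inner_add_right inner_minus_left
        matrix_vector_mul_assoc)
  then show ?thesis using N_iff[OF t] g_commute[OF t] by simp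
qed

text \<open>The projection to the normal bundle has a plus sign because \<open>g(v, v) = - 1\<close>.\<close>

definition Proj :: "real \<Rightarrow> real ^ 'n option ^ 'n option" where
  "Proj t = mat 1 + outer (v t) (g t *v v t)"

lemma Proj_vec: "Proj t *v u = u + ((g t *v v t) \<bullet> u) *\<^sub>R v t"
  by (simp add: Proj_def matrix_vector.add_left outer_mult_vec)

lemma Proj_N: "t \<in> I \<inter> U \<Longrightarrow> Proj t *v u \<in> N t"
  by (simp add: N_iff Proj_vec inner_add_right g_unit)

lemma Proj_id: "t \<in> I \<inter> U \<Longrightarrow> u \<in> N t \<Longrightarrow> Proj t *v u = u"
  by (simp add: N_iff Proj_vec)

lemma Proj_decomp: "u = Proj t *v u - ((g t *v v t) \<bullet> u) *\<^sub>R v t"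
  by (simp add: Proj_vec)

lemma Proj_v: "t \<in> I \<inter> U \<Longrightarrow> Proj t *v v t = 0"
  by (simp add: Proj_vec g_unit)

lemma Cinf_proj_coeff: "Cinf_on W (\<lambda>z. ((gmat (in_chart A c L) z *v snd z) \<bullet> u) *\<^sub>R snd z)"
  by (intro Cinf_on_scaleR Cinf_on_inner Cinf_on_matrix_vector Cinf_gmat W Cinf_on_const
      Cinf_on_bounded_linear bounded_linear_snd W)

lemma normal_section_Proj: "normal_section A L I \<eta> c U (\<lambda>t. Proj t *v u)"
proof -
  have "smooth_on (I \<inter> U) (\<lambda>t. u + ((g t *v snd (z t)) \<bullet> u) *\<^sub>R snd (z t))"
    by (intro smooth_on_add smooth_on_const smooth_comp_z[OF Cinf_proj_coeff])
  then show ?thesis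
    using open_U in_dom Proj_N unfolding normal_section_def Proj_vec snd_z by auto
qed

text \<open>In E(P)' - E(P') the derivative of the chosen section \<open>P\<close> cancels, so the
  choice is immaterial. Any differentiable matrix that represents \<open>E\<close> on normal vectors
  may be used, whatever its values elsewhere; the connection enters as a commutator.\<close>

lemma endo_deriv_matrix:
  assumes t: "t \<in> I \<inter> U" and M: "(M has_vector_derivative M') (at t within I)"
    and E: "\<And>s u. s \<in> I \<inter> U \<Longrightarrow> u \<in> N s \<Longrightarrow> E s u = M s *v u" and u: "u \<in> N t"
  shows "endo_deriv A L I \<eta> c E t u = (M' + \<omega> t ** M t - M t ** \<omega> t) *v u"
    and "(\<And>s u. s \<in> I \<inter> U \<Longrightarrow> u \<in> N s \<Longrightarrow> E s u \<in> N s) \<Longrightarrow> endo_deriv A L I \<eta> c E t u \<in> N t"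
proof -
  define P where "P = (SOME P. \<exists>U. t \<in> U \<and> normal_section A L I \<eta> c U P \<and> P t = u)"
  \<comment> \<open>Projecting the constant vector \<open>u\<close> gives a normal section through
    \<open>u\<close>, so the choice in \<open>endo_deriv\<close> is made from a nonempty
    set.\<close>
  have "\<exists>V. t \<in> V \<and> normal_section A L I \<eta> c V (\<lambda>s. Proj s *v u) \<and> Proj t *v u = u"
    using normal_section_Proj Proj_id[OF t u] t by blast
  then have "\<exists>P V. t \<in> V \<and> normal_section A L I \<eta> c V P \<and> P t = u" by blast
  from someI_ex[OF this, folded P_def]
  obtain V where V: "t \<in> V" "normal_section A L I \<eta> c V P" and Pt: "P t = u" by blast
  have oV: "open V" and sP: "smooth_on (I \<inter> V) P" and PN: "\<And>s. s \<in> I \<inter> V \<Longrightarrow> P s \<in> N s"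
    using V(2) by (auto simp: normal_section_def)
  have tV: "t \<in> I \<inter> V" using t V by simp
  let ?P' = "vector_derivative P (at t within I)"
  have P': "(P has_vector_derivative ?P') (at t within I)"
    by (rule smooth_on_has_vector_derivative[OF nondeg oV sP tV])
  have cP: "?P' + \<omega> t *v P t \<in> N t"
    by (rule cov_deriv_normal[OF t P' oV V(1)]) (use PN in auto)
  have MP: "((\<lambda>s. M s *v P s) has_vector_derivative M t *v ?P' + M' *v P t) (at t within I)"
    by (rule matrix_vector.has_vector_derivative[OF M P'])
  have "((\<lambda>s. E s (P s)) has_vector_derivative M t *v ?P' + M' *v P t) (at t within I)"
    by (rule has_vector_derivative_cong_open[OF MP, of "U \<inter> V"])
      (use t V oV open_U PN E in auto)
  from vector_derivative_within[OF at_neq_bot this] t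
  have EP: "vector_derivative (\<lambda>s. E s (P s)) (at t within I) = M t *v ?P' + M' *v P t" by simp
  have ED: "endo_deriv A L I \<eta> c E t u = (M t *v ?P' + M' *v P t + \<omega> t *v (M t *v P t)) - M t *v (?P' + \<omega> t *v P t)"
    unfolding endo_deriv_def P_def[symmetric] Let_def cov_deriv_eq EP
    using E[OF t cP] E[OF t, of "P t"] PN[OF tV] by simp
  also have "\<dots> = (M' + \<omega> t ** M t - M t ** \<omega> t) *v u"
    by (simp add: Pt matrix_vector.add_left matrix_vector.add_right matrix_vector.diff_left matrix_vector_mul_assoc)
  finally show "endo_deriv A L I \<eta> c E t u = (M' + \<omega> t ** M t - M t ** \<omega> t) *v u" .
  assume EN: "\<And>s u. s \<in> I \<inter> U \<Longrightarrow> u \<in> N s \<Longrightarrow> E s u \<in> N s"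
  have "M t *v ?P' + M' *v P t + \<omega> t *v (M t *v P t) \<in> N t"
    by (rule cov_deriv_normal[OF t MP, of "U \<inter> V"]) (use t V oV open_U PN E EN in \<open>auto simp flip: E\<close>)
  moreover have "M t *v (?P' + \<omega> t *v P t) \<in> N t"
    using EN[OF t cP] E[OF t cP] by simp
  ultimately show "endo_deriv A L I \<eta> c E t u \<in> N t"
    unfolding ED by (rule subspace_diff[OF subspace_N[OF t]])
qed

text \<open>Normality is tested with metric and velocity, and both transform as tensors on passing
  to the reference chart.\<close>

lemma vec_of_chart_N_iff:
  assumes t: "t \<in> I \<inter> U"
  shows "vec_of_chart A c (\<eta> t) u \<in> normal_fibre A L I \<eta> t \<longleftrightarrow> u \<in> N t"
proof -
  have tI: "t \<in> I" using t by simp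
  let ?r = "ref_chart A (\<eta> t)"
  have "v t \<noteq> 0" using z_W[OF t] z_Pair by (metis W_iff)
  from gform_transition[OF c ref_chart(1) in_dom[OF t] ref_chart(2) this, of "v t" u]
  have "gform (in_chart A c L) (chart_map c (\<eta> t), v t) (v t) u =
     gform (in_chart A ?r L) (chart_map ?r (\<eta> t), chart_vel ?r I \<eta> t) (chart_vel ?r I \<eta> t) (vec_of_chart A c (\<eta> t) u)"
    unfolding chart_vel_transition[OF nondeg curve c ref_chart(1) tI in_dom[OF t] ref_chart(2), symmetric]
    by (simp add: vec_of_chart_def)
  then show ?thesis by (simp add: normal_fibre_def chart_normal_def chart_lift_def)
qed

lemma vec_to_chart_N_iff:
  assumes t: "t \<in> I \<inter> U"
  shows "vec_to_chart A c (\<eta> t) u \<in> N t \<longleftrightarrow> u \<in> normal_fibre A L I \<eta> t"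
  using vec_of_chart_N_iff[OF t, of "vec_to_chart A c (\<eta> t) u"] by (simp add: vec_of_to_chart[OF c in_dom[OF t]])

end

section \<open>Lagrange tensor fields\<close>

locale lagrange_chart = unit_geodesic_chart A L X I \<eta> c U
  for A :: "('a::{t2_space,second_countable_topology}, 'n::finite) chart set"
    and L :: "'a \<Rightarrow> 'n coord \<Rightarrow> real" and X :: "'a \<Rightarrow> 'n coord" and I :: "real set" and \<eta> :: "real \<Rightarrow> 'a"
    and c :: "('a, 'n) chart" and U :: "real set" +
  fixes J :: "real \<Rightarrow> 'n coord \<Rightarrow> 'n coord"
  assumes lagrange: "lagrange_tensor A L I \<eta> J" and nonsing: "nonsingular A L I \<eta> J"
begin

abbreviation "J0 \<equiv> chart_endo A \<eta> c J"
abbreviation "J1 \<equiv> endo_deriv A L I \<eta> c J0"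
abbreviation "J2 \<equiv> endo_deriv A L I \<eta> c J1"

lemma jacobi: "jacobi_tensor A L I \<eta> J"
  using lagrange by (simp add: lagrange_tensor_def)

lemma smooth_endo_J0: "smooth_endo A L I \<eta> c J0"
  using jacobi c unfolding jacobi_tensor_def Let_def by blast

lemma jacobi_equation:
  assumes "t \<in> I \<inter> U" "u \<in> N t"
  shows "J2 t u + curv (in_chart A c L) (z t) *v J0 t u = 0"
  using jacobi c assms in_dom[OF assms(1)] unfolding jacobi_tensor_def Let_def by blast

lemma
  assumes t: "t \<in> I \<inter> U"
  shows J0_N: "u \<in> N t \<Longrightarrow> J0 t u \<in> N t"
    and J0_add: "u \<in> N t \<Longrightarrow> w \<in> N t \<Longrightarrow> J0 t (u + w) = J0 t u + J0 t w"
    and J0_scaleR: "u \<in> N t \<Longrightarrow> J0 t (r *\<^sub>R u) = r *\<^sub>R J0 t u"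
    and J0_inj: "u \<in> N t \<Longrightarrow> J0 t u = 0 \<Longrightarrow> u = 0"
proof -
  have e: "endo_on (normal_fibre A L I \<eta> t) (J t)"
    using jacobi t by (simp add: jacobi_tensor_def)
  have fib: "vec_of_chart A c (\<eta> t) u \<in> normal_fibre A L I \<eta> t" if "u \<in> N t" for u
    using that vec_of_chart_N_iff[OF t] by simp
  note lin = linear_vec_of_chart[OF c in_dom[OF t]] linear_vec_to_chart[OF c in_dom[OF t]]
  show 1: "J0 t u \<in> N t" if "u \<in> N t" for u
    using e fib[OF that] by (auto simp: chart_endo_def vec_to_chart_N_iff[OF t] endo_on_def)
  show 2: "J0 t (u + w) = J0 t u + J0 t w" if "u \<in> N t" "w \<in> N t" for u w
    using e fib[OF that(1)] fib[OF that(2)]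
    by (simp add: chart_endo_def endo_on_def linear_add[OF lin(1)] linear_add[OF lin(2)])
  show 3: "J0 t (r *\<^sub>R u) = r *\<^sub>R J0 t u" if "u \<in> N t" for u r
    using e fib[OF that] by (simp add: chart_endo_def endo_on_def linear_scale[OF lin(1)] linear_scale[OF lin(2)])
  show "u = 0" if u: "u \<in> N t" "J0 t u = 0"
  proof -
    have inj: "inj_on (J t) (normal_fibre A L I \<eta> t)"
      using nonsing t by (simp add: nonsingular_def bij_betw_def)
    have 0: "0 \<in> N t" by (rule subspace_0[OF subspace_N[OF t]])
    have "J0 t 0 = 0" using 3[OF 0, of 0] by simp
    then have "J t (vec_of_chart A c (\<eta> t) u) = J t (vec_of_chart A c (\<eta> t) 0)"
      using u(2) unfolding chart_endo_def by (metis vec_of_to_chart[OF c in_dom[OF t]])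
    then have "vec_of_chart A c (\<eta> t) u = vec_of_chart A c (\<eta> t) 0"
      using inj fib[OF u(1)] fib[OF 0] by (auto dest: inj_onD)
    then show ?thesis by (metis vec_to_of_chart[OF c in_dom[OF t]])
  qed
qed

text \<open>\<open>J\<close> extended by the identity on the velocity\<close>

definition ext :: "real \<Rightarrow> 'n coord \<Rightarrow> 'n coord" where
  "ext t u = J0 t (Proj t *v u) - ((g t *v v t) \<bullet> u) *\<^sub>R v t"

definition Jm :: "real \<Rightarrow> real ^ 'n option ^ 'n option" where
  "Jm t = matrix (ext t)"

lemma linear_ext: "t \<in> I \<inter> U \<Longrightarrow> linear (ext t)"
  by (rule linearI)
    (simp_all add: ext_def matrix_vector.add_right matrix_vector.scaleR_right J0_add J0_scaleR Proj_N
      inner_add_right algebra_simps)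

lemma Jm_ext: "t \<in> I \<inter> U \<Longrightarrow> Jm t *v u = ext t u"
  unfolding Jm_def using matrix_works[of "ext t" u] linear_ext[of t]
  by (simp add: linear_matrix_vector_mul_eq)

lemma Jm_N: "t \<in> I \<inter> U \<Longrightarrow> u \<in> N t \<Longrightarrow> Jm t *v u = J0 t u"
  by (simp add: Jm_ext ext_def Proj_id) (simp add: N_iff)

lemma Jm_v: "t \<in> I \<inter> U \<Longrightarrow> Jm t *v v t = v t"
  using J0_scaleR[of t 0 0] subspace_0[OF subspace_N] by (simp add: Jm_ext ext_def Proj_v g_unit)

text \<open>\<open>smooth_endo\<close> speaks only about smooth normal sections. The projections of
  the constant basis vectors are such sections and, with the velocity part added, give the columns
  of \<open>Jm\<close>.\<close>

lemma smooth_on_Jm: "smooth_on (I \<inter> U) Jm"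
proof -
  let ?col = "\<lambda>a (y :: 'n coord). (\<chi> i j. if j = a then y $ i else 0) :: real ^ 'n option ^ 'n option"
  have l: "bounded_linear (?col a)" for a
    by (rule linear_conv_bounded_linear[THEN iffD1], rule linearI) (auto simp: vec_eq_iff)
  have s: "smooth_on (I \<inter> U) (\<lambda>t. ext t u)" for u
  proof -
    have "smooth_on (I \<inter> U) (\<lambda>t. J0 t (Proj t *v u))"
      using smooth_endo_J0 normal_section_Proj unfolding smooth_endo_def by blast
    moreover have "smooth_on (I \<inter> U) (\<lambda>t. - (((g t *v snd (z t)) \<bullet> u) *\<^sub>R snd (z t)))"
      by (rule smooth_on_linear_comp[OF smooth_comp_z[OF Cinf_proj_coeff] bounded_linear_minus[OF bounded_linear_ident]])
    ultimately have "smooth_on (I \<inter> U) (\<lambda>t. J0 t (Proj t *v u) + - (((g t *v snd (z t)) \<bullet> u) *\<^sub>R snd (z t)))"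
      by (rule smooth_on_add)
    then show ?thesis by (simp add: ext_def snd_z)
  qed
  have "smooth_on (I \<inter> U) (\<lambda>t. \<Sum>a\<in>UNIV. ?col a (ext t (axis a 1)))"
    by (intro smooth_on_sum smooth_on_linear_comp[OF s l])
  moreover have "(\<Sum>a\<in>UNIV. ?col a (ext t (axis a 1))) = Jm t" for t
    by (simp add: Jm_def matrix_def vec_eq_iff)
  ultimately show ?thesis by simp
qed

abbreviation "Jm' t \<equiv> vector_derivative Jm (at t within I)"

text \<open>The covariant derivative of the endomorphism field \<open>Jm\<close>.\<close>

definition M :: "real \<Rightarrow> real ^ 'n option ^ 'n option" where
  "M t = Jm' t + \<omega> t ** Jm t - Jm t ** \<omega> t"

lemma Jm_derivative: "t \<in> I \<inter> U \<Longrightarrow> (Jm has_vector_derivative Jm' t) (at t within I)"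
  by (rule smooth_on_has_vector_derivative[OF nondeg open_U smooth_on_Jm])

lemma M_derivative: assumes t: "t \<in> I \<inter> U" obtains M' where "(M has_vector_derivative M') (at t within I)"
proof -
  obtain w' where w': "(\<omega> has_vector_derivative w') (at t within I)" using omega_derivative[OF t] .
  have J'': "(Jm' has_vector_derivative vector_derivative Jm' (at t within I)) (at t within I)"
    by (rule smooth_on_has_vector_derivative[OF nondeg open_U smooth_on_vector_derivative[OF nondeg open_U smooth_on_Jm] t])
  show thesis
    by (rule that, unfold M_def[abs_def],
        rule has_vector_derivative_diff[OF has_vector_derivative_add[OF J'' matrix_mult.has_vector_derivative[OF w' Jm_derivative[OF t]]]
          matrix_mult.has_vector_derivative[OF Jm_derivative[OF t] w']])
qed

lemma J1_M: "t \<in> I \<inter> U \<Longrightarrow> u \<in> N t \<Longrightarrow> J1 t u = M t *v u"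
  unfolding M_def by (rule endo_deriv_matrix(1)[OF _ Jm_derivative]) (simp_all add: Jm_N)

lemma J1_N: "t \<in> I \<inter> U \<Longrightarrow> u \<in> N t \<Longrightarrow> J1 t u \<in> N t"
  by (rule endo_deriv_matrix(2)[OF _ Jm_derivative]) (simp_all add: Jm_N J0_N)

text \<open>Normal space and velocity together span the tangent space.\<close>

lemma matrix_eqI_N:
  assumes t: "t \<in> I \<inter> U" and "\<And>u. u \<in> N t \<Longrightarrow> P *v u = Q *v u" "P *v v t = Q *v v t"
  shows "P = (Q :: real ^ 'n option ^ 'n option)"
proof -
  have "P *v u = Q *v u" for u
    using Proj_decomp[of u t] assms(2)[OF Proj_N[OF t, of u]] assms(3)
    by (metis matrix_vector.diff_right matrix_vector.scaleR_right)
  then show ?thesis by (simp add: matrix_eq)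
qed

text \<open>\<open>Jm\<close> fixes the velocity along the curve and the velocity is parallel, so
  the covariant derivative of \<open>Jm\<close> annihilates it.\<close>

lemma M_v: assumes t: "t \<in> I \<inter> U" shows "M t *v v t = 0"
proof -
  have "((\<lambda>s. Jm s *v v s) has_vector_derivative Jm t *v - (\<omega> t *v v t) + Jm' t *v v t) (at t within I)"
    by (rule matrix_vector.has_vector_derivative[OF Jm_derivative[OF t] v_derivative[OF t]])
  then have "(v has_vector_derivative Jm t *v - (\<omega> t *v v t) + Jm' t *v v t) (at t within I)"
    by (rule has_vector_derivative_cong_open[OF _ open_U]) (use t Jm_v in auto)
  then have "Jm t *v - (\<omega> t *v v t) + Jm' t *v v t = - (\<omega> t *v v t)"
    using vector_derivative_unique_within[OF at_neq_bot _ v_derivative[OF t]] t by blast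
  then show ?thesis
    by (simp add: M_def matrix_vector.add_left matrix_vector.diff_left matrix_vector.minus_right
        matrix_vector_mul_assoc[symmetric] Jm_v[OF t] algebra_simps)
qed

text \<open>On normal vectors this is the Jacobi equation. On the velocity both sides vanish:
  \<open>M\<close> annihilates it along the curve, and so does the curvature, which
  \<open>Jm\<close> leaves untouched by fixing the velocity.\<close>

lemma M_equation:
  assumes t: "t \<in> I \<inter> U" and M': "(M has_vector_derivative M') (at t within I)"
  shows "M' + \<omega> t ** M t - M t ** \<omega> t = - (curv (in_chart A c L) (z t) ** Jm t)"
proof (rule matrix_eqI_N[OF t])
  fix u assume u: "u \<in> N t"
  have "J2 t u = (M' + \<omega> t ** M t - M t ** \<omega> t) *v u"
    by (rule endo_deriv_matrix(1)[OF t M' _ u]) (rule J1_M)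
  then show "(M' + \<omega> t ** M t - M t ** \<omega> t) *v u = - (curv (in_chart A c L) (z t) ** Jm t) *v u"
    using jacobi_equation[OF t u]
    by (simp add: matrix_vector.minus_left matrix_vector_mul_assoc[symmetric] Jm_N[OF t u] eq_neg_iff_add_eq_0)
next
  have "((\<lambda>s. M s *v v s) has_vector_derivative M t *v - (\<omega> t *v v t) + M' *v v t) (at t within I)"
    by (rule matrix_vector.has_vector_derivative[OF M' v_derivative[OF t]])
  then have "((\<lambda>s. 0) has_vector_derivative M t *v - (\<omega> t *v v t) + M' *v v t) (at t within I)"
    by (rule has_vector_derivative_cong_open[OF _ open_U]) (use t M_v in auto)
  then have "M t *v - (\<omega> t *v v t) + M' *v v t = 0"
    using vector_derivative_unique_within[OF at_neq_bot _ has_vector_derivative_const] t by blast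
  then have "(M' + \<omega> t ** M t - M t ** \<omega> t) *v v t = 0"
    by (simp add: matrix_vector.add_left matrix_vector.diff_left matrix_vector.minus_right
        matrix_vector_mul_assoc[symmetric] M_v[OF t] algebra_simps)
  moreover have "curv (in_chart A c L) (z t) *v v t = 0"
    using curv_velocity[of "fst (z t)" "v t"] z_W[OF t] unfolding z_Pair[symmetric] by simp
  ultimately show "(M' + \<omega> t ** M t - M t ** \<omega> t) *v v t = - (curv (in_chart A c L) (z t) ** Jm t) *v v t"
    by (simp add: matrix_vector.minus_left matrix_vector_mul_assoc[symmetric] Jm_v[OF t])
qed

text \<open>\<open>J0\<close> has normal values and the velocity is not normal, so a kernel vector
  has no velocity component; injectivity of \<open>J0\<close> on normal vectors finishes.\<close>

lemma det_Jm: assumes t: "t \<in> I \<inter> U" shows "det (Jm t) \<noteq> 0"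
proof -
  have "u = 0" if u: "Jm t *v u = 0" for u
  proof -
    let ?a = "(g t *v v t) \<bullet> u"
    have "J0 t (Proj t *v u) = ?a *\<^sub>R v t" using u by (simp add: Jm_ext[OF t] ext_def)
    moreover have "J0 t (Proj t *v u) \<in> N t" by (rule J0_N[OF t Proj_N[OF t]])
    ultimately have "?a * ((g t *v v t) \<bullet> v t) = 0" by (simp add: N_iff[OF t])
    then have a: "?a = 0" using g_unit[OF t] by simp
    then have "u \<in> N t" "J0 t u = 0"
      using u by (simp_all add: N_iff[OF t] Jm_ext[OF t] ext_def Proj_vec)
    then show "u = 0" by (rule J0_inj[OF t])
  qed
  then show ?thesis
    unfolding invertible_det_nz[symmetric] invertible_left_inverse matrix_left_invertible_ker by blast
qed

text \<open>\<open>transpose_on\<close> is a definite description, so the adjoint must exist and be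
  unique. It is found by raising an index with the inverse metric and projecting; it is unique since
  a normal vector orthogonal to all normal vectors is orthogonal to everything.\<close>

lemma transpose_on_N:
  fixes F :: "real ^ 'n option ^ 'n option"
  assumes t: "t \<in> I \<inter> U" and F: "\<And>w. w \<in> N t \<Longrightarrow> f w = F *v w" and w: "w \<in> N t"
  shows "gform (in_chart A c L) (z t) (transpose_on (N t) (gform (in_chart A c L) (z t)) f y) w =
    gform (in_chart A c L) (z t) y (f w)"
proof -
  let ?b = "gform (in_chart A c L) (z t)"
  let ?P = "\<lambda>x. x \<in> N t \<and> (\<forall>w\<in>N t. ?b x w = ?b y (f w))"
  define x where "x = Proj t *v (matrix_inv (g t) *v (transpose F *v (g t *v y)))"
  have "?b x w = ?b y (f w)" if w: "w \<in> N t" for w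
  proof -
    let ?x0 = "matrix_inv (g t) *v (transpose F *v (g t *v y))"
    have "?b x w = (g t *v x) \<bullet> w" by (simp add: gform_inner g_commute[OF t])
    also have "\<dots> = (g t *v ?x0) \<bullet> w"
      using w by (simp add: x_def Proj_vec matrix_vector.add_right matrix_vector.scaleR_right inner_add_left N_iff[OF t])
    also have "g t *v ?x0 = transpose F *v (g t *v y)"
      by (simp add: matrix_vector_mul_assoc matrix_inv_right[OF g_det[OF t]] matrix_mul_assoc)
    also have "\<dots> \<bullet> w = (g t *v y) \<bullet> (F *v w)" by (rule inner_matrix_vector[symmetric])
    also have "\<dots> = ?b y (f w)" by (simp add: gform_inner g_commute[OF t] F[OF w])
    finally show ?thesis .
  qed
  then have x: "?P x" unfolding x_def using Proj_N[OF t] by blast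
  have "x' = x" if x': "?P x'" for x'
  proof -
    have d: "x' - x \<in> N t" using x x' subspace_diff[OF subspace_N[OF t]] by blast
    have 0: "(g t *v (x' - x)) \<bullet> w = 0" if "w \<in> N t" for w
      using x x' that by (simp add: gform_inner g_commute[OF t] matrix_vector.diff_right inner_diff_left)
    have "(g t *v (x' - x)) \<bullet> v t = (x' - x) \<bullet> (g t *v v t)" by (rule g_commute[OF t, symmetric])
    also have "\<dots> = 0" using d by (simp add: N_iff[OF t] inner_commute)
    finally have "(g t *v (x' - x)) \<bullet> v t = 0" .
    then have "(g t *v (x' - x)) \<bullet> w = 0" for w
      using 0[OF Proj_N[OF t, of w]] by (simp add: Proj_vec inner_add_right)
    then have "g t *v (x' - x) = 0" by (metis inner_eq_zero_iff)
    then have "matrix_inv (g t) *v (g t *v (x' - x)) = 0" by simp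
    then show "x' = x" by (simp add: matrix_vector_mul_assoc matrix_inv_left[OF g_det[OF t]])
  qed
  with x have "?P (THE x. ?P x)" by (rule theI)
  then show ?thesis unfolding transpose_on_def using w by blast
qed

text \<open>On normal vectors the Lagrange condition is the symmetry of g(J u, M w). Velocity
  components do not disturb it: \<open>M\<close> annihilates them, and the velocity that
  \<open>Jm\<close> keeps is orthogonal to the values of \<open>M\<close>.\<close>

lemma lagrange_symmetric:
  assumes t: "t \<in> I \<inter> U" shows "transpose (transpose (Jm t) ** g t ** M t) = transpose (Jm t) ** g t ** M t"
proof -
  let ?b = "gform (in_chart A c L) (z t)"
  have N: "(Jm t *v u) \<bullet> (g t *v (M t *v w)) = (Jm t *v w) \<bullet> (g t *v (M t *v u))"
    if u: "u \<in> N t" and w: "w \<in> N t" for u w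
  proof -
    let ?T = "transpose_on (N t) ?b"
    have "?T (J1 t) (J0 t u) - ?T (J0 t) (J1 t u) = 0"
      using lagrange c t in_dom[OF t] u unfolding lagrange_tensor_def Let_def by blast
    then have "?T (J1 t) (J0 t u) = ?T (J0 t) (J1 t u)" by simp
    then have "?b (J0 t u) (J1 t w) = ?b (J1 t u) (J0 t w)"
      using transpose_on_N[OF t J1_M[OF t] w, of "J0 t u"] transpose_on_N[OF t Jm_N[OF t, symmetric] w, of "J1 t u"]
      by simp
    then have "(Jm t *v u) \<bullet> (g t *v (M t *v w)) = (M t *v u) \<bullet> (g t *v (Jm t *v w))"
      using u w by (simp only: gform_inner J1_M[OF t] Jm_N[OF t])
    also have "\<dots> = (g t *v (M t *v u)) \<bullet> (Jm t *v w)" by (rule g_commute[OF t])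
    finally show ?thesis by (simp only: inner_commute[of "Jm t *v w"])
  qed
  have z: "v t \<bullet> (g t *v (M t *v w)) = 0" if "w \<in> N t" for w
    using J1_N[OF t that] J1_M[OF t that] by (simp add: N_iff[OF t] g_commute[OF t])
  have sym: "(Jm t *v u) \<bullet> (g t *v (M t *v w)) = (Jm t *v w) \<bullet> (g t *v (M t *v u))" for u w
  proof -
    have D: "Jm t *v x = Jm t *v (Proj t *v x) - ((g t *v v t) \<bullet> x) *\<^sub>R v t"
        "M t *v x = M t *v (Proj t *v x)" for x
      using Proj_decomp[of x t] Jm_v[OF t] M_v[OF t]
      by (metis matrix_vector.diff_right matrix_vector.scaleR_right)
         (use Proj_decomp[of x t] M_v[OF t] in \<open>metis matrix_vector.diff_right matrix_vector.scaleR_right scaleR_zero_right diff_zero\<close>)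
    show ?thesis
      unfolding D[of u] D[of w] inner_diff_left inner_scaleR_left z[OF Proj_N[OF t]]
      using N[OF Proj_N[OF t] Proj_N[OF t]] by simp
  qed
  let ?S = "transpose (Jm t) ** g t ** M t"
  have S: "u \<bullet> (?S *v w) = (Jm t *v u) \<bullet> (g t *v (M t *v w))" for u w
    by (simp only: matrix_vector_mul_assoc[symmetric] inner_matrix_vector[of _ "transpose _"] transpose_transpose)
  have "transpose ?S *v w = ?S *v w" for w
  proof (rule vector_eq_ldot[THEN iffD1], rule allI)
    fix u
    have "u \<bullet> (transpose ?S *v w) = (?S *v u) \<bullet> w"
      using inner_matrix_vector[of u "transpose ?S" w] by (simp only: transpose_transpose)
    also have "\<dots> = w \<bullet> (?S *v u)" by (rule inner_commute)
    also have "\<dots> = u \<bullet> (?S *v w)" unfolding S by (rule sym)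
    finally show "u \<bullet> (transpose ?S *v w) = u \<bullet> (?S *v w)" .
  qed
  then show ?thesis by (intro matrix_eq[THEN iffD2] allI)
qed

abbreviation "B t \<equiv> M t ** matrix_inv (Jm t)"

text \<open>\<open>g t ** B t\<close> is congruent, via the inverse of \<open>Jm\<close>, to the
  symmetric matrix of the Lagrange condition, so \<open>B t\<close> is self-adjoint. It annihilates
  the velocity because \<open>Jm\<close> fixes it and \<open>M\<close> annihilates it.\<close>

lemma trace_B_square: assumes t: "t \<in> I \<inter> U"
  shows "(trace (B t))\<^sup>2 / real CARD('n) \<le> trace (B t ** B t)"
proof (rule trace_square_ge[OF signature[OF z_W[OF t]], where v = "v t"])
  let ?J = "Jm t" and ?K = "matrix_inv (Jm t)"
  note K = matrix_inv_right[OF det_Jm[OF t]] matrix_inv_left[OF det_Jm[OF t]]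
  have "g t ** B t = transpose ?K ** (transpose ?J ** g t ** M t) ** ?K"
  proof -
    have "transpose ?K ** transpose ?J = mat 1"
      using K(1) by (metis matrix_transpose_mul transpose_mat)
    then have "transpose ?K ** (transpose ?J ** (g t ** M t)) = g t ** M t"
      by (simp add: matrix_mul_assoc)
    then show ?thesis by (simp add: matrix_mul_assoc)
  qed
  moreover have "transpose (transpose ?K ** H ** ?K) = transpose ?K ** transpose H ** ?K" for H
    by (simp only: matrix_transpose_mul transpose_transpose matrix_mul_assoc)
  ultimately show "transpose (g t ** B t) = g t ** B t"
    by (simp only: lagrange_symmetric[OF t])
  have "?K *v v t = ?K *v (?J *v v t)" by (simp add: Jm_v[OF t])
  also have "\<dots> = v t" by (simp add: matrix_vector_mul_assoc K)
  finally show "B t *v v t = 0" by (simp add: matrix_vector_mul_assoc[symmetric] M_v[OF t])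
  show "v t \<bullet> (g t *v v t) = - 1" by (rule g_unit[OF t])
qed

lemma expansion_derivative:
  assumes t: "t \<in> I \<inter> U"
  obtains \<theta>' where "((\<lambda>s. trace (B s)) has_vector_derivative \<theta>') (at t within I)"
    "\<theta>' \<le> - trace (curv (in_chart A c L) (z t)) - (trace (B t))\<^sup>2 / real CARD('n)"
proof -
  obtain M' where M': "(M has_vector_derivative M') (at t within I)" using M_derivative[OF t] .
  from raychaudhuri(1)[OF Jm_derivative[OF t] det_Jm[OF t] M' M_def M_equation[OF t M']]
  show thesis by (rule that) (use trace_B_square[OF t] in simp)
qed

lemma det_derivative:
  assumes t: "t \<in> I \<inter> U"
  shows "((\<lambda>s. det (Jm s)) has_vector_derivative det (Jm t) * trace (B t)) (at t within I)"
proof -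
  obtain M' where M': "(M has_vector_derivative M') (at t within I)" using M_derivative[OF t] .
  from raychaudhuri(2)[OF Jm_derivative[OF t] det_Jm[OF t] M' M_def M_equation[OF t M']]
    det_has_vector_derivative[OF Jm_derivative[OF t] det_Jm[OF t]]
  show ?thesis by simp
qed

section \<open>The determinant of the tensor field\<close>

text \<open>The factor \<open>r\<close> acts on the normal space only, not on the velocity where
  \<open>Jm\<close> is the identity; hence the exponent is n and not n + 1.\<close>

lemma endo_matrix_det_J:
  fixes b :: "'n \<Rightarrow> 'n coord" and Bm :: "real ^ 'n ^ 'n" and r :: real
  assumes t: "t \<in> I \<inter> U" and r: "r \<noteq> 0"
    and b: "inj b" "independent (range b)" "span (range b) = normal_fibre A L I \<eta> t"
    and B: "\<And>j. r *\<^sub>R J t (b j) = (\<Sum>i\<in>UNIV. Bm $ i $ j *\<^sub>R b i)"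
  shows "det Bm = r ^ CARD('n) * det (Jm t)"
proof -
  let ?T = "vec_to_chart A c (\<eta> t)" and ?T' = "vec_of_chart A c (\<eta> t)"
  note lin = linear_vec_to_chart[OF c in_dom[OF t]]
  have inj: "inj ?T" by (rule inj_on_inverseI[of _ ?T']) (rule vec_of_to_chart[OF c in_dom[OF t]])
  have "det ((1 / r) *\<^sub>R Bm) = det (Jm t)"
  proof (rule endo_matrix_det[OF v_notin_N[OF t] Jm_v[OF t] Jm_N[OF t], where b = "?T \<circ> b"])
    show "inj (?T \<circ> b)" using inj b(1) by (rule inj_compose)
    have r: "range (?T \<circ> b) = ?T ` range b" by (rule image_comp[symmetric])
    show "independent (range (?T \<circ> b))" unfolding r
      by (rule linear_independent_injective_image[OF lin b(2) inj_on_subset[OF inj]]) simp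
    have "?T ` normal_fibre A L I \<eta> t = N t"
    proof (intro set_eqI iffI)
      fix u assume "u \<in> N t"
      then have "?T' u \<in> normal_fibre A L I \<eta> t" by (simp add: vec_of_chart_N_iff[OF t])
      then show "u \<in> ?T ` normal_fibre A L I \<eta> t" by (metis image_eqI vec_to_of_chart[OF c in_dom[OF t]])
    qed (auto simp: vec_to_chart_N_iff[OF t])
    then show "span (range (?T \<circ> b)) = N t"
      unfolding r by (simp add: linear_span_image[OF lin] b(3))
    show "J0 t ((?T \<circ> b) j) = (\<Sum>i\<in>UNIV. ((1 / r) *\<^sub>R Bm) $ i $ j *\<^sub>R (?T \<circ> b) i)" for j
    proof -
      have "J t (b j) = (1 / r) *\<^sub>R (\<Sum>i\<in>UNIV. Bm $ i $ j *\<^sub>R b i)"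
        unfolding B[symmetric] using assms(2) by simp
      then have "?T (J t (b j)) = (1 / r) *\<^sub>R (\<Sum>i\<in>UNIV. Bm $ i $ j *\<^sub>R ?T (b i))"
        by (simp add: linear_scale[OF lin] linear_sum[OF lin])
      then show ?thesis
        by (simp add: chart_endo_def vec_of_to_chart[OF c in_dom[OF t]] scaleR_sum_right)
    qed
  qed
  then show ?thesis using r by (simp add: det_scaleR power_divide field_simps)
qed

lemma normal_fibre_basis:
  assumes t: "t \<in> I \<inter> U"
  obtains b :: "'n \<Rightarrow> 'n coord"
  where "inj b" "independent (range b)" "span (range b) = normal_fibre A L I \<eta> t"
proof -
  let ?T' = "vec_of_chart A c (\<eta> t)"
  note lin = linear_vec_of_chart[OF c in_dom[OF t]]
  have inj: "inj ?T'" by (rule inj_on_inverseI[of _ "vec_to_chart A c (\<eta> t)"]) (rule vec_to_of_chart[OF c in_dom[OF t]])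
  have "g t *v v t \<noteq> 0" using g_unit[OF t] by auto
  then have "dim {u. (g t *v v t) \<bullet> u = 0} = DIM('n coord) - 1" by (rule dim_hyperplane)
  moreover have Neq: "N t = {u. (g t *v v t) \<bullet> u = 0}" by (auto simp: N_iff[OF t])
  ultimately have dim: "dim (N t) = CARD('n)" by (simp add: card_UNIV_option)
  obtain S where S: "S \<subseteq> N t" "independent S" "N t \<subseteq> span S" "card S = dim (N t)"
    using basis_exists by blast
  have "finite S" using S(2) by (rule independent_imp_finite)
  then obtain h where h: "bij_betw h (UNIV :: 'n set) S"
    using S(4) dim finite_same_card_bij[of "UNIV :: 'n set" S] by auto
  have spS: "span S = N t"
    using S span_minimal[OF S(1) subspace_N[OF t]] by blast
  have r: "range (?T' \<circ> h) = ?T' ` S"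
    using h image_comp[of ?T' h UNIV] by (metis bij_betw_def)
  show thesis
  proof (rule that[of "?T' \<circ> h"])
    show "inj (?T' \<circ> h)" using inj h by (intro inj_compose) (auto simp: bij_betw_def)
    show "independent (range (?T' \<circ> h))" unfolding r
      by (rule linear_independent_injective_image[OF lin S(2) inj_on_subset[OF inj]]) simp
    show "span (range (?T' \<circ> h)) = normal_fibre A L I \<eta> t"
      unfolding r linear_span_image[OF lin] spS
    proof (intro set_eqI iffI)
      fix u assume "u \<in> normal_fibre A L I \<eta> t"
      then show "u \<in> ?T' ` N t"
        by (metis image_eqI vec_of_to_chart[OF c in_dom[OF t]] vec_to_chart_N_iff[OF t])
    qed (auto simp: vec_of_chart_N_iff[OF t])
  qed
qed

text \<open>Makes the definite description in \<open>endo_det\<close> meaningful: a basis of the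
  normal fibre indexed by \<open>'n\<close> exists, and every such basis gives the same
  value.\<close>

lemma endo_det_J:
  assumes t: "t \<in> I \<inter> U" and r: "r \<noteq> 0"
  shows "endo_det (normal_fibre A L I \<eta> t) (\<lambda>w. r *\<^sub>R J t w) = r ^ CARD('n) * det (Jm t)"
  unfolding endo_det_def
proof (rule the_equality)
  obtain b :: "'n \<Rightarrow> 'n coord" where b: "inj b" "independent (range b)" "span (range b) = normal_fibre A L I \<eta> t"
    using normal_fibre_basis[OF t] .
  have e: "endo_on (normal_fibre A L I \<eta> t) (J t)"
    using jacobi t by (simp add: jacobi_tensor_def)
  have "\<exists>q. (\<Sum>i\<in>UNIV. q i *\<^sub>R b i) = r *\<^sub>R J t (b j)" for j
  proof -
    have "b j \<in> normal_fibre A L I \<eta> t" unfolding b(3)[symmetric] by (rule span_base) simp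
    then have "J t (b j) \<in> span (range b)" using e unfolding b(3) endo_on_def by blast
    then have "r *\<^sub>R J t (b j) \<in> span (range b)" by (rule span_scale)
    then obtain q where "(\<Sum>w\<in>range b. q w *\<^sub>R w) = r *\<^sub>R J t (b j)"
      by (auto simp: span_finite)
    then show ?thesis using b(1) by (intro exI[of _ "q \<circ> b"]) (simp add: sum.reindex)
  qed
  then obtain q where q: "\<And>j. (\<Sum>i\<in>UNIV. q j i *\<^sub>R b i) = r *\<^sub>R J t (b j)" by metis
  define Bm :: "real ^ 'n ^ 'n" where "Bm = (\<chi> i j. q j i)"
  have Bm: "r *\<^sub>R J t (b j) = (\<Sum>i\<in>UNIV. Bm $ i $ j *\<^sub>R b i)" for j by (simp add: Bm_def q)
  show "\<exists>(b :: 'n \<Rightarrow> 'n coord) (Bm :: real ^ 'n ^ 'n).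
     inj b \<and> independent (range b) \<and> span (range b) = normal_fibre A L I \<eta> t \<and>
     (\<forall>j. r *\<^sub>R J t (b j) = (\<Sum>i\<in>UNIV. Bm $ i $ j *\<^sub>R b i)) \<and> r ^ CARD('n) * det (Jm t) = det Bm"
    by (intro exI[of _ b] exI[of _ Bm] conjI b allI Bm endo_matrix_det_J[OF t r b Bm, symmetric])
next
  fix d assume "\<exists>(b :: 'n \<Rightarrow> 'n coord) (Bm :: real ^ 'n ^ 'n).
     inj b \<and> independent (range b) \<and> span (range b) = normal_fibre A L I \<eta> t \<and>
     (\<forall>j. r *\<^sub>R J t (b j) = (\<Sum>i\<in>UNIV. Bm $ i $ j *\<^sub>R b i)) \<and> d = det Bm"
  then show "d = r ^ CARD('n) * det (Jm t)" using endo_matrix_det_J[OF t r] by blast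
qed

text \<open>The n-th power undoes the division of the weight by n.\<close>

lemma endo_det_weighted:
  assumes t: "t \<in> I \<inter> U"
  shows "endo_det (normal_fibre A L I \<eta> t) (weighted_tensor A I \<eta> \<psi> J t) =
    exp (- weight_along A \<psi> I \<eta> t) * det (Jm t)"
  using endo_det_J[OF t, of "exp (- weight_along A \<psi> I \<eta> t / real CARD('n))"]
  by (simp add: weighted_tensor_def[abs_def] exp_of_nat_mult[symmetric])

end

section \<open>The weight\<close>

lemma smooth_on_precompose:
  assumes g: "smooth_on S g" and h: "Cinf_on UNIV h"
  shows "smooth_on (h -` S) (\<lambda>x. g (h x))"
  unfolding smooth_on_def2
proof
  fix x assume "x \<in> h -` S"
  then have "h x \<in> S" by simp
  from g[unfolded smooth_on_def2, rule_format, OF this]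
  obtain U G where U: "open U" "h x \<in> U" and G: "Cinf_on U G" "\<forall>y\<in>S \<inter> U. G y = g y" by blast
  have "open (h -` U)"
    using continuous_open_preimage[OF Cinf_on_continuous_on[OF h] open_UNIV U(1)] by simp
  moreover have "Cinf_on (h -` U) (\<lambda>x. G (h x))"
    using \<open>open (h -` U)\<close> U(1) by (rule Cinf_on_compose) (use G h in \<open>auto intro: Cinf_on_subset\<close>)
  ultimately show "\<exists>V k. open V \<and> x \<in> V \<and> Cinf_on V k \<and> (\<forall>y\<in>h -` S \<inter> V. k y = g (h y))"
    using U G by (intro exI[of _ "h -` U"] exI[of _ "\<lambda>x. G (h x)"]) auto
qed

locale weighted_atlas = finsler_atlas A L
  for A :: "('a::{t2_space,second_countable_topology}, 'n::finite) chart set"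
    and L :: "'a \<Rightarrow> 'n coord \<Rightarrow> real" +
  fixes X :: "'a \<Rightarrow> 'n coord" and \<psi> :: "'a \<Rightarrow> 'n coord \<Rightarrow> real"
  assumes weighted: "weighted_finsler_spacetime A L X \<psi>"
begin

text \<open>The closed future cones without zero, in chart coordinates: a set with boundary, on
  which smoothness means local smooth extension.\<close>

definition weight_dom :: "('a, 'n) chart \<Rightarrow> ('n coord \<times> 'n coord) set" where
  "weight_dom c = {(x, v). x \<in> chart_img c \<and>
     vec_of_chart A c (chart_inv c x) v \<in> closure (future_cone L X (chart_inv c x)) - {0}}"

lemma smooth_on_weight: "c \<in> A \<Longrightarrow> smooth_on (weight_dom c) (in_chart A c \<psi>)"
  using weighted unfolding weighted_finsler_spacetime_def weight_dom_def by blast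

lemma future_cone_closure:
  assumes "future_causal L X p v" "L p v < 0"
  shows "v \<in> closure (future_cone L X p) - {0}"
proof -
  have "v \<in> future_cone L X p" using assms by (simp add: future_cone_def timelike_def)
  moreover have "v \<noteq> 0" using assms(2) L_zero by auto
  ultimately show ?thesis using closure_subset by blast
qed

lemma lift_weight_dom:
  assumes \<kappa>: "causal_geodesic A L X K \<kappa>" and c: "c \<in> A" and s: "s \<in> K" "\<kappa> s \<in> chart_dom c"
    and neg: "in_chart A c L (chart_lift c K \<kappa> s) < 0"
  shows "chart_lift c K \<kappa> s \<in> weight_dom c"
    and "in_chart A c \<psi> (chart_lift c K \<kappa> s) = weight_along A \<psi> K \<kappa> s"
proof -
  have k: "nondeg_interval K" "smooth_curve A K \<kappa>" using \<kappa> by (auto simp: causal_geodesic_def)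
  have "future_causal L X (\<kappa> s) (velocity A K \<kappa> s)" using \<kappa> s(1) by (simp add: causal_geodesic_def)
  moreover have "L (\<kappa> s) (velocity A K \<kappa> s) < 0" using neg in_chart_lift[OF k c s] by simp
  ultimately have "velocity A K \<kappa> s \<in> closure (future_cone L X (\<kappa> s)) - {0}"
    by (rule future_cone_closure)
  then show "chart_lift c K \<kappa> s \<in> weight_dom c"
    using s(2) by (simp add: weight_dom_def chart_lift_def chart_map_img chart_inv_map[OF c s(2)] vec_of_chart_vel[OF k c s])
  show "in_chart A c \<psi> (chart_lift c K \<kappa> s) = weight_along A \<psi> K \<kappa> s"
    unfolding in_chart_lift[OF k c s] weight_along_def ..
qed

text \<open>\<open>vector_derivative\<close> has some value even where no derivative exists, so
  existence of the first derivative is required on a neighbourhood of \<open>s\<close>, and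
  existence of the second at \<open>s\<close>.\<close>

definition weight_jet :: "real set \<Rightarrow> (real \<Rightarrow> 'a) \<Rightarrow> real \<Rightarrow> real \<Rightarrow> real \<Rightarrow> bool" where
  "weight_jet K \<kappa> s d1 d2 \<longleftrightarrow>
     (\<exists>V. open V \<and> s \<in> V \<and> (\<forall>r\<in>K \<inter> V. (weight_along A \<psi> K \<kappa> has_vector_derivative
            vector_derivative (weight_along A \<psi> K \<kappa>) (at r within K)) (at r within K))) \<and>
       vector_derivative (weight_along A \<psi> K \<kappa>) (at s within K) = d1 \<and>
       ((\<lambda>r. vector_derivative (weight_along A \<psi> K \<kappa>) (at r within K)) has_vector_derivative d2) (at s within K)"

text \<open>By the geodesic equation the derivatives of the weight are functions of the tangent vector, so that
  the arbitrary choice made in \<open>geodesic_from\<close> is harmless.\<close>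

lemma weight_derivatives:
  assumes c: "c \<in> A" and z0: "z0 \<in> weight_dom c" "in_chart A c L z0 < 0"
  obtains d1 d2 where
    "\<And>K \<kappa> s. causal_geodesic A L X K \<kappa> \<Longrightarrow> s \<in> K \<Longrightarrow> \<kappa> s \<in> chart_dom c \<Longrightarrow> chart_lift c K \<kappa> s = z0 \<Longrightarrow>
       weight_jet K \<kappa> s d1 d2"
proof -
  interpret C: finsler_chart "in_chart A c L" "chart_img c" by (rule finsler_chart_in_chart[OF c])
  from smooth_on_weight[OF c, unfolded smooth_on_def2, rule_format, OF z0(1)]
  obtain V0 f where V0: "open V0" "z0 \<in> V0" and f: "Cinf_on V0 f"
    and fe: "\<forall>y\<in>weight_dom c \<inter> V0. f y = in_chart A c \<psi> y" by blast
  have z0W: "z0 \<in> C.W"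
  proof -
    obtain x u where xu: "z0 = (x, u)" by (cases z0)
    have x: "x \<in> chart_img c" "vec_of_chart A c (chart_inv c x) u \<noteq> 0" using z0(1) xu by (auto simp: weight_dom_def)
    then have "u \<noteq> 0" using vec_of_chart_eq_0_iff[OF c chart_inv_dom[OF c x(1)]] by blast
    with x xu show ?thesis by (simp add: C.W_iff)
  qed
  \<comment> \<open>Timelike lifts of future-directed geodesics lie in \<open>weight_dom c\<close>,
    so on this neighbourhood the extension \<open>f\<close> may replace the weight along every such
    geodesic.\<close>
  define V1 where "V1 = V0 \<inter> (C.W \<inter> in_chart A c L -` {..<0})"
  have oV1: "open V1" unfolding V1_def
    by (intro open_Int V0(1) continuous_open_preimage[OF Cinf_on_continuous_on[OF C.smooth_L] C.W]) simp
  have z0V1: "z0 \<in> V1" using V0 z0W z0(2) by (simp add: V1_def)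
  have fV1: "Cinf_on V1 f" using f by (rule Cinf_on_subset) (simp add: V1_def)
  let ?F = "C.geodesic_field"
  \<comment> \<open>The derivative of the weight along the geodesic flow; the same operator applied
    to \<open>h\<close> gives the second derivative.\<close>
  define h where "h z = frechet_derivative f (at z) (?F z)" for z
  have hsum: "h z = (\<Sum>b\<in>Basis. (?F z \<bullet> b) * frechet_derivative f (at z) b)" if z: "z \<in> V1" for z
  proof -
    interpret D: linear "frechet_derivative f (at z)"
      by (rule linear_frechet_derivative[OF Cinf_on_differentiable[OF fV1 z]])
    have "h z = frechet_derivative f (at z) (\<Sum>b\<in>Basis. (?F z \<bullet> b) *\<^sub>R b)"
      by (simp add: h_def euclidean_representation)
    then show ?thesis by (simp only: D.sum D.scaleR real_scaleR_def)
  qed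
  have FV1: "Cinf_on V1 ?F"
    using C.Cinf_geodesic_field by (rule Cinf_on_subset) (auto simp: V1_def)
  have "Cinf_on V1 (\<lambda>z. \<Sum>b\<in>Basis. (?F z \<bullet> b) * frechet_derivative f (at z) b)"
    by (intro Cinf_on_sum Cinf_on_mult Cinf_on_inner Cinf_on_frechet_derivative Cinf_on_const oV1 fV1 FV1)
  then have hV1: "Cinf_on V1 h"
    by (rule Cinf_on_cong[OF oV1, THEN iffD2, rotated]) (rule hsum)
  show thesis
  proof (rule that[of "h z0" "frechet_derivative h (at z0) (?F z0)"])
    fix K \<kappa> s assume geo: "causal_geodesic A L X K \<kappa>" and s: "s \<in> K" "\<kappa> s \<in> chart_dom c"
      and zs: "chart_lift c K \<kappa> s = z0"
    have k: "nondeg_interval K" "smooth_curve A K \<kappa>" using geo by (auto simp: causal_geodesic_def)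
    obtain U where U: "s \<in> U" "param_nbhd K \<kappa> c U" using param_nbhd_exists[OF k(2) c s] .
    have oU: "open U" using U(2) by (simp add: param_nbhd_def)
    let ?z = "chart_lift c K \<kappa>" and ?w = "weight_along A \<psi> K \<kappa>"
    have "continuous_on (K \<inter> U) ?z" by (rule smooth_on_continuous_on[OF smooth_on_chart_lift[OF k c U(2)]])
    from this[unfolded continuous_on_open_invariant, rule_format, OF oV1]
    obtain V' where V': "open V'" "V' \<inter> (K \<inter> U) = ?z -` V1 \<inter> (K \<inter> U)" by blast
    define V where "V = U \<inter> V'"
    have V: "open V" "s \<in> V" "V \<subseteq> U"
      using oU V' s U(1) z0V1 zs by (auto simp: V_def)
    have zV1: "?z r \<in> V1" if "r \<in> K \<inter> V" for r using that V'(2) by (auto simp: V_def)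
    have rU: "r \<in> K \<inter> U" if "r \<in> K \<inter> V" for r using that V(3) by blast
    have dom: "\<kappa> r \<in> chart_dom c" if "r \<in> K \<inter> V" for r
      using rU[OF that] U(2) by (auto simp: param_nbhd_def)
    have chain: "((\<lambda>r. G (?z r)) has_vector_derivative frechet_derivative G (at (?z r)) (?F (?z r))) (at r within K)"
      if "Cinf_on V1 G" "r \<in> K \<inter> V" for G :: "'n coord \<times> 'n coord \<Rightarrow> real" and r
      using vector_derivative_diff_chain_within[OF geodesic_lift_derivative[OF geo c U(2) rU[OF that(2)]]
          has_derivative_at_withinI[OF Cinf_on_has_derivative[OF that(1) zV1[OF that(2)]]]]
      by (simp add: o_def)
    have w: "f (?z r) = ?w r" if "r \<in> K \<inter> V" for r
    proof -
      have neg: "in_chart A c L (?z r) < 0" using zV1[OF that] by (simp add: V1_def)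
      have rK: "r \<in> K" using that by simp
      have "f (?z r) = in_chart A c \<psi> (?z r)"
        using fe lift_weight_dom(1)[OF geo c rK dom[OF that] neg] zV1[OF that] by (simp add: V1_def)
      then show ?thesis using lift_weight_dom(2)[OF geo c rK dom[OF that] neg] by simp
    qed
    have dw: "(?w has_vector_derivative h (?z r)) (at r within K)" if r: "r \<in> K \<inter> V" for r
      unfolding h_def
      by (rule has_vector_derivative_cong_open[OF chain[OF fV1 r] V(1)]) (use r w in auto)
    have vd: "vector_derivative ?w (at r within K) = h (?z r)" if r: "r \<in> K \<inter> V" for r
      using vector_derivative_within[OF nondeg_interval_at_within_neq_bot[OF k(1)] dw[OF r]] r by blast
    have sV: "s \<in> K \<inter> V" using s V by simp
    have "((\<lambda>r. vector_derivative ?w (at r within K)) has_vector_derivative frechet_derivative h (at z0) (?F z0)) (at s within K)"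
      using has_vector_derivative_cong_open[OF chain[OF hV1 sV] V(1) s(1) V(2)] vd unfolding zs by force
    moreover have "\<forall>r\<in>K \<inter> V. (?w has_vector_derivative vector_derivative ?w (at r within K)) (at r within K)"
      using dw vd by simp
    ultimately show "weight_jet K \<kappa> s (h z0) (frechet_derivative h (at z0) (?F z0))"
      unfolding weight_jet_def
      using V vd[OF sV] zs by auto
  qed
qed

end

section \<open>Affine reparametrisation of the geodesic\<close>

lemma has_vector_derivative_affine:
  fixes F :: "real \<Rightarrow> 'b::real_normed_vector"
  assumes F: "(F has_vector_derivative F') (at (t + f * s) within I)"
  shows "((\<lambda>s. F (t + f * s)) has_vector_derivative f *\<^sub>R F') (at s within (\<lambda>s. t + f * s) -` I)"
proof -
  have a: "((\<lambda>s. t + f * s) has_vector_derivative f) (at s within (\<lambda>s. t + f * s) -` I)"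
    by (auto intro!: derivative_eq_intros simp: has_real_derivative_iff_has_vector_derivative[symmetric])
  have "(F has_vector_derivative F') (at (t + f * s) within (\<lambda>s. t + f * s) ` ((\<lambda>s. t + f * s) -` I))"
    using F by (rule has_vector_derivative_within_subset) auto
  from vector_diff_chain_within[OF a this] show ?thesis by (simp add: o_def)
qed

lemma nondeg_interval_affine:
  assumes I: "nondeg_interval I" and f: "f > (0::real)"
  shows "nondeg_interval ((\<lambda>s. t + f * s) -` I)"
proof -
  let ?h = "\<lambda>s. t + f * s"
  have "is_interval (?h -` I)"
    unfolding is_interval_1
  proof (intro ballI allI impI)
    fix a b x assume ab: "a \<in> ?h -` I" "b \<in> ?h -` I" and x: "a \<le> x \<and> x \<le> b"
    have "?h a \<le> ?h x" "?h x \<le> ?h b" using f x by simp_all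
    then show "x \<in> ?h -` I"
      using I ab unfolding nondeg_interval_def is_interval_1 by (metis vimage_eq)
  qed
  moreover have "interior (?h -` I) \<noteq> {}"
  proof -
    obtain y where y: "y \<in> interior I" using I by (auto simp: nondeg_interval_def)
    have "open (?h -` interior I)"
      by (rule open_vimage[OF open_interior]) (intro continuous_intros)
    moreover have "?h -` interior I \<subseteq> ?h -` I" using interior_subset by auto
    ultimately have "?h -` interior I \<subseteq> interior (?h -` I)" by (rule interior_maximal[rotated])
    moreover have "(y - t) / f \<in> ?h -` interior I" using y f by simp
    ultimately show ?thesis by blast
  qed
  ultimately show ?thesis by (simp add: nondeg_interval_def)
qed

text \<open>The curve \<open>\<sigma>\<close> introduced below is a geodesic through the point of
  parameter \<open>t0\<close> whose initial velocity is \<open>f\<close> times that of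
  \<open>\<eta>\<close>, as needed to evaluate \<open>Ric_N\<close> at the rescaled vector.\<close>

locale weighted_geodesic = unit_geodesic A L X I \<eta> + weighted_atlas A L X \<psi>
  for A :: "('a::{t2_space,second_countable_topology}, 'n::finite) chart set"
    and L :: "'a \<Rightarrow> 'n coord \<Rightarrow> real" and X :: "'a \<Rightarrow> 'n coord" and I :: "real set" and \<eta> :: "real \<Rightarrow> 'a"
    and \<psi> :: "'a \<Rightarrow> 'n coord \<Rightarrow> real" +
  fixes t0 f :: real
  assumes t0: "t0 \<in> I" and f: "f > 0"
begin

abbreviation "h s \<equiv> t0 + f * s"
abbreviation "K \<equiv> h -` I"
abbreviation "\<sigma> s \<equiv> \<eta> (h s)"

lemma nondeg_K: "nondeg_interval K" by (rule nondeg_interval_affine[OF nondeg f])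

lemma Cinf_h: "Cinf_on UNIV h"
  by (intro Cinf_on_add Cinf_on_const Cinf_on_bounded_linear bounded_linear_mult_right open_UNIV)

lemma smooth_curve_sigma: "smooth_curve A K \<sigma>"
  unfolding smooth_curve_def
proof (intro conjI ballI)
  have c: "continuous_on I \<eta>" using curve by (simp add: smooth_curve_def)
  show "continuous_on K \<sigma>"
    by (rule continuous_on_compose2[OF c]) (auto intro!: continuous_intros)
  fix c assume "c \<in> A"
  then have "smooth_on {t \<in> I. \<eta> t \<in> chart_dom c} (chart_map c \<circ> \<eta>)"
    using curve by (simp add: smooth_curve_def)
  from smooth_on_precompose[OF this Cinf_h]
  show "smooth_on {s \<in> K. \<sigma> s \<in> chart_dom c} (chart_map c \<circ> \<sigma>)"
    by (simp add: o_def vimage_def)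
qed

lemma chart_vel_sigma:
  assumes c: "c \<in> A" and s: "s \<in> K" "\<sigma> s \<in> chart_dom c"
  shows "chart_vel c K \<sigma> s = f *\<^sub>R chart_vel c I \<eta> (h s)"
proof -
  have hs: "h s \<in> I" using s by simp
  obtain U where U: "h s \<in> U" "param_nbhd I \<eta> c U" using param_nbhd_exists[OF curve c hs s(2)] .
  from has_vector_derivative_affine[OF chart_curve_has_vector_derivative[OF nondeg curve c U(2) IntI[OF hs U(1)]]]
  have "((\<lambda>s. chart_map c (\<sigma> s)) has_vector_derivative f *\<^sub>R chart_vel c I \<eta> (h s)) (at s within K)" .
  from vector_derivative_within[OF nondeg_interval_at_within_neq_bot[OF nondeg_K s(1)] this]
  show ?thesis by (simp add: chart_vel_def o_def)
qed

lemma velocity_sigma: "s \<in> K \<Longrightarrow> velocity A K \<sigma> s = f *\<^sub>R velocity A I \<eta> (h s)"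
  unfolding velocity_def by (rule chart_vel_sigma[OF ref_chart(1) _ ref_chart(2)])

lemma L_scale: "r > 0 \<Longrightarrow> L p (r *\<^sub>R v) = r\<^sup>2 * L p v"
  using finsler unfolding lorentz_finsler_def by blast

text \<open>The open ray through \<open>v\<close> is connected and consists of timelike
  vectors.\<close>

lemma future_causal_scale:
  assumes v: "future_causal L X p v" "L p v < 0" and r: "r > 0"
  shows "future_causal L X p (r *\<^sub>R v)"
proof -
  let ?S = "closure {w. timelike L p w} - {0}"
  have neg: "L p (q *\<^sub>R v) < 0" if "q > 0" for q
    using L_scale[OF that] v(2) that by (simp add: mult_pos_neg)
  have inS: "q *\<^sub>R v \<in> ?S" if "q > 0" for q
  proof -
    have "q *\<^sub>R v \<noteq> 0" using neg[OF that] L_zero by force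
    moreover have "q *\<^sub>R v \<in> closure {w. timelike L p w}"
      using neg[OF that] closure_subset by (force simp: timelike_def)
    ultimately show ?thesis by simp
  qed
  have "connected_component ?S v (r *\<^sub>R v)"
    unfolding connected_component_def
  proof (intro exI conjI)
    show "connected ((\<lambda>q. q *\<^sub>R v) ` {0<..})"
      by (intro connected_continuous_image continuous_intros) (simp add: convex_connected)
    show "(\<lambda>q. q *\<^sub>R v) ` {0<..} \<subseteq> ?S" using inS by auto
    show "v \<in> (\<lambda>q. q *\<^sub>R v) ` {0<..}" by (rule image_eqI[of _ _ 1]) auto
    show "r *\<^sub>R v \<in> (\<lambda>q. q *\<^sub>R v) ` {0<..}" using r by auto
  qed
  moreover have "connected_component ?S (X p) v" using v(1) by (simp add: future_causal_def)
  ultimately have "connected_component ?S (X p) (r *\<^sub>R v)" by (rule connected_component_trans[rotated])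
  then show ?thesis using neg[OF r] by (simp add: future_causal_def causal_def timelike_def)
qed

text \<open>The reparametrisation multiplies velocities by \<open>f\<close> and accelerations by
  f^2, and the spray has degree 2.\<close>

lemma causal_geodesic_sigma: "causal_geodesic A L X K \<sigma>"
  unfolding causal_geodesic_def
proof (intro conjI ballI impI allI nondeg_K smooth_curve_sigma)
  fix s assume s: "s \<in> K"
  have hs: "h s \<in> I" using s by simp
  have "future_causal L X (\<sigma> s) (velocity A I \<eta> (h s))" using causal hs by (simp add: causal_geodesic_def)
  then show "future_causal L X (\<sigma> s) (velocity A K \<sigma> s)"
    unfolding velocity_sigma[OF s] by (rule future_causal_scale) (use L_velocity[OF hs] f in auto)
next
  fix c s a assume c: "c \<in> A" and s: "s \<in> K" "\<sigma> s \<in> chart_dom c"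
  have hs: "h s \<in> I" using s by simp
  interpret C: finsler_chart "in_chart A c L" "chart_img c" by (rule finsler_chart_in_chart[OF c])
  obtain U where U: "h s \<in> U" "param_nbhd I \<eta> c U" using param_nbhd_exists[OF curve c hs s(2)] .
  have hsU: "h s \<in> I \<inter> U" using hs U by simp
  let ?v = "chart_vel c I \<eta>" and ?z = "chart_lift c I \<eta> (h s)"
  have "(?v has_vector_derivative snd (C.geodesic_field ?z)) (at (h s) within I)"
    using chart_vel_has_vector_derivative[OF nondeg curve c U(2) hsU] geodesic_vel_derivative[OF causal c U(2) hsU] by metis
  from has_vector_derivative_affine[OF bounded_linear.has_vector_derivative[OF bounded_linear_scaleR_right this]]
  have d: "((\<lambda>s. f *\<^sub>R ?v (h s)) has_vector_derivative f *\<^sub>R f *\<^sub>R snd (C.geodesic_field ?z)) (at s within K)" .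
  have "open (h -` U)"
    by (rule open_vimage) (use U(2) in \<open>auto simp: param_nbhd_def intro!: continuous_intros\<close>)
  with d have "(chart_vel c K \<sigma> has_vector_derivative f *\<^sub>R f *\<^sub>R snd (C.geodesic_field ?z)) (at s within K)"
    by (rule has_vector_derivative_cong_open)
      (use s U chart_vel_sigma[OF c] in \<open>auto simp: param_nbhd_def\<close>)
  from vector_derivative_within[OF nondeg_interval_at_within_neq_bot[OF nondeg_K s(1)] this]
  have e: "vector_derivative (chart_vel c K \<sigma>) (at s within K) = f *\<^sub>R f *\<^sub>R snd (C.geodesic_field ?z)" .
  have "?v (h s) \<noteq> 0"
    by (rule chart_vel_nonzero[OF nondeg curve c hs s(2)]) (simp add: L_velocity[OF hs])
  then have W: "(chart_map c (\<sigma> s), ?v (h s)) \<in> C.W" using s(2) by (simp add: C.W_iff chart_map_img)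
  show "vector_derivative (chart_vel c K \<sigma>) (at s within K) $ a + 2 * spray (in_chart A c L) a (chart_lift c K \<sigma> s) = 0"
    unfolding e using C.homogeneousD[OF C.homogeneous_spray W f, of a]
    by (simp add: C.geodesic_field_def chart_lift_def chart_vel_sigma[OF c s] power2_eq_square)
qed

lemma weight_along_sigma: "s \<in> K \<Longrightarrow> weight_along A \<psi> K \<sigma> s = weight_along A \<psi> I \<eta> (h s)"
proof -
  assume s: "s \<in> K"
  have hs: "h s \<in> I" using s by simp
  have "velocity A I \<eta> (h s) \<in> closure (future_cone L X (\<sigma> s)) - {0}"
    using causal hs L_velocity[OF hs] by (intro future_cone_closure) (auto simp: causal_geodesic_def)
  then have "\<psi> (\<sigma> s) (f *\<^sub>R velocity A I \<eta> (h s)) = \<psi> (\<sigma> s) (velocity A I \<eta> (h s))"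
    using weighted f unfolding weighted_finsler_spacetime_def by blast
  then show ?thesis by (simp add: weight_along_def velocity_sigma[OF s])
qed

text \<open>Three geodesics are compared: \<open>\<eta>\<close>, its reparametrisation
  \<open>\<sigma>\<close>, and the one picked by \<open>geodesic_from\<close>. The last two share
  their tangent vector at 0 and hence the derivatives of the weight; the chain rule relates the
  first two and produces \<open>f\<close> and f^2.\<close>

lemma weight_along_derivatives:
  obtains V b' where "open V" "t0 \<in> V"
    "\<And>r. r \<in> I \<inter> V \<Longrightarrow> (weight_along A \<psi> I \<eta> has_vector_derivative
       vector_derivative (weight_along A \<psi> I \<eta>) (at r within I)) (at r within I)"
    "((\<lambda>r. vector_derivative (weight_along A \<psi> I \<eta>) (at r within I)) has_vector_derivative b') (at t0 within I)"
    "weight_d1 A L X \<psi> (\<eta> t0) (f *\<^sub>R velocity A I \<eta> t0) =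
       f * vector_derivative (weight_along A \<psi> I \<eta>) (at t0 within I)"
    "weight_d2 A L X \<psi> (\<eta> t0) (f *\<^sub>R velocity A I \<eta> t0) = f\<^sup>2 * b'"
proof -
  let ?c = "ref_chart A (\<eta> t0)" and ?w = "weight_along A \<psi> I \<eta>" and ?p = "\<eta> t0"
  let ?v = "f *\<^sub>R velocity A I \<eta> t0"
  note c = ref_chart[of ?p]
  have at_p: "chart_lift ?c K' \<kappa> s = (chart_map ?c ?p, velocity A K' \<kappa> s)" if "\<kappa> s = ?p" for K' \<kappa> s
    using that by (simp add: chart_lift_def velocity_def)
  have wd: "chart_lift ?c K' \<kappa> s \<in> weight_dom ?c" "in_chart A ?c L (chart_lift ?c K' \<kappa> s) < 0"
    if k: "causal_geodesic A L X K' \<kappa>" "s \<in> K'" "\<kappa> s = ?p" "L ?p (velocity A K' \<kappa> s) < 0" for K' \<kappa> s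
  proof -
    have k': "nondeg_interval K'" "smooth_curve A K' \<kappa>" using k(1) by (auto simp: causal_geodesic_def)
    have d: "\<kappa> s \<in> chart_dom ?c" using c(2) k(3) by simp
    show n: "in_chart A ?c L (chart_lift ?c K' \<kappa> s) < 0"
      using in_chart_lift[OF k' c(1) k(2) d] k(3,4) by simp
    show "chart_lift ?c K' \<kappa> s \<in> weight_dom ?c"
      by (rule lift_weight_dom(1)[OF k(1) c(1) k(2) d n])
  qed
  have K0: "0 \<in> K" using t0 by simp
  have v0: "velocity A K \<sigma> 0 = ?v" using velocity_sigma[OF K0] by simp
  have Lv: "L ?p ?v < 0" using L_scale[OF f] L_velocity[OF t0] f by simp
  \<comment> \<open>Applied to \<open>\<eta>\<close> itself, only to secure that the weight along it
    has the derivatives to which the chain rule will refer.\<close>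
  obtain e1 e2 where e: "\<And>K \<kappa> s. causal_geodesic A L X K \<kappa> \<Longrightarrow> s \<in> K \<Longrightarrow> \<kappa> s \<in> chart_dom ?c \<Longrightarrow> chart_lift ?c K \<kappa> s = chart_lift ?c I \<eta> t0 \<Longrightarrow>
       weight_jet K \<kappa> s e1 e2"
    using weight_derivatives[OF c(1) wd[OF causal t0 refl]] L_velocity[OF t0] by auto
  from e[OF causal t0 c(2) refl, unfolded weight_jet_def] obtain V where V: "open V" "t0 \<in> V"
      "\<And>r. r \<in> I \<inter> V \<Longrightarrow> (?w has_vector_derivative vector_derivative ?w (at r within I)) (at r within I)"
    and w2: "((\<lambda>r. vector_derivative ?w (at r within I)) has_vector_derivative e2) (at t0 within I)"
    by blast
  let ?z0 = "chart_lift ?c K \<sigma> 0"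
  have p0: "\<sigma> 0 = ?p" by simp
  have z0: "?z0 = (chart_map ?c ?p, ?v)" using at_p[of \<sigma> 0 K] v0 by simp
  obtain d1 d2 where d: "\<And>K \<kappa> s. causal_geodesic A L X K \<kappa> \<Longrightarrow> s \<in> K \<Longrightarrow> \<kappa> s \<in> chart_dom ?c \<Longrightarrow> chart_lift ?c K \<kappa> s = ?z0 \<Longrightarrow>
       weight_jet K \<kappa> s d1 d2"
    using weight_derivatives[OF c(1) wd[OF causal_geodesic_sigma K0 p0]] Lv v0 by auto
  have ds: "vector_derivative (weight_along A \<psi> K \<sigma>) (at 0 within K) = d1"
      "((\<lambda>r. vector_derivative (weight_along A \<psi> K \<sigma>) (at r within K)) has_vector_derivative d2) (at 0 within K)"
    using d[OF causal_geodesic_sigma K0 _ refl] c(2) by (auto simp: weight_jet_def)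
  have sw: "vector_derivative (weight_along A \<psi> K \<sigma>) (at s within K) = f * vector_derivative ?w (at (h s) within I)"
    if s: "s \<in> K" "h s \<in> V" for s
  proof -
    have "h s \<in> I \<inter> V" using s by simp
    from has_vector_derivative_affine[OF V(3)[OF this]]
    have "((\<lambda>s. ?w (h s)) has_vector_derivative f * vector_derivative ?w (at (h s) within I)) (at s within K)" by simp
    then have "(weight_along A \<psi> K \<sigma> has_vector_derivative f * vector_derivative ?w (at (h s) within I)) (at s within K)"
      by (rule has_vector_derivative_transform[rotated 2]) (use s weight_along_sigma in auto)
    then show ?thesis by (rule vector_derivative_within[OF nondeg_interval_at_within_neq_bot[OF nondeg_K s(1)]])
  qed
  have 1: "d1 = f * vector_derivative ?w (at t0 within I)" using sw[OF K0] V(2) ds(1) by simp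
  have "((\<lambda>r. vector_derivative ?w (at r within I)) has_vector_derivative e2) (at (h 0) within I)" using w2 by simp
  from has_vector_derivative_affine[OF bounded_linear.has_vector_derivative[OF bounded_linear_mult_right this, of f]]
  have d': "((\<lambda>s. f * vector_derivative ?w (at (h s) within I)) has_vector_derivative f *\<^sub>R (f * e2)) (at 0 within K)" .
  have oV: "open (h -` V)" by (rule open_vimage[OF V(1)]) (intro continuous_intros)
  have "((\<lambda>s. vector_derivative (weight_along A \<psi> K \<sigma>) (at s within K)) has_vector_derivative f *\<^sub>R (f * e2)) (at 0 within K)"
    by (rule has_vector_derivative_cong_open[OF d' oV K0]) (use V(2) sw in auto)
  from vector_derivative_unique_within[OF nondeg_interval_at_within_neq_bot[OF nondeg_K K0] ds(2) this]
  have 2: "d2 = f\<^sup>2 * e2" by (simp add: power2_eq_square)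
  let ?Q = "\<lambda>(I, \<eta>). 0 \<in> I \<and> causal_geodesic A L X I \<eta> \<and> \<eta> 0 = ?p \<and> velocity A I \<eta> 0 = ?v"
  \<comment> \<open>\<open>\<sigma>\<close> witnesses that \<open>geodesic_from\<close> chooses from
    a nonempty set.\<close>
  have "?Q (K, \<sigma>)" using K0 causal_geodesic_sigma v0 by simp
  then have "?Q (geodesic_from A L X ?p ?v)" unfolding geodesic_from_def by (rule someI[of ?Q])
  then obtain K' \<kappa> where G: "geodesic_from A L X ?p ?v = (K', \<kappa>)" and k: "0 \<in> K'" "causal_geodesic A L X K' \<kappa>"
      "\<kappa> 0 = ?p" "velocity A K' \<kappa> 0 = ?v"
    by (cases "geodesic_from A L X ?p ?v") auto
  have dk: "vector_derivative (weight_along A \<psi> K' \<kappa>) (at 0 within K') = d1"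
      "((\<lambda>r. vector_derivative (weight_along A \<psi> K' \<kappa>) (at r within K')) has_vector_derivative d2) (at 0 within K')"
    using d[OF k(2,1)] c(2) at_p[where \<kappa> = \<kappa> and s = 0 and K' = K', OF k(3)] k(3,4) z0
    by (auto simp: weight_jet_def)
  have k': "nondeg_interval K'" using k(2) by (simp add: causal_geodesic_def)
  show thesis
  proof (rule that[OF V w2])
    show "weight_d1 A L X \<psi> ?p ?v = f * vector_derivative ?w (at t0 within I)"
      by (simp add: weight_d1_def G dk(1) 1)
    show "weight_d2 A L X \<psi> ?p ?v = f\<^sup>2 * e2"
      using vector_derivative_within[OF nondeg_interval_at_within_neq_bot[OF k' k(1)] dk(2)]
      by (simp add: weight_d2_def G 2)
  qed
qed

lemma Ric_scale: "Ric A L (\<eta> t0) (f *\<^sub>R velocity A I \<eta> t0) = f\<^sup>2 * Ric A L (\<eta> t0) (velocity A I \<eta> t0)"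
proof -
  let ?c = "ref_chart A (\<eta> t0)"
  note c = ref_chart[of "\<eta> t0"]
  interpret C: finsler_chart "in_chart A ?c L" "chart_img ?c" by (rule finsler_chart_in_chart[OF c(1)])
  have "velocity A I \<eta> t0 \<noteq> 0" using L_velocity[OF t0] L_zero by force
  then have "(chart_map ?c (\<eta> t0), velocity A I \<eta> t0) \<in> C.W" using c(2) by (simp add: C.W_iff chart_map_img)
  then show ?thesis by (simp add: Ric_def Let_def C.curv_scaleR f trace_scaleR)
qed

end

section \<open>The algebra of the weighted Ricci curvature\<close>

text \<open>The difference of the two sides is \<open>(b + \<epsilon> a (r - n) / r)\<^sup>2\<close> times \<open>r / (n (r - n))\<close>.\<close>

lemma weighted_square:
  fixes n r a b \<epsilon> :: real
  assumes n: "n > 0" and r: "r < 0 \<or> n < r"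
  shows "2 * (1 - \<epsilon>) / n * b * a + 1 / n * (1 - \<epsilon>\<^sup>2 * ((r - n) / r)) * a\<^sup>2 - (a + b)\<^sup>2 / n \<le> b\<^sup>2 / (r - n)"
proof -
  define q where "q = (r - n) / r"
  have r0: "r \<noteq> 0" "r - n \<noteq> 0" using n r by auto
  have q: "q > 0" using n r by (auto simp: q_def divide_neg_neg)
  have "b\<^sup>2 / (r - n) + b\<^sup>2 / n = b\<^sup>2 / (n * q)"
    using r0 n by (simp add: q_def field_simps)
  then have "b\<^sup>2 / (r - n) - (2 * (1 - \<epsilon>) / n * b * a + 1 / n * (1 - \<epsilon>\<^sup>2 * q) * a\<^sup>2 - (a + b)\<^sup>2 / n)
      = b\<^sup>2 / (n * q) + 2 * \<epsilon> * a * b / n + \<epsilon>\<^sup>2 * q * a\<^sup>2 / n"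
    using n by (simp add: power2_sum add_divide_distrib diff_divide_distrib algebra_simps)
  also have "\<dots> = (b + \<epsilon> * a * q)\<^sup>2 / (n * q)"
    using n q by (simp add: field_simps power2_eq_square)
  also have "\<dots> \<ge> 0" using n q by simp
  finally show ?thesis unfolding q_def by simp
qed

text \<open>For finite \<open>N\<close> other than 0 and n the admissible range of \<epsilon> is
  exactly \<epsilon>^2 (N - n) / N < 1. At N = n this product vanishes for every \<epsilon>.\<close>

lemma c_const_pos:
  assumes n: "n > 0" and N: "- \<infinity> < N \<and> N \<le> 0 \<or> ereal n \<le> N" and \<epsilon>: "epsilon_range n N \<epsilon>"
  shows "c_const n N \<epsilon> > 0"
proof (cases N)
  case (real r)
  then have r: "r \<le> 0 \<or> n \<le> r" using N by auto
  consider "r = 0" | "r = n" | "r \<noteq> 0" "r \<noteq> n" by blast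
  then show ?thesis
  proof cases
    case 3
    then have q: "r / (r - n) > 0" using r n by (auto intro: divide_neg_neg)
    have "\<bar>\<epsilon>\<bar> < sqrt (r / (r - n))" using \<epsilon> 3 real by (simp add: epsilon_range_def)
    then have "\<epsilon>\<^sup>2 < r / (r - n)"
      using real_less_rsqrt[of "\<bar>\<epsilon>\<bar>"] q by (metis abs_ge_zero power2_abs real_sqrt_abs real_sqrt_less_iff)
    then have "\<epsilon>\<^sup>2 * ((r - n) / r) < r / (r - n) * ((r - n) / r)"
      by (intro mult_strict_right_mono) (use q in \<open>auto simp: zero_less_divide_iff\<close>)
    also have "\<dots> = 1" using 3 by simp
    finally show ?thesis using 3 n real by (simp add: c_const_def)
  qed (use n real in \<open>auto simp: c_const_def\<close>)
next
  case PInf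
  then have "\<bar>\<epsilon>\<bar> < 1" using \<epsilon> by (simp add: epsilon_range_def)
  then have "\<epsilon>\<^sup>2 < 1" by (simp add: abs_square_less_1)
  then show ?thesis using PInf n by (simp add: c_const_def)
qed (use N in auto)

text \<open>Intended values: \<open>b\<close> is \<psi>', \<open>a\<close> is \<theta> - \<psi>',
  \<open>d\<close> is its derivative, \<open>k\<close> is dt/d\<tau> and \<open>\<rho>\<close> is c
  \<xi>. Each case of \<open>N\<close> comes down to a quadratic form in \<open>a\<close> and
  \<open>b\<close> being at most the term that \<open>Ric_N\<close> subtracts.\<close>

lemma ricci_bound:
  fixes n a b b' k \<rho> R d :: real and N :: ereal
  assumes n: "n = real CARD('n::finite)" and N: "- \<infinity> < N \<and> N \<le> 0 \<or> ereal n \<le> N"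
    and \<epsilon>: "epsilon_range n N \<epsilon>" and k: "k > 0" and \<rho>: "\<rho> > 0"
    and d: "d \<le> - R - (a + b)\<^sup>2 / n - b'"
    and Ric: "Ric A L p w = k\<^sup>2 * R" "weight_d1 A L X \<psi> p w = k * b" "weight_d2 A L X \<psi> p w = k\<^sup>2 * b'"
  shows "ereal (\<rho> * (k\<^sup>2 * (2 * (1 - \<epsilon>) / n * b * a + c_const n N \<epsilon> * a\<^sup>2 + d))) \<le>
     - (ereal \<rho> * Ric_N A L X \<psi> N p (w :: 'n coord))"
proof -
  let ?T = "2 * (1 - \<epsilon>) / n * b * a + c_const n N \<epsilon> * a\<^sup>2 + d"
  have n0: "n > 0" using n by simp
  have fin: ?thesis
    if R: "Ric_N A L X \<psi> N p w = ereal (k\<^sup>2 * (R + b' - e))"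
      and e: "2 * (1 - \<epsilon>) / n * b * a + c_const n N \<epsilon> * a\<^sup>2 - (a + b)\<^sup>2 / n \<le> e" for e
  proof -
    have "?T \<le> - (R + b' - e)" using d e by simp
    then have "\<rho> * (k\<^sup>2 * ?T) \<le> \<rho> * (k\<^sup>2 * - (R + b' - e))"
      using \<rho> by (intro mult_left_mono) auto
    then show ?thesis
      unfolding R by (simp only: mult_minus_right uminus_ereal.simps times_ereal.simps ereal_less_eq)
  qed
  \<comment> \<open>For N = +infinity nothing is subtracted, and the form is minus a square.\<close>
  have inf: ?thesis if "c_const n N \<epsilon> = (1 - \<epsilon>\<^sup>2) / n" "Ric_N A L X \<psi> N p w = ereal (k\<^sup>2 * (R + b' - 0))"
  proof (rule fin[OF that(2)])
    have "2 * (1 - \<epsilon>) / n * b * a + c_const n N \<epsilon> * a\<^sup>2 - (a + b)\<^sup>2 / n = - ((b + \<epsilon> * a)\<^sup>2 / n)"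
      using n0 by (simp add: that(1) field_simps power2_eq_square)
    also have "\<dots> \<le> 0" using n0 by simp
    finally show "2 * (1 - \<epsilon>) / n * b * a + c_const n N \<epsilon> * a\<^sup>2 - (a + b)\<^sup>2 / n \<le> 0" .
  qed
  show ?thesis
  proof (cases N)
    case (real r)
    then have r: "r \<le> 0 \<or> n \<le> r" using N by auto
    show ?thesis
    proof (cases "r = n")
      case rn: True
      show ?thesis
      proof (cases "b = 0")
        case True
        show ?thesis
        proof (rule fin)
          show "Ric_N A L X \<psi> N p w = ereal (k\<^sup>2 * (R + b' - 0))"
            unfolding Ric_N_def using real rn True Ric n by (simp add: algebra_simps)
          show "2 * (1 - \<epsilon>) / n * b * a + c_const n N \<epsilon> * a\<^sup>2 - (a + b)\<^sup>2 / n \<le> 0"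
            using real rn True n0 by (simp add: c_const_def)
        qed
      next
        case False
        \<comment> \<open>The right side of the claim becomes plus infinity, so nothing has to be
          estimated.\<close>
        then have "Ric_N A L X \<psi> N p w = - \<infinity>"
          unfolding Ric_N_def using real rn Ric n k by simp
        then show ?thesis using \<rho> by simp
      qed
    next
      case False
      have RN: "Ric_N A L X \<psi> N p w = ereal (k\<^sup>2 * (R + b' - b\<^sup>2 / (r - n)))"
        unfolding Ric_N_def using real False Ric n by (simp add: algebra_simps power_mult_distrib)
      show ?thesis
      proof (rule fin[OF RN], cases "r = 0")
        case True
        \<comment> \<open>With these values the form equals - b^2 / n, which is the subtracted term
          for r = 0: equality holds.\<close>
        then have "\<epsilon> = 0" "c_const n N \<epsilon> = 1 / n" using \<epsilon> real by (auto simp: epsilon_range_def c_const_def)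
        then show "2 * (1 - \<epsilon>) / n * b * a + c_const n N \<epsilon> * a\<^sup>2 - (a + b)\<^sup>2 / n \<le> b\<^sup>2 / (r - n)"
          using True n0 by (simp add: field_simps power2_eq_square)
      next
        case r0: False
        then have "r < 0 \<or> n < r" using r False by auto
        from weighted_square[OF n0 this, of \<epsilon> b a] r0 real
        show "2 * (1 - \<epsilon>) / n * b * a + c_const n N \<epsilon> * a\<^sup>2 - (a + b)\<^sup>2 / n \<le> b\<^sup>2 / (r - n)"
          by (simp add: c_const_def)
      qed
    qed
  next
    case PInf
    then show ?thesis
      by (intro inf) (simp_all add: c_const_def Ric_N_def Ric algebra_simps)
  qed (use N in auto)
qed

theorem proposition5p14:
  fixes A :: "('a::{t2_space,second_countable_topology}, 'n::finite) chart set"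
    and L :: "'a \<Rightarrow> 'n coord \<Rightarrow> real"
    and X :: "'a \<Rightarrow> 'n coord"
    and \<psi> :: "'a \<Rightarrow> 'n coord \<Rightarrow> real"
    and I :: "real set"
    and \<eta> :: "real \<Rightarrow> 'a"
    and J :: "real \<Rightarrow> 'n coord \<Rightarrow> 'n coord"
    and n :: real
    and N :: ereal
    and \<epsilon> c :: real
    and \<xi> :: "real \<Rightarrow> real"
  assumes "weighted_finsler_spacetime A L X \<psi>"
    and "unit_timelike_geodesic A L X I \<eta>"
    and "lagrange_tensor A L I \<eta> J"
    and "nonsingular A L I \<eta> J"
    and "n = real CARD('n)"
    and "- \<infinity> < N \<and> N \<le> 0 \<or> ereal n \<le> N"
    and "epsilon_range n N \<epsilon>"
    and "c = c_const n N \<epsilon>"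
    and "\<xi> = (\<lambda>t. \<bar>endo_det (normal_fibre A L I \<eta> t) (weighted_tensor A I \<eta> \<psi> J t)\<bar> powr c)"
  shows "0 < c \<and>
    (\<forall>t\<in>I. ereal (proper_deriv A I \<eta> \<psi> \<epsilon> (proper_deriv A I \<eta> \<psi> \<epsilon> \<xi>) t)
       \<le> - (ereal (c * \<xi> t) * Ric_N A L X \<psi> N (\<eta> t) (proper_velocity A I \<eta> \<psi> \<epsilon> t)))"
proof (intro conjI ballI)
  have n0: "n > 0" using assms(5) by simp
  show c0: "0 < c" unfolding assms(8) by (rule c_const_pos[OF n0 assms(6,7)])
  fix t0 assume t0: "t0 \<in> I"
  let ?k = "proper_factor A I \<eta> \<psi> \<epsilon>"
  have fs: "finsler_spacetime A L X" using assms(1) by (simp add: weighted_finsler_spacetime_def)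
  \<comment> \<open>The factor dt/d\<tau> is frozen at \<open>t0\<close>, since only the single
    vector \<eta>^* at \<open>t0\<close> enters the right side.\<close>
  interpret weighted_geodesic A L X I \<eta> \<psi> t0 "?k t0"
    using assms(1,2) fs t0
    by unfold_locales (simp_all add: finsler_spacetime_def connected_manifold_def proper_factor_def)
  \<comment> \<open>In the reference chart of this point the chart components at \<open>t0\<close>
    are the stored components, which is how \<open>Ric\<close> reads them.\<close>
  let ?c = "ref_chart A (\<eta> t0)"
  obtain U where U: "t0 \<in> U" "param_nbhd I \<eta> ?c U" using param_nbhd_exists[OF curve ref_chart(1) t0 ref_chart(2)] .
  interpret Lag: lagrange_chart A L X I \<eta> ?c U J
    using assms(3,4) U(2) ref_chart by unfold_locales simp_all
  have t0U: "t0 \<in> I \<inter> U" using t0 U by simp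
  let ?w = "weight_along A \<psi> I \<eta>"
  obtain V b' where V: "open V" "t0 \<in> V"
    and w1: "\<And>r. r \<in> I \<inter> V \<Longrightarrow> (?w has_vector_derivative vector_derivative ?w (at r within I)) (at r within I)"
    and w2: "((\<lambda>r. vector_derivative ?w (at r within I)) has_vector_derivative b') (at t0 within I)"
    and d1: "weight_d1 A L X \<psi> (\<eta> t0) (?k t0 *\<^sub>R velocity A I \<eta> t0) = ?k t0 * vector_derivative ?w (at t0 within I)"
    and d2: "weight_d2 A L X \<psi> (\<eta> t0) (?k t0 *\<^sub>R velocity A I \<eta> t0) = (?k t0)\<^sup>2 * b'"
    by (rule weight_along_derivatives) (rule that)
  define \<theta> where "\<theta> s = trace (Lag.B s)" for s
  define \<phi> where "\<phi> r = vector_derivative ?w (at r within I)" for r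
  \<comment> \<open>\<xi> is exp (c l) and \<open>a\<close> is the derivative of \<open>l\<close>,
    so the real power of the determinant is never differentiated directly.\<close>
  define l where "l s = ln \<bar>det (Lag.Jm s)\<bar> - ?w s" for s
  define a where "a s = \<theta> s - \<phi> s" for s
  let ?m = "2 * (1 - \<epsilon>) / n"
  let ?UV = "U \<inter> V"
  have oUV: "open ?UV" and tUV: "t0 \<in> ?UV" using Lag.open_U V U by auto
  have \<xi>_eq: "\<xi> s = exp (c * l s)" if "s \<in> I" "s \<in> ?UV" for s
  proof -
    have nz: "det (Lag.Jm s) \<noteq> 0" using that by (intro Lag.det_Jm) auto
    have "\<xi> s = \<bar>exp (- ?w s) * det (Lag.Jm s)\<bar> powr c"
      unfolding assms(9) using that by (subst Lag.endo_det_weighted) auto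
    also have "\<dots> = exp (c * ln (exp (- ?w s) * \<bar>det (Lag.Jm s)\<bar>))"
      using nz by (simp add: powr_def abs_mult)
    also have "ln (exp (- ?w s) * \<bar>det (Lag.Jm s)\<bar>) = l s"
      using nz by (simp add: ln_mult l_def)
    finally show ?thesis .
  qed
  have l': "(l has_vector_derivative a s) (at s within I)" if s: "s \<in> I" "s \<in> ?UV" for s
  proof -
    have nz: "det (Lag.Jm s) \<noteq> 0" using s by (intro Lag.det_Jm) auto
    have "((\<lambda>s. det (Lag.Jm s)) has_real_derivative det (Lag.Jm s) * \<theta> s) (at s within I)"
      using Lag.det_derivative[of s] s by (simp add: has_real_derivative_iff_has_vector_derivative \<theta>_def)
    \<comment> \<open>Writing ln |x| as ln (x^2) / 2 treats both signs of the determinant at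
      once.\<close>
    then have "((\<lambda>s. ln ((det (Lag.Jm s))\<^sup>2) / 2) has_real_derivative \<theta> s) (at s within I)"
      using nz by (auto intro!: derivative_eq_intros simp: power2_eq_square linorder_neq_iff zero_less_mult_iff)
    moreover have "ln \<bar>x\<bar> = ln (x\<^sup>2) / 2" for x :: real
    proof (cases "x = 0")
      case False
      then have "ln (\<bar>x\<bar>\<^sup>2) = 2 * ln \<bar>x\<bar>" by (subst ln_realpow) auto
      then show ?thesis by simp
    qed simp
    ultimately have "((\<lambda>s. ln \<bar>det (Lag.Jm s)\<bar>) has_vector_derivative \<theta> s) (at s within I)"
      by (simp only: has_real_derivative_iff_has_vector_derivative)
    from has_vector_derivative_diff[OF this w1[of s]] s
    show ?thesis unfolding l_def[abs_def] a_def \<phi>_def by auto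
  qed
  obtain \<theta>' where \<theta>': "(\<theta> has_vector_derivative \<theta>') (at t0 within I)"
    and \<theta>'_le: "\<theta>' \<le> - trace (curv (in_chart A ?c L) (Lag.z t0)) - (\<theta> t0)\<^sup>2 / n"
    using Lag.expansion_derivative[OF t0U] unfolding \<theta>_def[abs_def] assms(5) .
  have a': "(a has_vector_derivative \<theta>' - b') (at t0 within I)"
    unfolding a_def[abs_def] \<phi>_def[abs_def] by (rule has_vector_derivative_diff[OF \<theta>' w2])
  let ?E = "\<lambda>s. exp (c * l s)"
  have k_eq: "?k = (\<lambda>s. exp (?m * ?w s))" by (simp add: proper_factor_def[abs_def] assms(5))
  have E': "(?E has_vector_derivative ?E s * (c * a s)) (at s within I)" if "s \<in> I" "s \<in> ?UV" for s
    using l'[OF that] unfolding has_real_derivative_iff_has_vector_derivative[symmetric]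
    by (auto intro!: derivative_eq_intros)
  have k': "(?k has_vector_derivative ?k s * (?m * \<phi> s)) (at s within I)" if "s \<in> I" "s \<in> ?UV" for s
    using w1[of s] that n0 unfolding k_eq has_real_derivative_iff_has_vector_derivative[symmetric] \<phi>_def
    by (auto intro!: derivative_eq_intros)
  have first: "proper_deriv A I \<eta> \<psi> \<epsilon> \<xi> s = ?k s * (?E s * (c * a s))" if s: "s \<in> I" "s \<in> ?UV" for s
  proof -
    have "(\<xi> has_vector_derivative ?E s * (c * a s)) (at s within I)"
      by (rule has_vector_derivative_cong_open[OF E'[OF s] oUV s]) (simp add: \<xi>_eq)
    from vector_derivative_within[OF at_neq_bot[OF s(1)] this]
    show ?thesis by (simp add: proper_deriv_def)
  qed
  \<comment> \<open>Product rule: \<open>?k\<close> contributes the mixed term in \<open>?m\<close>,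
    the exponential contributes c a^2, and \<open>a\<close> contributes \<theta>' - b'.\<close>
  have "((\<lambda>s. ?k s * (?E s * (c * a s))) has_vector_derivative
      ?k t0 * (?E t0 * c * (?m * \<phi> t0 * a t0 + c * (a t0)\<^sup>2 + (\<theta>' - b')))) (at t0 within I)"
    using k'[OF t0 tUV] l'[OF t0 tUV] a' n0 unfolding has_real_derivative_iff_has_vector_derivative[symmetric]
    by (auto intro!: derivative_eq_intros simp: power2_eq_square algebra_simps)
  then have "(proper_deriv A I \<eta> \<psi> \<epsilon> \<xi> has_vector_derivative
      ?k t0 * (?E t0 * c * (?m * \<phi> t0 * a t0 + c * (a t0)\<^sup>2 + (\<theta>' - b')))) (at t0 within I)"
    by (rule has_vector_derivative_cong_open[OF _ oUV t0 tUV]) (simp add: first)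
  from vector_derivative_within[OF at_neq_bot[OF t0] this]
  have second: "proper_deriv A I \<eta> \<psi> \<epsilon> (proper_deriv A I \<eta> \<psi> \<epsilon> \<xi>) t0 =
      c * \<xi> t0 * ((?k t0)\<^sup>2 * (?m * \<phi> t0 * a t0 + c_const n N \<epsilon> * (a t0)\<^sup>2 + (\<theta>' - b')))"
    by (simp add: proper_deriv_def \<xi>_eq[OF t0 tUV] power2_eq_square assms(8)[symmetric])
  have "Lag.z t0 = (chart_map ?c (\<eta> t0), velocity A I \<eta> t0)"
    by (simp add: chart_lift_def velocity_def)
  then have "trace (curv (in_chart A ?c L) (Lag.z t0)) = Ric A L (\<eta> t0) (velocity A I \<eta> t0)"
    by (simp add: Ric_def Let_def)
  \<comment> \<open>The Raychaudhuri inequality with \<theta> written as a + \<phi>, in the shape of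
    the bound on \<open>d\<close> in \<open>ricci_bound\<close>.\<close>
  then have "\<theta>' - b' \<le> - Ric A L (\<eta> t0) (velocity A I \<eta> t0) - (a t0 + \<phi> t0)\<^sup>2 / n - b'"
    using \<theta>'_le by (simp add: a_def)
  moreover have "c * \<xi> t0 > 0" using c0 by (simp add: \<xi>_eq[OF t0 tUV])
  moreover note Ric_scale d1[folded \<phi>_def] d2
  ultimately show "ereal (proper_deriv A I \<eta> \<psi> \<epsilon> (proper_deriv A I \<eta> \<psi> \<epsilon> \<xi>) t0)
       \<le> - (ereal (c * \<xi> t0) * Ric_N A L X \<psi> N (\<eta> t0) (proper_velocity A I \<eta> \<psi> \<epsilon> t0))"
    unfolding second proper_velocity_def
    by (intro ricci_bound[OF assms(5,6,7) f])
qed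

end
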